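(* Let $\mathfrak g$ be a semi-simple real Lie algebra, $(\mathfrak g,\mathfrak h)$ a symmetric pair and $\mathfrak a_0\subset\mathfrak h^\perp\cap\mathfrak k^\perp$ a maximal abelian subspace. With the notation of the context, the following holds for every root space $\mathfrak g^\alpha$, $\alpha\in\Sigma_0=\Sigma(\mathfrak g,\mathfrak a_0)$: (1) $\mathfrak g^\alpha$ decomposes into finitely many $L$-orbits. In particular, there exists an open $L$-orbit, and hence $\mathfrak g^\alpha_{\mathbb C}$ is a prehomogeneous vector space. (2) For $\epsilon\in\{\pm\}$: if $\dim\mathfrak g^{\alpha,\epsilon}>1$, then $M^+$ acts transitively on the unit sphere of $\mathfrak g^{\alpha,\epsilon}$. (3) $\mathfrak g^\alpha$ is irreducible as a real representation of $L_\tau$.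
   Context: $\mathfrak h$ is the fixed point algebra of an involution $\sigma$ of $\mathfrak g$; $\theta$ is a Cartan involution of $\mathfrak g$ commuting with $\sigma$, with $\mathfrak k$ its $+1$-eigenspace; $\perp$ denotes orthogonal complement with respect to the Cartan–Killing form, so $\mathfrak k^\perp$ and $\mathfrak h^\perp$ are the $-1$-eigenspaces of $\theta$ and $\sigma$. $\mathfrak a_0$ is extended to a maximal abelian subspace $\mathfrak a\subset\mathfrak k^\perp$; $\Sigma\subset\mathfrak a^*$ is the restricted root system and $\Sigma_0=\Sigma|_{\mathfrak a_0}\setminus\{0\}$; for $\alpha\in\Sigma_0$, $\mathfrak g^\alpha=\{X\in\mathfrak g:[A,X]=\alpha(A)X\ \forall A\in\mathfrak a_0\}$. Put $\tau=\sigma\circ\theta$; it preserves each $\mathfrak g^\alpha$, and $\mathfrak g^{\alpha,\pm}$ denote its $\pm1$-eigenspaces in $\mathfrak g^\alpha$. Let $\mathfrak l=\mathfrak z_{\mathfrak g}(\mathfrak a_0)$ be the centralizer of $\mathfrak a_0$ in $\mathfrak g$, and $\mathfrak m^+$ the centralizer of $\mathfrak a_0$ in $\mathfrak k\cap\mathfrak h$. Let $G=\mathrm{Int}(\mathfrak g)$ be the adjoint group, $M^+\subset L\subset G$ the connected subgroups with Lie algebras $\mathfrak m^+\subset\mathfrak l$, and $L_\tau=L\rtimes\{\mathbf 1,\tau\}$. All these groups act naturally on $\mathfrak g^\alpha$, and $M^+$ preserves $\mathfrak g^{\alpha,\pm}$. The unit sphere is taken with respect to the inner product $-B(\cdot,\theta\,\cdot)$,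 $B$ the Cartan–Killing form. *)

theory Defs
  imports
    "HOL-Analysis.Analysis"
    "HOL-Algebra.Group_Action"
    "HOL-Algebra.Generated_Groups"
begin

text \<open>A finite-dimensional real Lie algebra is a bracket on a type of class
  \<open>euclidean_space\<close>. The class provides finite dimension and the vector space topology; its
  inner product is auxiliary and unrelated to the Killing form.\<close>

definition lie_algebra :: "('v::real_vector \<Rightarrow> 'v \<Rightarrow> 'v) \<Rightarrow> bool" where
  "lie_algebra br \<longleftrightarrow>
     (\<forall>x. linear (br x)) \<and> (\<forall>y. linear (\<lambda>x. br x y)) \<and>
     (\<forall>x. br x x = 0) \<and>
     (\<forall>x y z. br x (br y z) + br y (br z x) + br z (br x y) = 0)"

definition lie_ideal :: "('v::real_vector \<Rightarrow> 'v \<Rightarrow> 'v) \<Rightarrow> 'v set \<Rightarrow> bool" where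
  "lie_ideal br I \<longleftrightarrow> subspace I \<and> (\<forall>x. \<forall>y\<in>I. br x y \<in> I)"

definition derived_algebra :: "('v::real_vector \<Rightarrow> 'v \<Rightarrow> 'v) \<Rightarrow> 'v set \<Rightarrow> 'v set" where
  "derived_algebra br S = span {br x y | x y. x \<in> S \<and> y \<in> S}"

definition lie_solvable :: "('v::real_vector \<Rightarrow> 'v \<Rightarrow> 'v) \<Rightarrow> 'v set \<Rightarrow> bool" where
  "lie_solvable br S \<longleftrightarrow> (\<exists>n. (derived_algebra br ^^ n) S \<subseteq> {0})"

definition semisimple_lie_algebra :: "('v::real_vector \<Rightarrow> 'v \<Rightarrow> 'v) \<Rightarrow> bool" where
  "semisimple_lie_algebra br \<longleftrightarrow>
     lie_algebra br \<and> (\<forall>I. lie_ideal br I \<and> lie_solvable br I \<longrightarrow> I = {0})"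

text \<open>The sum does not depend on the choice of the (orthonormal) basis.\<close>

definition lin_trace :: "('v::euclidean_space \<Rightarrow> 'v) \<Rightarrow> real" where
  "lin_trace f = (\<Sum>b\<in>Basis. f b \<bullet> b)"

definition killing :: "('v::euclidean_space \<Rightarrow> 'v \<Rightarrow> 'v) \<Rightarrow> 'v \<Rightarrow> 'v \<Rightarrow> real" where
  "killing br x y = lin_trace (br x \<circ> br y)"

definition killing_perp :: "('v::euclidean_space \<Rightarrow> 'v \<Rightarrow> 'v) \<Rightarrow> 'v set \<Rightarrow> 'v set" where
  "killing_perp br S = {x. \<forall>y\<in>S. killing br x y = 0}"

text \<open>The identity is admitted as an involution: otherwise Riemannian and compact
  situations would need separate treatment.\<close>

definition lie_involution :: "('v::real_vector \<Rightarrow> 'v \<Rightarrow> 'v) \<Rightarrow> ('v \<Rightarrow> 'v) \<Rightarrow> bool" where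
  "lie_involution br \<sigma> \<longleftrightarrow>
     linear \<sigma> \<and> (\<forall>x y. \<sigma> (br x y) = br (\<sigma> x) (\<sigma> y)) \<and> (\<forall>x. \<sigma> (\<sigma> x) = x)"

definition symmetric_pair :: "('v::real_vector \<Rightarrow> 'v \<Rightarrow> 'v) \<Rightarrow> ('v \<Rightarrow> 'v) \<Rightarrow> 'v set \<Rightarrow> bool" where
  "symmetric_pair br \<sigma> \<hh> \<longleftrightarrow> lie_involution br \<sigma> \<and> \<hh> = {x. \<sigma> x = x}"

definition cartan_inner ::
  "('v::euclidean_space \<Rightarrow> 'v \<Rightarrow> 'v) \<Rightarrow> ('v \<Rightarrow> 'v) \<Rightarrow> 'v \<Rightarrow> 'v \<Rightarrow> real" where
  "cartan_inner br \<theta> x y = - killing br x (\<theta> y)"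

definition cartan_involution ::
  "('v::euclidean_space \<Rightarrow> 'v \<Rightarrow> 'v) \<Rightarrow> ('v \<Rightarrow> 'v) \<Rightarrow> bool" where
  "cartan_involution br \<theta> \<longleftrightarrow>
     lie_involution br \<theta> \<and> (\<forall>x. x \<noteq> 0 \<longrightarrow> cartan_inner br \<theta> x x > 0)"

definition abelian_subspace :: "('v::real_vector \<Rightarrow> 'v \<Rightarrow> 'v) \<Rightarrow> 'v set \<Rightarrow> bool" where
  "abelian_subspace br S \<longleftrightarrow> subspace S \<and> (\<forall>x\<in>S. \<forall>y\<in>S. br x y = 0)"

definition maximal_abelian_in ::
  "('v::real_vector \<Rightarrow> 'v \<Rightarrow> 'v) \<Rightarrow> 'v set \<Rightarrow> 'v set \<Rightarrow> bool" where
  "maximal_abelian_in br P S \<longleftrightarrow>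
     abelian_subspace br S \<and> S \<subseteq> P \<and>
     (\<forall>T. abelian_subspace br T \<and> T \<subseteq> P \<and> S \<subseteq> T \<longrightarrow> T = S)"

text \<open>A linear form on a subspace \<open>S\<close> is an extensional function on \<open>S\<close>, so that two forms are
  equal iff they agree on \<open>S\<close>.\<close>

definition dual_of :: "'v::real_vector set \<Rightarrow> ('v \<Rightarrow> real) set" where
  "dual_of S = {f \<in> extensional S.
     (\<forall>x\<in>S. \<forall>y\<in>S. f (x + y) = f x + f y) \<and> (\<forall>c. \<forall>x\<in>S. f (c *\<^sub>R x) = c * f x)}"

definition root_space ::
  "('v::real_vector \<Rightarrow> 'v \<Rightarrow> 'v) \<Rightarrow> 'v set \<Rightarrow> ('v \<Rightarrow> real) \<Rightarrow> 'v set" where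
  "root_space br S \<alpha> = {x. \<forall>A\<in>S. br A x = \<alpha> A *\<^sub>R x}"

definition restricted_roots ::
  "('v::real_vector \<Rightarrow> 'v \<Rightarrow> 'v) \<Rightarrow> 'v set \<Rightarrow> ('v \<Rightarrow> real) set" where
  "restricted_roots br \<aa> =
     {\<alpha> \<in> dual_of \<aa>. (\<exists>A\<in>\<aa>. \<alpha> A \<noteq> 0) \<and> root_space br \<aa> \<alpha> \<noteq> {0}}"

definition restricted_roots_to ::
  "('v::real_vector \<Rightarrow> 'v \<Rightarrow> 'v) \<Rightarrow> 'v set \<Rightarrow> 'v set \<Rightarrow> ('v \<Rightarrow> real) set" where
  "restricted_roots_to br \<aa> \<aa>0 =
     (\<lambda>\<alpha>. restrict \<alpha> \<aa>0) ` restricted_roots br \<aa> - {\<lambda>A\<in>\<aa>0. 0}"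

definition lie_centralizer ::
  "('v::real_vector \<Rightarrow> 'v \<Rightarrow> 'v) \<Rightarrow> 'v set \<Rightarrow> 'v set \<Rightarrow> 'v set" where
  "lie_centralizer br S T = {x \<in> S. \<forall>A\<in>T. br A x = 0}"

definition eigenpart :: "('v::real_vector \<Rightarrow> 'v) \<Rightarrow> 'v set \<Rightarrow> real \<Rightarrow> 'v set" where
  "eigenpart \<tau> V \<epsilon> = {x \<in> V. \<tau> x = \<epsilon> *\<^sub>R x}"

text \<open>The operator exponential, for endomorphisms that are plain functions.\<close>

definition lin_exp :: "('v::real_normed_vector \<Rightarrow> 'v) \<Rightarrow> 'v \<Rightarrow> 'v" where
  "lin_exp T x = (\<Sum>n. (T ^^ n) x /\<^sub>R fact n)"

text \<open>For a subalgebra \<open>S\<close>, the connected subgroup of the adjoint group with Lie algebra \<open>S\<close>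
  is the group of endomorphisms generated by all \<open>exp (ad X)\<close> with \<open>X \<in> S\<close>; here \<open>br X\<close> is
  \<open>ad X\<close>. For \<open>S = UNIV\<close> it is the adjoint group itself.\<close>

definition connected_subgroup ::
  "('v::real_normed_vector \<Rightarrow> 'v \<Rightarrow> 'v) \<Rightarrow> 'v set \<Rightarrow> ('v \<Rightarrow> 'v) monoid" where
  "connected_subgroup br S =
     (BijGroup UNIV)\<lparr>carrier := generate (BijGroup UNIV) ((\<lambda>X. lin_exp (br X)) ` S)\<rparr>"

definition semidirect ::
  "('a, 'c) monoid_scheme \<Rightarrow> ('b, 'd) monoid_scheme \<Rightarrow> ('b \<Rightarrow> 'a \<Rightarrow> 'a) \<Rightarrow> ('a \<times> 'b) monoid" where
  "semidirect N H \<phi> =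
     \<lparr>carrier = carrier N \<times> carrier H,
      mult = (\<lambda>(n, h) (n', h'). (n \<otimes>\<^bsub>N\<^esub> \<phi> h n', h \<otimes>\<^bsub>H\<^esub> h')),
      one = (\<one>\<^bsub>N\<^esub>, \<one>\<^bsub>H\<^esub>)\<rparr>"

text \<open>The group \<open>L \<rtimes> {1, \<tau>}\<close>, where \<open>{1, \<tau>}\<close> acts on \<open>L\<close> by conjugation.\<close>

definition extended_by ::
  "('v \<Rightarrow> 'v) monoid \<Rightarrow> ('v \<Rightarrow> 'v) \<Rightarrow> (('v \<Rightarrow> 'v) \<times> ('v \<Rightarrow> 'v)) monoid" where
  "extended_by L \<tau> =
     semidirect L ((BijGroup UNIV)\<lparr>carrier := {id, \<tau>}\<rparr>) (\<lambda>h n. h \<circ> n \<circ> inv_into UNIV h)"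

text \<open>Actions are extensional, as required by \<^locale>\<open>group_action\<close>.\<close>

definition natural_action :: "'v set \<Rightarrow> ('v \<Rightarrow> 'v) \<Rightarrow> 'v \<Rightarrow> 'v" where
  "natural_action V g = restrict g V"

definition extended_action :: "'v set \<Rightarrow> ('v \<Rightarrow> 'v) \<times> ('v \<Rightarrow> 'v) \<Rightarrow> 'v \<Rightarrow> 'v" where
  "extended_action V = (\<lambda>(n, h). restrict (n \<circ> h) V)"

definition real_representation ::
  "('a, 'c) monoid_scheme \<Rightarrow> 'v::real_vector set \<Rightarrow> ('a \<Rightarrow> 'v \<Rightarrow> 'v) \<Rightarrow> bool" where
  "real_representation G V \<phi> \<longleftrightarrow>
     subspace V \<and> group_action G V \<phi> \<and>
     (\<forall>g\<in>carrier G. (\<forall>x\<in>V. \<forall>y\<in>V. \<phi> g (x + y) = \<phi> g x + \<phi> g y) \<and>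
        (\<forall>c. \<forall>x\<in>V. \<phi> g (c *\<^sub>R x) = c *\<^sub>R \<phi> g x))"

definition irreducible_real_representation ::
  "('a, 'c) monoid_scheme \<Rightarrow> 'v::real_vector set \<Rightarrow> ('a \<Rightarrow> 'v \<Rightarrow> 'v) \<Rightarrow> bool" where
  "irreducible_real_representation G V \<phi> \<longleftrightarrow>
     real_representation G V \<phi> \<and> V \<noteq> {0} \<and>
     (\<forall>W. subspace W \<and> W \<subseteq> V \<and> (\<forall>g\<in>carrier G. \<phi> g ` W \<subseteq> W) \<longrightarrow> W = {0} \<or> W = V)"

text \<open>The complexification of a real space is the product with itself, \<open>(x, y)\<close> standing for
  \<open>x + \<i> y\<close>; a real subspace \<open>S\<close> has complexification \<open>S \<times> S\<close>.\<close>

definition cscale :: "complex \<Rightarrow> 'v::real_vector \<times> 'v \<Rightarrow> 'v \<times> 'v" where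
  "cscale c z = (Re c *\<^sub>R fst z - Im c *\<^sub>R snd z, Re c *\<^sub>R snd z + Im c *\<^sub>R fst z)"

definition complexify_bracket ::
  "('v::real_vector \<Rightarrow> 'v \<Rightarrow> 'v) \<Rightarrow> 'v \<times> 'v \<Rightarrow> 'v \<times> 'v \<Rightarrow> 'v \<times> 'v" where
  "complexify_bracket br z w =
     (br (fst z) (fst w) - br (snd z) (snd w), br (fst z) (snd w) + br (snd z) (fst w))"

definition complexify_space :: "'v set \<Rightarrow> ('v \<times> 'v) set" where
  "complexify_space S = S \<times> S"

inductive complex_polynomial :: "('v::real_vector \<times> 'v \<Rightarrow> complex) \<Rightarrow> bool" where
  linear: "\<lbrakk>\<And>z w. f (z + w) = f z + f w; \<And>c z. f (cscale c z) = c * f z\<rbrakk>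
             \<Longrightarrow> complex_polynomial f"
| const: "complex_polynomial (\<lambda>z. c)"
| add: "\<lbrakk>complex_polynomial f; complex_polynomial g\<rbrakk> \<Longrightarrow> complex_polynomial (\<lambda>z. f z + g z)"
| mult: "\<lbrakk>complex_polynomial f; complex_polynomial g\<rbrakk> \<Longrightarrow> complex_polynomial (\<lambda>z. f z * g z)"

definition zariski_open_in ::
  "('v::real_vector \<times> 'v) set \<Rightarrow> ('v \<times> 'v) set \<Rightarrow> bool" where
  "zariski_open_in V U \<longleftrightarrow>
     (\<exists>P. (\<forall>p\<in>P. complex_polynomial p) \<and> U = {z \<in> V. \<exists>p\<in>P. p z \<noteq> 0})"

definition complex_representation ::
  "('a, 'c) monoid_scheme \<Rightarrow> ('v::real_vector \<times> 'v) set \<Rightarrow>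
     ('a \<Rightarrow> 'v \<times> 'v \<Rightarrow> 'v \<times> 'v) \<Rightarrow> bool" where
  "complex_representation G V \<phi> \<longleftrightarrow>
     subspace V \<and> (\<forall>c. cscale c ` V \<subseteq> V) \<and> group_action G V \<phi> \<and>
     (\<forall>g\<in>carrier G. (\<forall>z\<in>V. \<forall>w\<in>V. \<phi> g (z + w) = \<phi> g z + \<phi> g w) \<and>
        (\<forall>c. \<forall>z\<in>V. \<phi> g (cscale c z) = cscale c (\<phi> g z)))"

text \<open>Orbits are nonempty and \<open>V\<close> is Zariski-irreducible, so a Zariski-open orbit is dense.\<close>

definition prehomogeneous ::
  "('a, 'c) monoid_scheme \<Rightarrow> ('v::real_vector \<times> 'v) set \<Rightarrow>
     ('a \<Rightarrow> 'v \<times> 'v \<Rightarrow> 'v \<times> 'v) \<Rightarrow> bool" where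
  "prehomogeneous G V \<phi> \<longleftrightarrow>
     complex_representation G V \<phi> \<and> (\<exists>U\<in>orbits G V \<phi>. zariski_open_in V U)"

definition unit_sphere ::
  "('v::euclidean_space \<Rightarrow> 'v \<Rightarrow> 'v) \<Rightarrow> ('v \<Rightarrow> 'v) \<Rightarrow> 'v set \<Rightarrow> 'v set" where
  "unit_sphere br \<theta> V = {x \<in> V. cartan_inner br \<theta> x x = 1}"

definition levi_group ::
  "('v::euclidean_space \<Rightarrow> 'v \<Rightarrow> 'v) \<Rightarrow> 'v set \<Rightarrow> ('v \<Rightarrow> 'v) monoid" where
  "levi_group br \<aa>0 = connected_subgroup br (lie_centralizer br UNIV \<aa>0)"

text \<open>The connected subgroup of the adjoint group of the complexified Lie algebra whose Lie
  algebra is the complexification of the centralizer of \<open>\<aa>0\<close>.\<close>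

definition complex_levi_group ::
  "('v::euclidean_space \<Rightarrow> 'v \<Rightarrow> 'v) \<Rightarrow> 'v set \<Rightarrow> ('v \<times> 'v \<Rightarrow> 'v \<times> 'v) monoid" where
  "complex_levi_group br \<aa>0 =
     connected_subgroup (complexify_bracket br) (complexify_space (lie_centralizer br UNIV \<aa>0))"

definition m_plus_group ::
  "('v::euclidean_space \<Rightarrow> 'v \<Rightarrow> 'v) \<Rightarrow> 'v set \<Rightarrow> 'v set \<Rightarrow> 'v set \<Rightarrow> ('v \<Rightarrow> 'v) monoid" where
  "m_plus_group br \<kk> \<hh> \<aa>0 = connected_subgroup br (lie_centralizer br (\<kk> \<inter> \<hh>) \<aa>0)"

end

theory Submission
  imports Defs "Jordan_Normal_Form.Determinant"
begin

text \<open>Write \<open>\<langle>X, Y\<rangle> = - B(X, \<theta> Y)\<close> and \<open>m(X) = [\<theta> X, X]\<close>. The kernel of \<open>ad (\<theta> X)\<close> on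
  \<open>\<gg>\<^sup>\<alpha>\<close> is the orthogonal complement of the tangent space \<open>[\<ll>, X]\<close> of the orbit of \<open>X\<close>, so every
  vector near \<open>X\<close> is \<open>L\<close>-conjugate to \<open>X + Y\<close> with \<open>Y\<close> small in this kernel. Along this slice the
  cross terms of \<open>m(X + Y)\<close> vanish and \<open>F = |m|\<^sup>2 / |\<cdot>|\<^sup>4\<close> has a strict local maximum at \<open>X\<close>.
  Hence the infimum of \<open>F\<close> over the closure of an orbit is attained on the orbit itself. A unit
  vector \<open>X\<close> at which \<open>F\<close> is minimal on its orbit is an eigenvector of \<open>ad m(X)\<close>, and the flow of
  \<open>- ad m(X)\<close>, rescaled to fix \<open>X\<close>, expands the slice. It therefore moves any other orbit passing close
  to \<open>X\<close> to points where \<open>F\<close> is smaller than \<open>F(X)\<close> by a fixed amount, so that minimal vectors near \<open>X\<close>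
  are conjugate to \<open>X\<close>. Minimal vectors form a compact set, so there are finitely many orbits.

  If \<open>X \<noteq> 0\<close> is an eigenvector of \<open>\<tau>\<close>, then \<open>m(X) \<in> \<aa>0\<close> by maximality of \<open>\<aa>0\<close>, and the slice
  through \<open>X\<close> is trivial: the orbit of \<open>X\<close> is open in \<open>\<gg>\<^sup>\<alpha>\<close>, and the multiples of its \<open>M\<^sup>+\<close>-orbit are
  open in the eigenspace. Connectedness of the punctured eigenspace gives transitivity on the
  sphere, and an invariant subspace contains an eigenvector of \<open>\<tau>\<close>, hence an open set. Over the
  complex numbers \<open>[\<ll>, X] = \<gg>\<^sup>\<alpha>\<close> persists on the nonvanishing locus of a determinant, and that locus
  lies in one orbit because a complex line minus finitely many points is connected.\<close>

section \<open>Exponentials of linear operators\<close>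

text \<open>A copy of the bounded operators that is a Banach algebra, so that the results of the library on
  \<^const>\<open>exp\<close> apply.\<close>

typedef (overloaded) 'a endo = "UNIV :: ('a::euclidean_space \<Rightarrow>\<^sub>L 'a) set"
  morphisms blinfun_of_endo endo_of_blinfun ..

setup_lifting type_definition_endo

instantiation endo :: (euclidean_space) real_normed_vector
begin

lift_definition zero_endo :: "'a endo" is 0 .
lift_definition plus_endo :: "'a endo \<Rightarrow> 'a endo \<Rightarrow> 'a endo" is "(+)" .
lift_definition minus_endo :: "'a endo \<Rightarrow> 'a endo \<Rightarrow> 'a endo" is "(-)" .
lift_definition uminus_endo :: "'a endo \<Rightarrow> 'a endo" is uminus .
lift_definition scaleR_endo :: "real \<Rightarrow> 'a endo \<Rightarrow> 'a endo" is "(*\<^sub>R)" .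
lift_definition norm_endo :: "'a endo \<Rightarrow> real" is norm .
lift_definition dist_endo :: "'a endo \<Rightarrow> 'a endo \<Rightarrow> real" is dist .
lift_definition sgn_endo :: "'a endo \<Rightarrow> 'a endo" is sgn .

definition uniformity_endo :: "('a endo \<times> 'a endo) filter" where
  "uniformity_endo = (INF e\<in>{0<..}. principal {(x, y). dist x y < e})"

definition open_endo :: "'a endo set \<Rightarrow> bool" where
  "open_endo U \<longleftrightarrow> (\<forall>x\<in>U. eventually (\<lambda>(x', y). x' = x \<longrightarrow> y \<in> U) uniformity)"

instance
proof
  fix a b c :: "'a endo" and r s :: real and U :: "'a endo set"
  show "a + b + c = a + (b + c)" by transfer simp
  show "a + b = b + a" by transfer simp
  show "0 + a = a" by transfer simp
  show "- a + a = 0" by transfer simp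
  show "a - b = a + - b" by transfer simp
  show "r *\<^sub>R (a + b) = r *\<^sub>R a + r *\<^sub>R b" by transfer (simp add: scaleR_right_distrib)
  show "(r + s) *\<^sub>R a = r *\<^sub>R a + s *\<^sub>R a" by transfer (simp add: scaleR_left_distrib)
  show "r *\<^sub>R s *\<^sub>R a = (r * s) *\<^sub>R a" by transfer simp
  show "1 *\<^sub>R a = a" by transfer simp
  show "dist a b = norm (a - b)" by transfer (simp add: dist_norm)
  show "sgn a = inverse (norm a) *\<^sub>R a" by transfer (simp add: sgn_div_norm)
  show "uniformity = (INF e\<in>{0<..}. principal {(x, y :: 'a endo). dist x y < e})"
    by (rule uniformity_endo_def)
  show "open U = (\<forall>x\<in>U. eventually (\<lambda>(x', y). x' = x \<longrightarrow> y \<in> U) uniformity)"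
    by (rule open_endo_def)
  show "norm a = 0 \<longleftrightarrow> a = 0" by transfer simp
  show "norm (a + b) \<le> norm a + norm b" by transfer (rule norm_triangle_ineq)
  show "norm (r *\<^sub>R a) = \<bar>r\<bar> * norm a" by transfer simp
qed

end

instantiation endo :: (euclidean_space) real_normed_algebra_1
begin

lift_definition one_endo :: "'a endo" is id_blinfun .
lift_definition times_endo :: "'a endo \<Rightarrow> 'a endo \<Rightarrow> 'a endo" is "(o\<^sub>L)" .

instance
proof
  fix a b c :: "'a endo" and r :: real
  show "a * b * c = a * (b * c)" by transfer (rule blinfun_eqI, simp)
  show "1 * a = a" by transfer (rule blinfun_eqI, simp)
  show "a * 1 = a" by transfer (rule blinfun_eqI, simp)
  show "(a + b) * c = a * c + b * c" by transfer (rule blinfun_eqI, simp add: blinfun.bilinear_simps)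
  show "a * (b + c) = a * b + a * c" by transfer (rule blinfun_eqI, simp add: blinfun.bilinear_simps)
  show "r *\<^sub>R a * b = r *\<^sub>R (a * b)" by transfer (rule blinfun_eqI, simp add: blinfun.bilinear_simps)
  show "a * r *\<^sub>R b = r *\<^sub>R (a * b)" by transfer (rule blinfun_eqI, simp add: blinfun.bilinear_simps)
  show "norm (a * b) \<le> norm a * norm b" by transfer (rule norm_blinfun_compose)
  show "norm (1::'a endo) = 1" by transfer (rule norm_blinfun_id)
  then show "(0::'a endo) \<noteq> 1" by (metis norm_zero zero_neq_one)
qed

end

instance endo :: (euclidean_space) banach
proof
  fix X :: "nat \<Rightarrow> 'a endo"
  assume "Cauchy X"
  then have "Cauchy (\<lambda>n. blinfun_of_endo (X n))"
    unfolding Cauchy_def by transfer simp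
  then obtain B where B: "(\<lambda>n. blinfun_of_endo (X n)) \<longlonglongrightarrow> B"
    using Cauchy_convergent_iff convergent_def by blast
  have "X \<longlonglongrightarrow> endo_of_blinfun B"
    using B unfolding lim_sequentially
    by (simp add: dist_endo.rep_eq endo_of_blinfun_inverse)
  then show "convergent X" by (auto simp: convergent_def)
qed

lift_definition endo_app :: "'a::euclidean_space endo \<Rightarrow> 'a \<Rightarrow> 'a" is blinfun_apply .

definition endo_of :: "('a::euclidean_space \<Rightarrow> 'a) \<Rightarrow> 'a endo" where
  "endo_of T = endo_of_blinfun (Blinfun T)"

lemma endo_app_endo_of: "linear T \<Longrightarrow> endo_app (endo_of T) = T"
  by (simp add: endo_app_def endo_of_def endo_of_blinfun_inverse bounded_linear_Blinfun_apply
      linear_conv_bounded_linear)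

lemma endo_eqI: "(\<And>x. endo_app A x = endo_app B x) \<Longrightarrow> A = B"
  by transfer (rule blinfun_eqI)

lemma bounded_bilinear_endo_app: "bounded_bilinear endo_app"
proof
  show "endo_app (a + a') b = endo_app a b + endo_app a' b" for a a' :: "'a endo" and b
    by transfer (simp add: blinfun.bilinear_simps)
  show "endo_app a (b + b') = endo_app a b + endo_app a b'" for a :: "'a endo" and b b'
    by transfer (simp add: blinfun.bilinear_simps)
  show "endo_app (r *\<^sub>R a) b = r *\<^sub>R endo_app a b" for r and a :: "'a endo" and b
    by transfer (simp add: blinfun.bilinear_simps)
  show "endo_app a (r *\<^sub>R b) = r *\<^sub>R endo_app a b" for r and a :: "'a endo" and b
    by transfer (simp add: blinfun.bilinear_simps)
  show "\<exists>K. \<forall>(a::'a endo) b. norm (endo_app a b) \<le> norm a * norm b * K"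
    by (rule exI[of _ 1], transfer) (simp add: norm_blinfun)
qed

interpretation endo_app: bounded_bilinear endo_app
  by (rule bounded_bilinear_endo_app)

lemma endo_app_simps [simp]:
  "endo_app 1 x = x" "endo_app (A * B) x = endo_app A (endo_app B x)"
  by (transfer, simp)+

lemma linear_endo_app: "linear (endo_app A)"
  using endo_app.bounded_linear_right bounded_linear.linear by blast

lemma endo_app_power: "endo_app (A ^ n) x = (endo_app A ^^ n) x"
  by (induction n) auto

lemma linear_endo_of:
  assumes "\<And>Z. linear (f Z)" "\<And>x. linear (\<lambda>Z. f Z x)"
  shows "linear (\<lambda>Z. endo_of (f Z))"
  by (rule linearI; rule endo_eqI)
    (simp_all add: endo_app_endo_of assms endo_app.add_left endo_app.scaleR_left linear_add[OF assms(2)]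
      linear_scale[OF assms(2)])

subsection \<open>The operator exponential\<close>

text \<open>Evaluation at \<open>x\<close> is bounded linear on endomorphisms, so it carries the
  exponential series of the Banach algebra to the pointwise series defining
  \<open>lin_exp\<close>.\<close>

lemma lin_exp_sums:
  fixes T :: "'a::euclidean_space \<Rightarrow> 'a"
  assumes "linear T"
  shows "(\<lambda>n. (T ^^ n) x /\<^sub>R fact n) sums endo_app (exp (endo_of T)) x"
proof -
  have "(\<lambda>n. endo_app (endo_of T ^ n /\<^sub>R fact n) x) sums endo_app (exp (endo_of T)) x"
    by (rule bounded_linear.sums[OF endo_app.bounded_linear_left exp_converges])
  then show ?thesis
    by (simp add: endo_app.scaleR_left endo_app_power endo_app_endo_of[OF assms])
qed

lemma lin_exp_eq: "linear (T :: 'a::euclidean_space \<Rightarrow> 'a) \<Longrightarrow> lin_exp T = endo_app (exp (endo_of T))"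
  by (rule ext) (simp add: lin_exp_def sums_unique[OF lin_exp_sums, symmetric])

lemma linear_lin_exp: "linear (T :: 'a::euclidean_space \<Rightarrow> 'a) \<Longrightarrow> linear (lin_exp T)"
  by (simp add: lin_exp_eq linear_endo_app)

lemma endo_of_add:
  "linear (S :: 'a::euclidean_space \<Rightarrow> 'a) \<Longrightarrow> linear T \<Longrightarrow> endo_of (\<lambda>x. S x + T x) = endo_of S + endo_of T"
  by (rule endo_eqI) (simp add: endo_app.add_left endo_app_endo_of linear_compose_add)

lemma endo_of_scaleR:
  "linear (T :: 'a::euclidean_space \<Rightarrow> 'a) \<Longrightarrow> endo_of (\<lambda>x. c *\<^sub>R T x) = c *\<^sub>R endo_of T"
  by (rule endo_eqI) (simp add: endo_app.scaleR_left endo_app_endo_of linear_compose_scale_right)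

lemma lin_exp_add:
  fixes S T :: "'a::euclidean_space \<Rightarrow> 'a"
  assumes "linear S" "linear T" "\<And>x. S (T x) = T (S x)"
  shows "lin_exp (\<lambda>x. S x + T x) x = lin_exp S (lin_exp T x)"
proof -
  have "endo_of S * endo_of T = endo_of T * endo_of S"
    by (rule endo_eqI) (simp add: endo_app_endo_of assms)
  then show ?thesis
    by (simp add: lin_exp_eq assms linear_compose_add endo_of_add exp_add_commuting)
qed

lemma lin_exp_zero: "lin_exp (\<lambda>x. 0) x = (x :: 'a :: euclidean_space)"
proof -
  have "endo_of (\<lambda>x. 0) = (0 :: 'a endo)"
    by (rule endo_eqI) (simp add: endo_app_endo_of linear_zero endo_app.zero_left)
  then show ?thesis by (simp add: lin_exp_eq linear_zero)
qed

lemma lin_exp_minus: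
  fixes T :: "'a::euclidean_space \<Rightarrow> 'a"
  assumes "linear T"
  shows "lin_exp T (lin_exp (\<lambda>x. - T x) x) = x" "lin_exp (\<lambda>x. - T x) (lin_exp T x) = x"
proof -
  have *: "linear (\<lambda>x. - T x)" by (simp add: assms linear_compose_neg)
  show "lin_exp T (lin_exp (\<lambda>x. - T x) x) = x"
    using lin_exp_add[OF assms *, of x] by (simp add: lin_exp_zero linear_neg[OF assms])
  show "lin_exp (\<lambda>x. - T x) (lin_exp T x) = x"
    using lin_exp_add[OF * assms, of x] by (simp add: lin_exp_zero linear_neg[OF assms])
qed

lemma lin_exp_eigenvector:
  fixes T :: "'a::euclidean_space \<Rightarrow> 'a"
  assumes "linear T" "T x = c *\<^sub>R x"
  shows "lin_exp T x = exp c *\<^sub>R x"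
proof -
  have "(T ^^ n) x = c ^ n *\<^sub>R x" for n
    by (induction n) (simp_all add: linear_scale[OF assms(1)] assms(2))
  then have "(\<lambda>n. (c ^ n /\<^sub>R fact n) *\<^sub>R x) sums lin_exp T x"
    using lin_exp_sums[OF assms(1), of x] by (simp add: lin_exp_eq[OF assms(1)])
  moreover have "(\<lambda>n. (c ^ n /\<^sub>R fact n) *\<^sub>R x) sums (exp c *\<^sub>R x)"
    by (rule sums_scaleR_left[OF exp_converges])
  ultimately show ?thesis by (rule sums_unique2)
qed

text \<open>All partial sums of the series stay in \<open>V\<close>, and a subspace in finite
  dimension is closed.\<close>

lemma lin_exp_in_subspace:
  fixes T :: "'a::euclidean_space \<Rightarrow> 'a"
  assumes "linear T" "subspace V" "\<And>x. x \<in> V \<Longrightarrow> T x \<in> V" "x \<in> V"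
  shows "lin_exp T x \<in> V"
proof -
  have "(T ^^ n) x \<in> V" for n
    by (induction n) (auto simp: assms)
  then have "(\<Sum>i<n. (T ^^ i) x /\<^sub>R fact i) \<in> V" for n
    by (intro subspace_sum subspace_scale assms)
  moreover have "(\<lambda>n. \<Sum>i<n. (T ^^ i) x /\<^sub>R fact i) \<longlonglongrightarrow> lin_exp T x"
    using lin_exp_sums[OF assms(1), of x] by (simp add: sums_def lin_exp_eq[OF assms(1)])
  ultimately show ?thesis
    by (rule closed_sequentially[OF closed_subspace[OF assms(2)]])
qed

text \<open>\<open>f\<close> intertwines all powers, hence the two series term by term. It serves
  for conjugation by \<open>\<tau>\<close> and for commutation with complex scalars.\<close>

lemma lin_exp_intertwine:
  fixes T :: "'a::euclidean_space \<Rightarrow> 'a" and S :: "'b::euclidean_space \<Rightarrow> 'b"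
  assumes "linear T" "linear S" "linear f" "\<And>x. f (T x) = S (f x)"
  shows "f (lin_exp T x) = lin_exp S (f x)"
proof -
  have "f ((T ^^ n) x) = (S ^^ n) (f x)" for n
    by (induction n) (simp_all add: assms)
  then have "(\<lambda>n. (S ^^ n) (f x) /\<^sub>R fact n) sums f (lin_exp T x)"
    using bounded_linear.sums[OF linear_conv_bounded_linear[THEN iffD1, OF assms(3)]
        lin_exp_sums[OF assms(1), of x]]
    by (simp add: lin_exp_eq[OF assms(1)] linear_scale[OF assms(3)])
  moreover have "(\<lambda>n. (S ^^ n) (f x) /\<^sub>R fact n) sums lin_exp S (f x)"
    using lin_exp_sums[OF assms(2), of "f x"] by (simp add: lin_exp_eq[OF assms(2)])
  ultimately show ?thesis by (rule sums_unique2)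
qed

lemma lin_exp_has_vector_derivative:
  fixes T :: "'a::euclidean_space \<Rightarrow> 'a"
  assumes "linear T"
  shows "((\<lambda>t. lin_exp (\<lambda>x. t *\<^sub>R T x) x) has_vector_derivative T (lin_exp (\<lambda>x. t *\<^sub>R T x) x)) (at t)"
proof -
  have 1: "lin_exp (\<lambda>x. t *\<^sub>R T x) x = endo_app (exp (t *\<^sub>R endo_of T)) x" for t
    by (simp add: lin_exp_eq assms linear_compose_scale_right endo_of_scaleR)
  have "((\<lambda>t. endo_app (exp (t *\<^sub>R endo_of T)) x) has_vector_derivative
      endo_app (endo_of T * exp (t *\<^sub>R endo_of T)) x) (at t)"
    by (rule bounded_linear.has_vector_derivative[OF endo_app.bounded_linear_left
          exp_scaleR_has_vector_derivative_left])
  then show ?thesis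
    by (simp add: 1 endo_app_endo_of assms)
qed

text \<open>On a ball of radius \<open>r\<close> the series is dominated by
  \<open>r ^ n / fact n\<close>, so it converges uniformly there.\<close>

lemma continuous_on_exp_algebra:
  "continuous_on UNIV (exp :: 'a::{real_normed_algebra_1,banach} \<Rightarrow> 'a)"
proof -
  have "continuous_on (ball 0 r) (exp :: 'a \<Rightarrow> 'a)" for r :: real
  proof (cases "r > 0")
    case True
    have "uniform_limit (ball 0 r) (\<lambda>n x::'a. \<Sum>i<n. x ^ i /\<^sub>R fact i) (\<lambda>x. \<Sum>i. x ^ i /\<^sub>R fact i) sequentially"
    proof (rule Weierstrass_m_test)
      fix n and x :: 'a assume "x \<in> ball 0 r"
      then have "norm (x ^ n) \<le> r ^ n"
        using norm_power_ineq[of x n] power_mono[of "norm x" r n] by simp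
      then show "norm (x ^ n /\<^sub>R fact n) \<le> r ^ n /\<^sub>R fact n"
        by (simp add: divide_simps)
    next
      show "summable (\<lambda>n. r ^ n /\<^sub>R fact n)" by (rule summable_exp_generic)
    qed
    then have "continuous_on (ball 0 r) (\<lambda>x::'a. \<Sum>i. x ^ i /\<^sub>R fact i)"
      by (rule uniform_limit_theorem[rotated]) (auto intro!: continuous_intros always_eventually)
    then show ?thesis by (simp add: exp_def)
  qed (simp add: ball_eq_empty[THEN iffD2])
  then have "continuous_on (\<Union>r. ball 0 r) (exp :: 'a \<Rightarrow> 'a)"
    by (intro continuous_on_open_UN) auto
  also have "(\<Union>r. ball 0 r) = (UNIV :: 'a set)"
    by (auto intro: gt_ex)
  finally show ?thesis .
qed

text \<open>The terms of order at least two are dominated by those of the real exponential at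
  \<open>norm h\<close>, whose sum is at most \<open>(norm h)\<^sup>2\<close> for
  \<open>norm h \<le> 1\<close>.\<close>

lemma exp_has_derivative_at_zero:
  "((exp :: 'a::{real_normed_algebra_1,banach} \<Rightarrow> 'a) has_derivative (\<lambda>h. h)) (at 0)"
proof -
  have bound: "norm (exp h - 1 - h) \<le> (norm h)\<^sup>2" if "norm h \<le> 1" for h :: 'a
  proof -
    have sm: "summable (\<lambda>n. inverse (fact (n + 2)) *\<^sub>R norm h ^ (n + 2))"
      using summable_ignore_initial_segment[OF summable_exp_generic[of "norm h"], of 2]
      by (simp add: field_simps)
    have "norm (exp h - 1 - h) = norm (\<Sum>n. inverse (fact (n + 2)) *\<^sub>R h ^ (n + 2))"
      by (subst exp_first_two_terms) simp
    also have "\<dots> \<le> (\<Sum>n. inverse (fact (n + 2)) *\<^sub>R norm h ^ (n + 2))"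
      by (rule norm_suminf_le[OF _ sm]) (simp add: norm_power_ineq divide_right_mono del: power_Suc fact_Suc)
    also have "\<dots> = exp (norm h) - 1 - norm h"
      by (subst exp_first_two_terms) simp
    also have "\<dots> \<le> (norm h)\<^sup>2" using exp_bound[of "norm h"] that by simp
    finally show ?thesis .
  qed
  show ?thesis
    unfolding has_derivative_at_alt
  proof (intro conjI allI impI)
    show "bounded_linear (\<lambda>h::'a. h)" by (rule bounded_linear_ident)
    fix e :: real assume e: "e > 0"
    have "norm (exp y - exp 0 - (y - 0)) \<le> e * norm (y - 0)" if "norm (y - 0) < min e 1" for y :: 'a
    proof -
      have "norm (exp y - 1 - y) \<le> norm y * norm y"
        using bound[of y] that by (simp add: power2_eq_square)
      also have "\<dots> \<le> e * norm y" using that by (intro mult_right_mono) auto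
      finally show ?thesis by simp
    qed
    then show "\<exists>d>0. \<forall>y::'a. norm (y - 0) < d \<longrightarrow> norm (exp y - exp 0 - (y - 0)) \<le> e * norm (y - 0)"
      using e by (intro exI[of _ "min e 1"]) auto
  qed
qed

subsection \<open>Local slices for linear group actions\<close>

lemma linear_projection_exists:
  fixes V :: "'v::real_vector set"
  assumes "subspace V"
  obtains p where "linear p" "range p \<subseteq> V" "\<And>x. x \<in> V \<Longrightarrow> p x = x"
proof -
  have "linear (\<lambda>x::'v. x)" by (rule linear_ident)
  from real_vector.linear_exists_left_inverse_on[OF this assms]
  show ?thesis using that by (auto simp: inj_on_def)
qed

text \<open>By transversality the map taking \<open>(Z, Y, w)\<close> to
  \<open>exp (ad Z) (x0 + Y) + w\<close> has a surjective derivative at 0, so Sussmann's open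
  mapping theorem covers a ball around \<open>x0\<close>. The summand \<open>w\<close>, from a
  complement of \<open>V\<close>, makes the target the whole space; it vanishes over points of
  \<open>V\<close>.\<close>

lemma exp_ad_slice:
  fixes br :: "'v::euclidean_space \<Rightarrow> 'v \<Rightarrow> 'v"
  assumes br: "bilinear br"
    and L: "subspace L" and V: "subspace V" and S: "subspace S" "S \<subseteq> V"
    and x0: "x0 \<in> V"
    and LV: "\<And>Z x. Z \<in> L \<Longrightarrow> x \<in> V \<Longrightarrow> br Z x \<in> V"
    and transversal: "\<And>v. v \<in> V \<Longrightarrow> \<exists>Z\<in>L. \<exists>Y\<in>S. v = br Z x0 + Y"
    and \<epsilon>: "\<epsilon> > 0"
  shows "\<exists>\<delta>>0. \<forall>x\<in>V. dist x x0 < \<delta> \<longrightarrow>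
           (\<exists>Z\<in>L. \<exists>Y\<in>S. norm Y < \<epsilon> \<and> x = lin_exp (br Z) (x0 + Y))"
proof -
  have lin1: "linear (br x)" and lin2: "linear (\<lambda>z. br z x)" for x
    using br by (auto simp: bilinear_def)
  \<comment> \<open>Projections onto \<open>L\<close>, \<open>S\<close> and \<open>V\<close> allow
    the map to be defined on a full product space.\<close>
  obtain p where p: "linear p" "range p \<subseteq> L" "\<And>x. x \<in> L \<Longrightarrow> p x = x"
    using linear_projection_exists[OF L] by blast
  obtain q where q: "linear q" "range q \<subseteq> S" "\<And>x. x \<in> S \<Longrightarrow> q x = x"
    using linear_projection_exists[OF S(1)] by blast
  obtain s where s: "linear s" "range s \<subseteq> V" "\<And>x. x \<in> V \<Longrightarrow> s x = x"
    using linear_projection_exists[OF V] by blast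
  define r where "r x = x - s x" for x
  have r: "linear r" unfolding r_def by (intro linear_compose_sub linear_ident s)
  have blp: "bounded_linear p" and blq: "bounded_linear q" and blr: "bounded_linear r"
    using p(1) q(1) r by (simp_all add: linear_conv_bounded_linear)
  define A where "A w = endo_of (br (p (fst w)))" for w :: "'v \<times> 'v \<times> 'v"
  have "linear (\<lambda>z. endo_of (br z))" by (rule linear_endo_of[OF lin1 lin2])
  then have "bounded_linear (\<lambda>z. endo_of (br z))" by (simp add: linear_conv_bounded_linear)
  then have blA: "bounded_linear A"
    unfolding A_def
    by (rule bounded_linear_compose[OF _ bounded_linear_compose[OF blp bounded_linear_fst]])
  have A0: "A 0 = 0" by (rule linear_0[OF bounded_linear.linear[OF blA]])
  have blq2: "bounded_linear (\<lambda>w :: 'v \<times> 'v \<times> 'v. q (fst (snd w)))"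
    by (rule bounded_linear_compose[OF blq bounded_linear_compose[OF bounded_linear_fst bounded_linear_snd]])
  have blr2: "bounded_linear (\<lambda>w :: 'v \<times> 'v \<times> 'v. r (snd (snd w)))"
    by (rule bounded_linear_compose[OF blr bounded_linear_compose[OF bounded_linear_snd bounded_linear_snd]])
  define f where "f w = endo_app (exp (A w)) (x0 + q (fst (snd w))) + r (snd (snd w))"
    for w :: "'v \<times> 'v \<times> 'v"
  define f' where "f' w = br (p (fst w)) x0 + q (fst (snd w)) + r (snd (snd w))"
    for w :: "'v \<times> 'v \<times> 'v"
  have f_eq: "f w = lin_exp (br (p (fst w))) (x0 + q (fst (snd w))) + r (snd (snd w))" for w
    by (simp add: f_def A_def lin_exp_eq[OF lin1])
  have dA: "((\<lambda>w. exp (A w)) has_derivative A) (at 0)"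
    by (rule has_derivative_compose[of A A 0 UNIV exp "\<lambda>h. h", simplified])
      (simp_all add: A0 exp_has_derivative_at_zero bounded_linear_imp_has_derivative[OF blA])
  have dq: "((\<lambda>w :: 'v \<times> 'v \<times> 'v. x0 + q (fst (snd w))) has_derivative (\<lambda>w. q (fst (snd w)))) (at 0)"
    using has_derivative_add[OF has_derivative_const bounded_linear_imp_has_derivative[OF blq2]] by simp
  have "(f has_derivative f') (at 0)"
  proof -
    have "((\<lambda>w. endo_app (exp (A w)) (x0 + q (fst (snd w))) + r (snd (snd w))) has_derivative
        (\<lambda>h. endo_app (exp (A 0)) (q (fst (snd h))) +
          endo_app (A h) (x0 + q (fst (snd (0 :: 'v \<times> 'v \<times> 'v)))) + r (snd (snd h)))) (at 0)"
      by (rule has_derivative_add[OF endo_app.FDERIV[OF dA dq] bounded_linear_imp_has_derivative[OF blr2]])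
    then show ?thesis
      by (simp add: f_def[abs_def] f'_def[abs_def] A0 linear_0[OF q(1)])
        (simp add: A_def endo_app_endo_of[OF lin1] add.commute add.left_commute)
  qed
  moreover have lf': "linear f'"
    by (rule bounded_linear.linear[OF has_derivative_bounded_linear[OF calculation]])
  moreover have "surj f'"
  proof -
    have "\<exists>w. f' w = v" for v
    proof -
      have "s v \<in> V" using s by auto
      from transversal[OF this] obtain Z Y where ZY: "Z \<in> L" "Y \<in> S" "s v = br Z x0 + Y" by blast
      have "s (r v) = 0" by (simp add: r_def linear_diff[OF s(1)] s(3)[OF \<open>s v \<in> V\<close>])
      then have "r (r v) = r v" by (simp add: r_def[of "r v"])
      then have "f' (Z, Y, r v) = v"
        using ZY by (simp add: f'_def p(3) q(3)) (simp add: r_def)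
      then show ?thesis by blast
    qed
    then show ?thesis by (metis surjI)
  qed
  then obtain g' where g': "linear g'" "f' \<circ> g' = id"
    using linear_surjective_right_inverse[OF lf'] by blast
  \<comment> \<open>The bound on \<open>norm Y\<close> is built into the open set whose image is
    taken.\<close>
  define T where "T = {w :: 'v \<times> 'v \<times> 'v. norm (q (fst (snd w))) < \<epsilon>}"
  have "open T"
    unfolding T_def
    by (intro open_Collect_less continuous_intros linear_continuous_on blq2)
  moreover have "0 \<in> T" by (simp add: T_def linear_0[OF q(1)] \<epsilon>)
  ultimately have "0 \<in> interior T" by (simp add: interior_open)
  moreover have "continuous_on UNIV f"
    unfolding f_def
    by (intro continuous_on_add endo_app.continuous_on continuous_on_compose2[OF continuous_on_exp_algebra]
        linear_continuous_on blA blq2 blr2 continuous_intros) auto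
  ultimately have "f 0 \<in> interior (f ` T)"
    using sussmann_open_mapping[of UNIV f 0 f' g' T] \<open>(f has_derivative f') (at 0)\<close> g'
    by (simp add: linear_conv_bounded_linear)
  moreover have "f 0 = x0"
    by (simp add: f_def A0 linear_0[OF q(1)] linear_0[OF r])
  ultimately obtain \<delta> where \<delta>: "\<delta> > 0" "ball x0 \<delta> \<subseteq> f ` T"
    by (auto simp: mem_interior)
  show ?thesis
  proof (intro exI[of _ \<delta>] conjI ballI impI)
    fix x assume x: "x \<in> V" "dist x x0 < \<delta>"
    then have "x \<in> f ` T" using \<delta> by (auto simp: dist_commute)
    then obtain Z Y w where *: "norm (q Y) < \<epsilon>" "x = lin_exp (br (p Z)) (x0 + q Y) + r w"
      by (auto simp: T_def f_eq)
    have pq: "p Z \<in> L" "q Y \<in> S" using p q by auto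
    then have "x0 + q Y \<in> V" using x0 V S by (auto intro: subspace_add)
    then have "lin_exp (br (p Z)) (x0 + q Y) \<in> V"
      using pq LV by (intro lin_exp_in_subspace lin1 V) auto
    then have "r w \<in> V" using x * V by (metis add_diff_cancel_left' subspace_diff)
    \<comment> \<open>\<open>s\<close> fixes \<open>V\<close> but annihilates the range of
      \<open>r\<close>, so a value of \<open>r\<close> lying in \<open>V\<close> is 0.\<close>
    then have "r w = s (r w)" by (simp add: s)
    also have "\<dots> = s w - s (s w)" by (simp add: r_def linear_diff[OF s(1)])
    also have "s (s w) = s w" using s(2) by (intro s(3)) auto
    finally have "r w = 0" by simp
    then show "\<exists>Z\<in>L. \<exists>Y\<in>S. norm Y < \<epsilon> \<and> x = lin_exp (br Z) (x0 + Y)"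
      using * pq by auto
  qed (use \<delta> in auto)
qed

subsection \<open>Groups generated by exponentials\<close>

lemma mult_BijGroup_UNIV:
  "f \<in> Bij UNIV \<Longrightarrow> g \<in> Bij UNIV \<Longrightarrow> f \<otimes>\<^bsub>BijGroup UNIV\<^esub> g = f \<circ> g"
  by (auto simp: BijGroup_def compose_def)

lemma one_BijGroup_UNIV: "\<one>\<^bsub>BijGroup UNIV\<^esub> = id"
  by (auto simp: BijGroup_def)

lemma carrier_BijGroup_UNIV: "carrier (BijGroup UNIV) = {f. bij f}"
  by (auto simp: BijGroup_def Bij_def)

lemma bij_lin_exp: "linear (T :: 'v::euclidean_space \<Rightarrow> 'v) \<Longrightarrow> bij (lin_exp T)"
  by (rule o_bij[of "lin_exp (\<lambda>x. - T x)"]) (auto simp: lin_exp_minus)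

text \<open>This is what makes the operators \<open>lin_exp (br X)\<close>, for
  \<open>X \<in> S\<close>, a set of linear bijections closed under inverses.\<close>

definition ad_system :: "('v::euclidean_space \<Rightarrow> 'v \<Rightarrow> 'v) \<Rightarrow> 'v set \<Rightarrow> bool" where
  "ad_system br S \<longleftrightarrow> (\<forall>x. linear (br x)) \<and> (\<forall>x\<in>S. - x \<in> S \<and> br (- x) = (\<lambda>y. - br x y))"

lemma ad_systemI:
  assumes "bilinear br" "subspace S"
  shows "ad_system br S"
  using assms linear_neg[of "\<lambda>x. br x _"] by (auto simp: ad_system_def bilinear_def subspace_neg)

lemma inv_lin_exp_BijGroup:
  fixes T :: "'v::euclidean_space \<Rightarrow> 'v"
  assumes "linear T"
  shows "inv\<^bsub>BijGroup UNIV\<^esub> (lin_exp T) = lin_exp (\<lambda>x. - T x)"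
proof -
  interpret group "BijGroup (UNIV :: 'v set)" by (rule group_BijGroup)
  have b: "bij (lin_exp T)" "bij (lin_exp (\<lambda>x. - T x))"
    using assms by (auto intro!: bij_lin_exp linear_compose_neg)
  show ?thesis
    by (rule inv_equality)
      (use b in \<open>auto simp: carrier_BijGroup_UNIV one_BijGroup_UNIV mult_BijGroup_UNIV Bij_def
          lin_exp_minus[OF assms]\<close>)
qed

lemma connected_subgroup_group:
  assumes "ad_system br S"
  shows "subgroup (carrier (connected_subgroup br S)) (BijGroup UNIV)" "group (connected_subgroup br S)"
proof -
  interpret group "BijGroup (UNIV :: 'a set)" by (rule group_BijGroup)
  have "(\<lambda>X. lin_exp (br X)) ` S \<subseteq> carrier (BijGroup UNIV)"
    using assms by (auto simp: carrier_BijGroup_UNIV ad_system_def bij_lin_exp)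
  then show *: "subgroup (carrier (connected_subgroup br S)) (BijGroup UNIV)"
    by (simp add: connected_subgroup_def generate_is_subgroup)
  show "group (connected_subgroup br S)"
    using subgroup_imp_group[OF *] by (simp add: connected_subgroup_def)
qed

text \<open>The inverse of \<open>lin_exp (br X)\<close> is \<open>lin_exp (br (- X))\<close>, again
  a generator, so no case for inverses arises.\<close>

lemma connected_subgroup_induct [consumes 2, case_names one exp comp]:
  assumes g: "g \<in> carrier (connected_subgroup br S)" and S: "ad_system br S"
    and "id": "P id"
    and exp: "\<And>X. X \<in> S \<Longrightarrow> P (lin_exp (br X))"
    and comp: "\<And>g h. g \<in> carrier (connected_subgroup br S) \<Longrightarrow> h \<in> carrier (connected_subgroup br S)
           \<Longrightarrow> P g \<Longrightarrow> P h \<Longrightarrow> P (g \<circ> h)"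
  shows "P g"
proof -
  have sub: "generate (BijGroup UNIV) ((\<lambda>X. lin_exp (br X)) ` S) \<subseteq> Bij UNIV"
    using subgroup.subset[OF connected_subgroup_group(1)[OF S]]
    by (simp add: connected_subgroup_def BijGroup_def)
  have lin: "linear (br x)" for x using S by (auto simp: ad_system_def)
  have "g \<in> generate (BijGroup UNIV) ((\<lambda>X. lin_exp (br X)) ` S)"
    using g by (simp add: connected_subgroup_def)
  then show ?thesis
  proof induction
    case one
    show ?case unfolding one_BijGroup_UNIV by (rule "id")
  next
    case (incl h)
    then show ?case using exp by auto
  next
    case (inv h)
    then obtain X where X: "X \<in> S" "h = lin_exp (br X)" by auto
    then have "inv\<^bsub>BijGroup UNIV\<^esub> h = lin_exp (br (- X))"
      using S by (simp add: inv_lin_exp_BijGroup[OF lin] ad_system_def)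
    then show ?case using exp[of "- X"] X S by (auto simp: ad_system_def)
  next
    case (eng h1 h2)
    then have "h1 \<in> carrier (connected_subgroup br S)" "h2 \<in> carrier (connected_subgroup br S)"
      by (simp_all add: connected_subgroup_def)
    then have "P (h1 \<circ> h2)" using comp eng by blast
    moreover have "h1 \<otimes>\<^bsub>BijGroup UNIV\<^esub> h2 = h1 \<circ> h2"
      using eng sub by (intro mult_BijGroup_UNIV) auto
    ultimately show ?case by (simp only:)
  qed
qed

context
  fixes br :: "'v::euclidean_space \<Rightarrow> 'v \<Rightarrow> 'v" and S
  assumes S: "ad_system br S"
begin

lemma connected_subgroup_mult:
  assumes "g \<in> carrier (connected_subgroup br S)" "h \<in> carrier (connected_subgroup br S)"
  shows "g \<otimes>\<^bsub>connected_subgroup br S\<^esub> h = g \<circ> h"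
proof -
  have "g \<in> Bij UNIV" "h \<in> Bij UNIV"
    using subgroup.subset[OF connected_subgroup_group(1)[OF S]] assms by (auto simp: BijGroup_def)
  then show ?thesis by (simp add: mult_BijGroup_UNIV connected_subgroup_def)
qed

lemma connected_subgroup_comp:
  assumes "g \<in> carrier (connected_subgroup br S)" "h \<in> carrier (connected_subgroup br S)"
  shows "g \<circ> h \<in> carrier (connected_subgroup br S)"
  using group.is_monoid[OF connected_subgroup_group(2)[OF S]] assms
  by (metis connected_subgroup_mult monoid.m_closed)

lemma connected_subgroup_exp: "X \<in> S \<Longrightarrow> lin_exp (br X) \<in> carrier (connected_subgroup br S)"
  by (auto simp: connected_subgroup_def intro: generate.incl)

lemma connected_subgroup_id: "id \<in> carrier (connected_subgroup br S)"
  using generate.one[of "BijGroup UNIV"] by (simp add: connected_subgroup_def one_BijGroup_UNIV)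

lemma connected_subgroup_linear:
  assumes "g \<in> carrier (connected_subgroup br S)"
  shows "linear g"
  using assms S
proof (induction rule: connected_subgroup_induct)
  case one
  show ?case by (rule linear_id)
next
  case (exp X)
  then show ?case using S by (simp add: ad_system_def linear_lin_exp)
next
  case (comp g h)
  then show ?case by (intro linear_compose)
qed

lemma connected_subgroup_inverse:
  assumes "g \<in> carrier (connected_subgroup br S)"
  shows "\<exists>h\<in>carrier (connected_subgroup br S). (\<forall>x. h (g x) = x) \<and> (\<forall>x. g (h x) = x)"
proof -
  interpret G: group "connected_subgroup br S" by (rule connected_subgroup_group(2)[OF S])
  have h: "inv\<^bsub>connected_subgroup br S\<^esub> g \<in> carrier (connected_subgroup br S)" using assms by simp
  have one: "\<one>\<^bsub>connected_subgroup br S\<^esub> = id"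
    by (simp add: connected_subgroup_def one_BijGroup_UNIV)
  show ?thesis
    using G.l_inv[OF assms] G.r_inv[OF assms] h assms
    by (intro bexI[OF _ h]) (auto simp: connected_subgroup_mult one fun_eq_iff)
qed

text \<open>Stated for sets, so that it serves root spaces and unit spheres alike.\<close>

lemma connected_subgroup_preserves:
  assumes "g \<in> carrier (connected_subgroup br S)"
    and "\<And>X x. X \<in> S \<Longrightarrow> x \<in> E \<Longrightarrow> lin_exp (br X) x \<in> E" "x \<in> E"
  shows "g x \<in> E"
proof -
  have "\<forall>x\<in>E. g x \<in> E" using assms(1) S
    by (induction rule: connected_subgroup_induct) (simp_all add: assms(2))
  then show ?thesis using assms by blast
qed

lemma connected_subgroup_action:
  assumes "\<And>X x. X \<in> S \<Longrightarrow> x \<in> E \<Longrightarrow> lin_exp (br X) x \<in> E"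
  shows "group_action (connected_subgroup br S) E (natural_action E)"
proof -
  interpret G: group "connected_subgroup br S" by (rule connected_subgroup_group(2)[OF S])
  interpret B: group "BijGroup E" by (rule group_BijGroup)
  have pres: "g x \<in> E" if "g \<in> carrier (connected_subgroup br S)" "x \<in> E" for g x
    using connected_subgroup_preserves[OF that(1) assms that(2)] .
  have bij: "natural_action E g \<in> Bij E" if g: "g \<in> carrier (connected_subgroup br S)" for g
  proof -
    obtain h where h: "h \<in> carrier (connected_subgroup br S)" "\<And>x. h (g x) = x" "\<And>x. g (h x) = x"
      using connected_subgroup_inverse[OF g] by blast
    have "bij_betw g E E"
      by (rule bij_betw_byWitness[of E h g E]) (auto simp: h pres[OF g] pres[OF h(1)])
    then have "bij_betw (natural_action E g) E E"
      by (simp add: natural_action_def cong: bij_betw_cong)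
    then show ?thesis by (simp add: Bij_def natural_action_def)
  qed
  have "natural_action E \<in> hom (connected_subgroup br S) (BijGroup E)"
  proof (rule homI)
    fix g assume "g \<in> carrier (connected_subgroup br S)"
    then show "natural_action E g \<in> carrier (BijGroup E)" using bij by (simp add: BijGroup_def)
  next
    fix g h assume gh: "g \<in> carrier (connected_subgroup br S)" "h \<in> carrier (connected_subgroup br S)"
    then have "natural_action E g \<otimes>\<^bsub>BijGroup E\<^esub> natural_action E h
        = compose E (natural_action E g) (natural_action E h)"
      using bij by (simp add: BijGroup_def)
    also have "\<dots> = natural_action E (g \<circ> h)"
      using pres[OF gh(2)] by (auto simp: natural_action_def compose_def restrict_def)
    finally show "natural_action E (g \<otimes>\<^bsub>connected_subgroup br S\<^esub> h) =
        natural_action E g \<otimes>\<^bsub>BijGroup E\<^esub> natural_action E h"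
      using gh by (simp add: connected_subgroup_mult)
  qed
  then show ?thesis
    by (auto simp: group_action_def group_hom_def group_hom_axioms_def G.is_group B.is_group)
qed

lemma orbit_natural_action:
  "x \<in> E \<Longrightarrow> orbit (connected_subgroup br S) (natural_action E) x =
     {g x | g. g \<in> carrier (connected_subgroup br S)}"
  by (auto simp: orbit_def natural_action_def)

end

section \<open>Finiteness of the number of orbits\<close>

subsection \<open>Traces and the Killing form\<close>

text \<open>Expanding \<open>g b\<close> in the basis gives a double sum over matrix entries;
  exchanging the sums exchanges \<open>f\<close> and \<open>g\<close>, whence the cyclicity of the
  trace.\<close>

lemma lin_trace_comp:
  assumes "linear f" "linear g"
  shows "lin_trace (f \<circ> g) = (\<Sum>b\<in>Basis. \<Sum>c\<in>Basis. inner (g b) c * inner (f c) b)"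
proof -
  have "inner (f (g b)) b = (\<Sum>c\<in>Basis. inner (g b) c * inner (f c) b)" for b
  proof -
    have "f (g b) = f (\<Sum>c\<in>Basis. inner (g b) c *\<^sub>R c)" by (simp add: euclidean_representation)
    also have "\<dots> = (\<Sum>c\<in>Basis. inner (g b) c *\<^sub>R f c)"
      by (simp add: linear_sum[OF assms(1)] linear_scale[OF assms(1)])
    finally show ?thesis by (simp add: inner_sum_left)
  qed
  then show ?thesis by (simp add: lin_trace_def)
qed

lemma lin_trace_commute:
  assumes "linear f" "linear g"
  shows "lin_trace (f \<circ> g) = lin_trace (g \<circ> f)"
  unfolding lin_trace_comp[OF assms] lin_trace_comp[OF assms(2,1)]
  by (subst sum.swap) (simp add: mult.commute)

lemma lin_trace_linear:
  "lin_trace (\<lambda>x. f x + g x) = lin_trace f + lin_trace g"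
  "lin_trace (\<lambda>x. f x - g x) = lin_trace f - lin_trace g"
  "lin_trace (\<lambda>x. c *\<^sub>R f x) = c * lin_trace f"
  by (simp_all add: lin_trace_def inner_add_left inner_diff_left sum.distrib sum_subtractf sum_distrib_left)

lemma lie_algebra_bilinear: "lie_algebra br \<Longrightarrow> bilinear br"
  by (simp add: lie_algebra_def bilinear_def)

locale real_lie_algebra =
  fixes br :: "'g::euclidean_space \<Rightarrow> 'g \<Rightarrow> 'g"
  assumes lie: "lie_algebra br"
begin

lemma br_linear: "linear (br x)" "linear (\<lambda>z. br z x)"
  using lie by (auto simp: lie_algebra_def)

lemmas br_simps =
  linear_add[OF br_linear(1)] linear_add[OF br_linear(2)]
  linear_diff[OF br_linear(1)] linear_diff[OF br_linear(2)]
  linear_neg[OF br_linear(1)] linear_neg[OF br_linear(2)]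
  linear_scale[OF br_linear(1)] linear_scale[OF br_linear(2)]
  linear_0[OF br_linear(1)] linear_0[OF br_linear(2)]

lemma br_self [simp]: "br x x = 0"
  using lie by (auto simp: lie_algebra_def)

lemma br_anticommute: "br x y = - br y x"
proof -
  have "br (x + y) (x + y) = 0" by (rule br_self)
  then have "br x y + br y x = 0" unfolding br_simps by (simp only: br_self add_0 add_0_right add.commute)
  then show ?thesis by (rule eq_neg_iff_add_eq_0[THEN iffD2])
qed

lemma jacobi: "br x (br y z) = br (br x y) z + br y (br x z)"
proof -
  have "br x (br y z) + br y (br z x) + br z (br x y) = 0"
    using lie by (auto simp: lie_algebra_def)
  moreover have "br y (br z x) = - br y (br x z)"
    using br_anticommute[of z x] by (simp add: br_simps)
  moreover have "br z (br x y) = - br (br x y) z" by (rule br_anticommute)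
  ultimately show ?thesis by (simp add: algebra_simps)
qed

lemma killing_commute: "killing br x y = killing br y x"
  unfolding killing_def by (rule lin_trace_commute[OF br_linear(1) br_linear(1)])

lemma killing_linear_left:
  "killing br (x + y) z = killing br x z + killing br y z"
  "killing br (x - y) z = killing br x z - killing br y z"
  "killing br (c *\<^sub>R x) z = c * killing br x z"
  by (simp_all add: killing_def comp_def br_simps lin_trace_linear)

lemma killing_linear_right:
  "killing br z (x + y) = killing br z x + killing br z y"
  "killing br z (x - y) = killing br z x - killing br z y"
  "killing br z (c *\<^sub>R x) = c * killing br z x"
  unfolding killing_commute[of z] by (rule killing_linear_left)+

text \<open>\<open>ad (br x y)\<close> is the commutator of \<open>ad x\<close> and
  \<open>ad y\<close>, and cyclicity of the trace moves the leading \<open>ad y\<close> of the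
  second product to its end.\<close>

lemma killing_invariant: "killing br (br x y) z = killing br x (br y z)"
proof -
  have ad: "br (br u v) w = br u (br v w) - br v (br u w)" for u v w
    by (simp add: jacobi[of u v w])
  have lin: "linear (\<lambda>w. br u (br v w))" for u v
    using linear_compose[OF br_linear(1) br_linear(1)] by (simp add: comp_def)
  have "killing br (br x y) z =
      lin_trace (\<lambda>w. br x (br y (br z w))) - lin_trace (\<lambda>w. br y (br x (br z w)))"
    by (simp add: killing_def comp_def ad lin_trace_linear)
  also have "lin_trace (\<lambda>w. br y (br x (br z w))) = lin_trace (\<lambda>w. br x (br z (br y w)))"
    using lin_trace_commute[OF br_linear(1)[of y] lin[of x z]] by (simp add: comp_def)
  also have "lin_trace (\<lambda>w. br x (br y (br z w))) - lin_trace (\<lambda>w. br x (br z (br y w)))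
      = killing br x (br y z)"
    by (simp add: killing_def comp_def ad br_simps lin_trace_linear)
  finally show ?thesis .
qed

text \<open>\<open>ad (\<phi> x)\<close> is the conjugate of \<open>ad x\<close> by
  \<open>\<phi>\<close>, and traces are invariant under conjugation.\<close>

lemma killing_involution:
  assumes "lie_involution br \<phi>"
  shows "killing br (\<phi> x) (\<phi> y) = killing br x y"
proof -
  have \<phi>: "linear \<phi>" "\<phi> (\<phi> z) = z" "\<phi> (br u v) = br (\<phi> u) (\<phi> v)" for z u v
    using assms by (auto simp: lie_involution_def)
  have l: "linear (br x \<circ> br y \<circ> \<phi>)" by (intro linear_compose br_linear \<phi>)
  have "br (\<phi> x) \<circ> br (\<phi> y) = \<phi> \<circ> (br x \<circ> br y \<circ> \<phi>)" by (auto simp: \<phi> fun_eq_iff)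
  then have "killing br (\<phi> x) (\<phi> y) = lin_trace ((br x \<circ> br y \<circ> \<phi>) \<circ> \<phi>)"
    unfolding killing_def by (simp only: lin_trace_commute[OF \<phi>(1) l])
  also have "(br x \<circ> br y \<circ> \<phi>) \<circ> \<phi> = br x \<circ> br y" by (simp add: \<phi> fun_eq_iff)
  finally show ?thesis unfolding killing_def .
qed

end

section \<open>Cartan involutions and the associated inner product\<close>

locale cartan_pair = real_lie_algebra br for br :: "'g::euclidean_space \<Rightarrow> 'g \<Rightarrow> 'g" +
  fixes \<theta> :: "'g \<Rightarrow> 'g"
  assumes cartan: "cartan_involution br \<theta>"
begin

abbreviation ip :: "'g \<Rightarrow> 'g \<Rightarrow> real" where "ip \<equiv> cartan_inner br \<theta>"

lemma theta: "linear \<theta>" "\<theta> (\<theta> z) = z" "\<theta> (br u v) = br (\<theta> u) (\<theta> v)"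
  using cartan by (auto simp: cartan_involution_def lie_involution_def)

lemmas theta_simps = theta(2) linear_add[OF theta(1)] linear_diff[OF theta(1)]
  linear_neg[OF theta(1)] linear_scale[OF theta(1)] linear_0[OF theta(1)]

lemma ip_pos: "x \<noteq> 0 \<Longrightarrow> ip x x > 0"
  using cartan by (auto simp: cartan_involution_def)

lemma ip_commute: "ip x y = ip y x"
proof -
  have "killing br x (\<theta> y) = killing br (\<theta> x) (\<theta> (\<theta> y))"
    using cartan by (simp add: killing_involution cartan_involution_def)
  then show ?thesis by (simp add: cartan_inner_def theta killing_commute)
qed

lemma bilinear_ip: "bilinear ip"
  unfolding bilinear_def
  by (intro conjI allI linearI)
    (simp_all add: cartan_inner_def killing_linear_left killing_linear_right theta_simps)

lemmas ip_simps =
  bilinear_ladd[OF bilinear_ip] bilinear_radd[OF bilinear_ip]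
  bilinear_lsub[OF bilinear_ip] bilinear_rsub[OF bilinear_ip]
  bilinear_lneg[OF bilinear_ip] bilinear_rneg[OF bilinear_ip]
  bilinear_lmul[OF bilinear_ip] bilinear_rmul[OF bilinear_ip]
  bilinear_lzero[OF bilinear_ip] bilinear_rzero[OF bilinear_ip]

lemma ip_nonneg: "ip x x \<ge> 0"
  by (cases "x = 0") (auto simp: ip_simps less_imp_le ip_pos)

lemma ip_eq_0_iff: "ip x x = 0 \<longleftrightarrow> x = 0"
  by (metis ip_pos ip_simps(9) less_irrefl)

text \<open>Invariance of the Killing form, read through the automorphism \<open>\<theta>\<close>,
  makes \<open>- ad (\<theta> x)\<close> the adjoint of \<open>ad x\<close>.\<close>

lemma ip_br: "ip (br x y) z = - ip y (br (\<theta> x) z)"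
proof -
  have "ip (br x y) z = killing br (br y x) (\<theta> z)"
    using killing_linear_left(3)[of "-1" "br y x" "\<theta> z"]
    by (simp add: cartan_inner_def br_anticommute[of x y])
  then show ?thesis by (simp add: killing_invariant cartan_inner_def theta)
qed

text \<open>Gram-Schmidt for \<open>ip\<close>, which is unrelated to the inner product of the type
  class. The induction runs over a finite spanning set; each new vector is first made orthogonal to
  the span of the old ones.\<close>

lemma ip_decomposition:
  assumes V: "subspace V" and U: "subspace U" "U \<subseteq> V" and v: "v \<in> V"
  shows "\<exists>u\<in>U. \<exists>s\<in>V. v = u + s \<and> (\<forall>y\<in>U. ip s y = 0)"
proof -
  have fin: "\<forall>v. \<exists>u\<in>span B. \<forall>y\<in>span B. ip (v - u) y = 0" if "finite B" for B
    using that
  proof induction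
    case empty
    then show ?case by (auto simp: ip_simps)
  next
    case (insert x B)
    obtain ux where ux: "ux \<in> span B" "\<forall>y\<in>span B. ip (x - ux) y = 0" using insert.IH by blast
    define x' where "x' = x - ux"
    have x': "x' \<in> span (insert x B)" "\<And>y. y \<in> span B \<Longrightarrow> ip x' y = 0" "\<And>y. y \<in> span B \<Longrightarrow> ip y x' = 0"
      using ux span_mono[of B "insert x B"]
      by (auto simp: x'_def ip_commute[of _ "x - ux"] intro!: span_diff intro: span_base)
    show ?case
    proof
      fix v
      obtain uv where uv: "uv \<in> span B" "\<forall>y\<in>span B. ip (v - uv) y = 0" using insert.IH by blast
      \<comment> \<open>For \<open>x' = 0\<close> the quotient is 0 by convention, and the identity
        below reads 0 = 0.\<close>
      define c where "c = ip (v - uv) x' / ip x' x'"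
      have c: "ip (v - uv) x' = c * ip x' x'"
        using ip_eq_0_iff[of x'] by (cases "x' = 0") (auto simp: c_def ip_simps)
      have "uv + c *\<^sub>R x' \<in> span (insert x B)"
        using uv x' span_mono[of B "insert x B"] by (intro span_add span_scale) auto
      moreover have "ip (v - (uv + c *\<^sub>R x')) y = 0" if "y \<in> span (insert x B)" for y
      proof -
        obtain k where k: "y - k *\<^sub>R x \<in> span B" using \<open>y \<in> span (insert x B)\<close> unfolding span_insert by blast
        define w where "w = y - k *\<^sub>R x'"
        have "w = (y - k *\<^sub>R x) + k *\<^sub>R ux" by (simp add: w_def x'_def algebra_simps)
        then have w: "w \<in> span B" using k ux by (auto intro!: span_add span_scale)
        have "y = w + k *\<^sub>R x'" by (simp add: w_def)
        then have "ip (v - (uv + c *\<^sub>R x')) y = ip (v - uv) w - c * ip x' w + k * (ip (v - uv) x' - c * ip x' x')"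
          by (simp add: ip_simps algebra_simps)
        then show ?thesis using uv w x' c by simp
      qed
      ultimately show "\<exists>u\<in>span (insert x B). \<forall>y\<in>span (insert x B). ip (v - u) y = 0" by blast
    qed
  qed
  obtain B where "finite B" "span B = U"
    using finiteI_independent basis_subspace_exists[OF U(1)] by metis
  with fin[of B] obtain u where "u \<in> U" "\<forall>y\<in>U. ip (v - u) y = 0" by blast
  then show ?thesis
    using U v V by (intro bexI[of _ u] bexI[of _ "v - u"]) (auto intro: subspace_diff)
qed

lemma bounded_bilinear_ip: "bounded_bilinear ip"
  using bilinear_ip by (simp add: bilinear_conv_bounded_bilinear)

lemma bounded_bilinear_br: "bounded_bilinear br"
  using lie_algebra_bilinear[OF lie] by (simp add: bilinear_conv_bounded_bilinear)

lemma continuous_on_ip [continuous_intros]: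
  "continuous_on S f \<Longrightarrow> continuous_on S g \<Longrightarrow> continuous_on S (\<lambda>x. ip (f x) (g x))"
  by (rule bounded_bilinear.continuous_on[OF bounded_bilinear_ip])

lemma continuous_on_br [continuous_intros]:
  "continuous_on S f \<Longrightarrow> continuous_on S g \<Longrightarrow> continuous_on S (\<lambda>x. br (f x) (g x))"
  by (rule bounded_bilinear.continuous_on[OF bounded_bilinear_br])

lemma continuous_on_theta [continuous_intros]:
  "continuous_on S f \<Longrightarrow> continuous_on S (\<lambda>x. \<theta> (f x))"
  by (rule continuous_on_compose2[OF linear_continuous_on[OF
        linear_conv_bounded_linear[THEN iffD1, OF theta(1)], of UNIV]]) auto

text \<open>The lower constant is the minimum of \<open>ip x x\<close> on the compact unit sphere,
  spread to all vectors by homogeneity.\<close>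

lemma ip_norm_bounds:
  "\<exists>c>0. \<exists>C>0. \<forall>x. c * (norm x)\<^sup>2 \<le> ip x x \<and> ip x x \<le> C * (norm x)\<^sup>2"
proof -
  obtain C where C: "C > 0" "\<And>x y. norm (ip x y) \<le> norm x * norm y * C"
    using bounded_bilinear.pos_bounded[OF bounded_bilinear_ip] by blast
  have "ip x x \<le> C * (norm x)\<^sup>2" for x
    using C(2)[of x x] by (simp add: power2_eq_square mult.commute)
  moreover have "\<exists>z\<in>sphere (0::'g) 1. \<forall>x\<in>sphere 0 1. ip z z \<le> ip x x"
    by (rule continuous_attains_inf) (auto intro!: continuous_intros)
  then obtain z where z: "norm z = 1" "\<And>x. norm x = 1 \<Longrightarrow> ip z z \<le> ip x x" by auto
  have "ip z z * (norm x)\<^sup>2 \<le> ip x x" for x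
  proof (cases "x = 0")
    case False
    have "ip z z \<le> ip (x /\<^sub>R norm x) (x /\<^sub>R norm x)" using False by (intro z) simp
    then show ?thesis using False by (simp add: ip_simps field_simps power2_eq_square)
  qed (simp add: ip_simps)
  moreover have "ip z z > 0" using z by (intro ip_pos) auto
  ultimately show ?thesis using C(1) by blast
qed

lemma compact_ip_sphere:
  assumes "subspace V"
  shows "compact {x \<in> V. ip x x = 1}"
proof -
  obtain c C where c: "c > 0" "\<And>x. c * (norm x)\<^sup>2 \<le> ip x x"
    using ip_norm_bounds by blast
  have "norm x \<le> 1 + 1 / c" if "ip x x = 1" for x
  proof -
    have "(norm x)\<^sup>2 \<le> 1 / c" using c(2)[of x] c(1) that by (simp add: field_simps)
    moreover have "norm x \<le> 1 + (norm x)\<^sup>2"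
    proof -
      have "2 * norm x \<le> (norm x)\<^sup>2 + 1"
        using zero_le_power2[of "norm x - 1"] by (simp add: power2_diff)
      then show ?thesis using norm_ge_zero[of x] by linarith
    qed
    ultimately show ?thesis by simp
  qed
  then have "bounded {x \<in> V. ip x x = 1}" by (auto simp: bounded_iff)
  moreover have "closed {x. ip x x = 1}"
    by (intro closed_Collect_eq continuous_intros)
  then have "closed (V \<inter> {x. ip x x = 1})" using closed_subspace[OF assms] by blast
  moreover have "V \<inter> {x. ip x x = 1} = {x \<in> V. ip x x = 1}" by blast
  ultimately show ?thesis by (metis compact_eq_bounded_closed)
qed

text \<open>\<open>br (\<theta> Y) Y\<close> is quadratic in \<open>Y\<close>, so its squared length
  is quartic.\<close>

lemma bounded_quartic:
  obtains C where "C > 0" "\<And>Y. ip (br (\<theta> Y) Y) (br (\<theta> Y) Y) \<le> C * (ip Y Y)\<^sup>2"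
proof -
  obtain c C where c: "c > 0" "C > 0" "\<And>x. c * (norm x)\<^sup>2 \<le> ip x x" "\<And>x. ip x x \<le> C * (norm x)\<^sup>2"
    using ip_norm_bounds by blast
  obtain K where K: "K > 0" "\<And>x y. norm (br x y) \<le> norm x * norm y * K"
    using bounded_bilinear.pos_bounded[OF bounded_bilinear_br] by blast
  obtain M where M: "M > 0" "\<And>x. norm (\<theta> x) \<le> norm x * M"
    using bounded_linear.pos_bounded theta(1) linear_conv_bounded_linear by blast
  have "ip (br (\<theta> Y) Y) (br (\<theta> Y) Y) \<le> (C * (M * K)\<^sup>2 / c\<^sup>2) * (ip Y Y)\<^sup>2" for Y
  proof -
    have "norm (br (\<theta> Y) Y) \<le> norm (\<theta> Y) * norm Y * K" by (rule K)
    also have "\<dots> \<le> norm Y * M * norm Y * K" using M K by (intro mult_right_mono) auto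
    also have "\<dots> = (M * K) * (norm Y)\<^sup>2" by (simp add: power2_eq_square)
    also have "\<dots> \<le> (M * K) * (ip Y Y / c)" using c(1,3) M K by (intro mult_left_mono) (auto simp: field_simps)
    finally have "(norm (br (\<theta> Y) Y))\<^sup>2 \<le> ((M * K) * (ip Y Y / c))\<^sup>2" by (intro power_mono) auto
    then have "C * (norm (br (\<theta> Y) Y))\<^sup>2 \<le> C * ((M * K) * (ip Y Y / c))\<^sup>2" using c by simp
    then show ?thesis using c(4)[of "br (\<theta> Y) Y"] by (simp add: power_mult_distrib power_divide)
  qed
  then show ?thesis using that[of "C * (M * K)\<^sup>2 / c\<^sup>2"] c K M by simp
qed

text \<open>The component \<open>s\<close> orthogonal to all \<open>br Z X\<close> is killed by
  \<open>ad (\<theta> X)\<close>: for \<open>T = br (\<theta> X) s\<close> one finds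
  \<open>ip T T = ip s (br T X) = 0\<close>, as \<open>T \<in> L\<close>. \<open>L\<close> and
  \<open>V\<close> stay general because the argument recurs for the \<open>\<tau>\<close>-fixed part
  of the centralizer acting on an eigenspace of \<open>\<tau>\<close>.\<close>

lemma tangent_decomposition:
  assumes L: "subspace L" and V: "subspace V"
    and LV: "\<And>Z. Z \<in> L \<Longrightarrow> br Z X \<in> V"
    and VL: "\<And>s. s \<in> V \<Longrightarrow> br (\<theta> X) s \<in> L"
    and v: "v \<in> V"
  shows "\<exists>Z\<in>L. \<exists>Y\<in>{Y \<in> V. br (\<theta> X) Y = 0}. v = br Z X + Y"
proof -
  have "subspace ((\<lambda>Z. br Z X) ` L)"
    by (rule linear_subspace_image[OF br_linear(2) L])
  from ip_decomposition[OF V this _ v] LV obtain Z s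
    where Zs: "Z \<in> L" "s \<in> V" "v = br Z X + s" "\<And>Z. Z \<in> L \<Longrightarrow> ip s (br Z X) = 0"
    by blast
  define T where "T = br (\<theta> X) s"
  have "T \<in> L" using Zs VL by (simp add: T_def)
  have "ip T T = - ip s (br X T)" by (subst (1) T_def) (simp add: ip_br theta)
  also have "\<dots> = ip s (br T X)" by (simp add: br_anticommute[of X T] ip_simps)
  also have "\<dots> = 0" by (rule Zs(4)[OF \<open>T \<in> L\<close>])
  finally have "T = 0" by (simp add: ip_eq_0_iff)
  then show ?thesis using Zs by (auto simp: T_def)
qed

end

section \<open>Root spaces, the centralizer of \<open>\<aa>0\<close> and the moment map\<close>

locale cartan_grading = cartan_pair br \<theta> for br :: "'g::euclidean_space \<Rightarrow> 'g \<Rightarrow> 'g" and \<theta> +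
  fixes \<aa>0 :: "'g set" and \<alpha> :: "'g \<Rightarrow> real"
  assumes theta_a0: "A \<in> \<aa>0 \<Longrightarrow> \<theta> A = - A"
    and a0_subspace: "subspace \<aa>0"
    and a0_abelian: "A \<in> \<aa>0 \<Longrightarrow> A' \<in> \<aa>0 \<Longrightarrow> br A A' = 0"
    and alpha_nonzero: "\<exists>A\<in>\<aa>0. \<alpha> A \<noteq> 0"
begin

abbreviation V where "V \<equiv> root_space br \<aa>0 \<alpha>"
abbreviation L where "L \<equiv> lie_centralizer br UNIV \<aa>0"
abbreviation GL where "GL \<equiv> levi_group br \<aa>0"

lemma V_D: "x \<in> V \<Longrightarrow> A \<in> \<aa>0 \<Longrightarrow> br A x = \<alpha> A *\<^sub>R x"
  by (simp add: root_space_def)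

lemma L_D: "Z \<in> L \<Longrightarrow> A \<in> \<aa>0 \<Longrightarrow> br A Z = 0"
  by (simp add: lie_centralizer_def)

lemma V_subspace: "subspace V"
  by (auto simp: subspace_def root_space_def br_simps algebra_simps)

lemma L_subspace: "subspace L"
  by (auto simp: subspace_def lie_centralizer_def br_simps)

lemma L_ad_system: "ad_system br L"
  by (rule ad_systemI[OF lie_algebra_bilinear[OF lie] L_subspace])

lemma a0_L: "A \<in> \<aa>0 \<Longrightarrow> A \<in> L"
  by (auto simp: lie_centralizer_def a0_abelian)

lemma L_V: "Z \<in> L \<Longrightarrow> x \<in> V \<Longrightarrow> br Z x \<in> V"
  by (auto simp: root_space_def lie_centralizer_def jacobi[of _ Z x] br_simps)

text \<open>\<open>\<theta>\<close> negates \<open>\<aa>0\<close>, so \<open>\<theta> x\<close> has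
  weight \<open>- \<alpha>\<close>, which cancels the weight of \<open>y\<close>.\<close>

lemma thetaV_V: "x \<in> V \<Longrightarrow> y \<in> V \<Longrightarrow> br (\<theta> x) y \<in> L"
proof -
  assume x: "x \<in> V" and y: "y \<in> V"
  have "br A (br (\<theta> x) y) = 0" if A: "A \<in> \<aa>0" for A
  proof -
    have "br A (\<theta> x) = \<theta> (br (\<theta> A) x)" by (simp add: theta)
    also have "\<dots> = - \<alpha> A *\<^sub>R \<theta> x"
      by (simp add: theta_a0[OF A] br_simps theta_simps V_D[OF x A])
    finally show ?thesis
      by (simp add: jacobi[of A] V_D[OF y A] br_simps)
  qed
  then show ?thesis by (simp add: lie_centralizer_def)
qed

abbreviation moment :: "'g \<Rightarrow> 'g" where "moment X \<equiv> br (\<theta> X) X"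

lemma theta_moment: "\<theta> (moment X) = - moment X"
  by (simp add: theta br_anticommute[of X])

text \<open>Pairing with the moment becomes a matrix coefficient of \<open>ad (moment X)\<close>;
  the derivative of the squared length of the moment is computed in this way.\<close>

lemma ip_moment: "ip (moment X) (br (\<theta> U) W) = ip (br (moment X) U) W"
proof -
  have "ip (br (\<theta> U) W) (moment X) = - ip W (br U (moment X))" by (simp add: ip_br theta)
  then show ?thesis by (simp add: br_anticommute[of U] ip_simps ip_commute)
qed

lemma ip_moment_self: "ip (moment X) (moment X) = ip (br (moment X) X) X"
  by (rule ip_moment)

lemma moment_symmetric: "ip (br (moment X) U) W = ip U (br (moment X) W)"
  using ip_br[of "moment X" U W] by (simp add: theta_moment br_simps ip_simps)

text \<open>For \<open>A \<in> \<aa>0\<close> one has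
  \<open>ip (moment X) A = \<alpha> A * ip X X\<close>, which is nonzero for a suitable
  \<open>A\<close>.\<close>

lemma moment_nonzero:
  assumes "X \<in> V" "X \<noteq> 0"
  shows "moment X \<noteq> 0"
proof
  obtain A where A: "A \<in> \<aa>0" "\<alpha> A \<noteq> 0" using alpha_nonzero by blast
  assume "moment X = 0"
  then have "ip (moment X) A = 0" by (simp add: ip_simps)
  then have "ip X (br X A) = 0" by (simp add: ip_br theta)
  then have "\<alpha> A * ip X X = 0"
    by (simp add: br_anticommute[of X] V_D[OF assms(1) A(1)] ip_simps)
  then show False using A assms ip_eq_0_iff by simp
qed

text \<open>The cross terms of \<^term>\<open>moment (X + Y)\<close> vanish on the slice, and the remaining first-order
  contribution to its norm has the favourable sign.\<close>

lemma moment_slice: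
  assumes Y: "br (\<theta> X) Y = 0"
  shows "moment (X + Y) = moment X + moment Y"
    and "ip (br (moment X) Y) Y = - ip (br X Y) (br X Y)"
    and "ip (moment X) (moment Y) \<le> 0"
    and "X \<in> V \<Longrightarrow> Y \<in> V \<Longrightarrow> ip X Y = 0"
proof -
  \<comment> \<open>\<open>\<theta>\<close> carries one cross term to the negative of the other, so
    both vanish.\<close>
  have "br (\<theta> Y) X = - \<theta> (br (\<theta> X) Y)" by (simp add: theta br_anticommute[of X])
  then have "br (\<theta> Y) X = 0" by (simp add: Y theta_simps)
  then show "moment (X + Y) = moment X + moment Y"
    using Y by (simp add: theta_simps br_simps)
  \<comment> \<open>The slice equation leaves one term of the Jacobi identity; taking the adjoint of
    \<open>ad (\<theta> X)\<close> then produces the negative square.\<close>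
  have "br (moment X) Y = br (\<theta> X) (br X Y)" using jacobi[of "\<theta> X" X Y] Y by (simp add: br_simps)
  then show *: "ip (br (moment X) Y) Y = - ip (br X Y) (br X Y)"
    by (simp add: ip_br[of "\<theta> X"] theta)
  then show "ip (moment X) (moment Y) \<le> 0"
    by (simp add: ip_moment ip_nonneg)
  assume XY: "X \<in> V" "Y \<in> V"
  obtain A where A: "A \<in> \<aa>0" "\<alpha> A \<noteq> 0" using alpha_nonzero by blast
  have "ip (br (\<theta> X) Y) A = - ip Y (br X A)" by (simp add: ip_br theta)
  also have "\<dots> = \<alpha> A * ip X Y"
    by (simp add: br_anticommute[of X] V_D[OF XY(1) A(1)] ip_simps ip_commute)
  finally show "ip X Y = 0" using A Y by (simp add: ip_simps)
qed

text \<open>Let \<open>a\<close> be the squared length of \<open>moment X\<close> and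
  \<open>r = ip Y Y\<close>. The strict inequality is
  \<open>a + C r\<^sup>2 < a (1 + r)\<^sup>2\<close>, a consequence of \<open>C r < 2 a\<close>. The
  middle value depends on \<open>Y\<close> through \<open>r\<close> alone, which yields a uniform
  bound at fixed \<open>r\<close>.\<close>

lemma moment_slice_descent:
  assumes X: "X \<in> V" "ip X X = 1"
    and Y: "Y \<in> V" "br (\<theta> X) Y = 0" "Y \<noteq> 0"
    and C: "ip (moment Y) (moment Y) \<le> C * (ip Y Y)\<^sup>2" "C * ip Y Y < 2 * ip (moment X) (moment X)"
  shows "ip (moment (X + Y)) (moment (X + Y)) \<le> ip (moment X) (moment X) + C * (ip Y Y)\<^sup>2"
    and "ip (moment X) (moment X) + C * (ip Y Y)\<^sup>2 < ip (moment X) (moment X) * (ip (X + Y) (X + Y))\<^sup>2"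
    and "ip (X + Y) (X + Y) = 1 + ip Y Y"
proof -
  note sl = moment_slice[OF Y(2)]
  show n: "ip (X + Y) (X + Y) = 1 + ip Y Y"
    using sl(4)[OF X(1) Y(1)] X by (simp add: ip_simps ip_commute[of Y X])
  show "ip (moment (X + Y)) (moment (X + Y)) \<le> ip (moment X) (moment X) + C * (ip Y Y)\<^sup>2"
    using sl(3) C(1) by (simp add: sl(1) ip_simps ip_commute[of "moment Y" "moment X"])
  define a r where "a = ip (moment X) (moment X)" and "r = ip Y Y"
  have "r > 0" "a \<ge> 0" using Y ip_pos ip_nonneg by (auto simp: a_def r_def)
  then have "C * r * r < 2 * a * r" using C(2) by (intro mult_strict_right_mono) (auto simp: a_def r_def)
  moreover have "0 \<le> a * r\<^sup>2" using \<open>a \<ge> 0\<close> by simp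
  ultimately show "ip (moment X) (moment X) + C * (ip Y Y)\<^sup>2 < ip (moment X) (moment X) * (ip (X + Y) (X + Y))\<^sup>2"
    unfolding n a_def[symmetric] r_def[symmetric] by (simp add: power2_eq_square algebra_simps)
qed

subsection \<open>The Levi group\<close>

lemma GL_V: "g \<in> carrier GL \<Longrightarrow> x \<in> V \<Longrightarrow> g x \<in> V"
  unfolding levi_group_def
  by (rule connected_subgroup_preserves[OF L_ad_system])
    (auto intro!: lin_exp_in_subspace br_linear V_subspace L_V)

lemma GL_exp: "Z \<in> L \<Longrightarrow> lin_exp (br Z) \<in> carrier GL"
  unfolding levi_group_def by (rule connected_subgroup_exp[OF L_ad_system])

lemma GL_comp: "g \<in> carrier GL \<Longrightarrow> h \<in> carrier GL \<Longrightarrow> g \<circ> h \<in> carrier GL"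
  unfolding levi_group_def by (rule connected_subgroup_comp[OF L_ad_system])

lemma GL_linear: "g \<in> carrier GL \<Longrightarrow> linear g"
  unfolding levi_group_def by (rule connected_subgroup_linear[OF L_ad_system])

lemma GL_inverse:
  assumes "g \<in> carrier GL"
  shows "\<exists>h\<in>carrier GL. (\<forall>x. h (g x) = x) \<and> (\<forall>x. g (h x) = x)"
  using connected_subgroup_inverse[OF L_ad_system] assms unfolding levi_group_def by blast

text \<open>Elements of \<open>\<aa>0\<close> act on \<open>V\<close> by scalars, so their
  exponentials give all positive multiples. Vectors can thus be normalized within their
  orbit.\<close>

lemma GL_scale:
  assumes "c > 0"
  obtains g where "g \<in> carrier GL" "\<And>x. x \<in> V \<Longrightarrow> g x = c *\<^sub>R x"
proof -
  obtain A where A: "A \<in> \<aa>0" "\<alpha> A \<noteq> 0" using alpha_nonzero by blast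
  define Z where "Z = (ln c / \<alpha> A) *\<^sub>R A"
  have "Z \<in> L" using A by (auto simp: Z_def intro!: a0_L subspace_scale a0_subspace)
  moreover have "lin_exp (br Z) x = c *\<^sub>R x" if "x \<in> V" for x
  proof -
    have "br Z x = ln c *\<^sub>R x" using A by (simp add: Z_def br_simps V_D[OF that])
    from lin_exp_eigenvector[OF br_linear(1) this] show ?thesis using assms by simp
  qed
  ultimately show ?thesis using that GL_exp by blast
qed

definition levi_conj :: "'g \<Rightarrow> 'g \<Rightarrow> bool" where
  "levi_conj x y \<longleftrightarrow> (\<exists>g\<in>carrier GL. g x = y)"

lemma levi_conj_trans: "levi_conj x y \<Longrightarrow> levi_conj y z \<Longrightarrow> levi_conj x z"
  unfolding levi_conj_def by (metis GL_comp comp_apply)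

lemma levi_conj_sym: "levi_conj x y \<Longrightarrow> levi_conj y x"
  unfolding levi_conj_def by (metis GL_inverse)

lemma levi_conj_exp: "Z \<in> L \<Longrightarrow> levi_conj x (lin_exp (br Z) x)"
  unfolding levi_conj_def using GL_exp by blast

lemma levi_conj_scale: "c > 0 \<Longrightarrow> x \<in> V \<Longrightarrow> levi_conj x (c *\<^sub>R x)"
  unfolding levi_conj_def by (metis GL_scale)

lemma levi_conj_V: "levi_conj x y \<Longrightarrow> x \<in> V \<Longrightarrow> y \<in> V"
  unfolding levi_conj_def using GL_V by blast

lemma levi_conj_refl: "levi_conj x x"
proof -
  have "br 0 = (\<lambda>x. 0)" by (auto simp: br_simps)
  then show ?thesis using levi_conj_exp[of 0 x] subspace_0[OF L_subspace] by (simp add: lin_exp_zero)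
qed

lemma slice_subspace: "subspace {Y \<in> V. br (\<theta> X) Y = 0}"
  using V_subspace by (auto simp: subspace_def br_simps)

text \<open>This is \<open>exp_ad_slice\<close> for the complement found in
  \<open>tangent_decomposition\<close>, with the size of \<open>Y\<close> measured by
  \<open>ip\<close>.\<close>

lemma moment_slice_nearby:
  assumes X: "X \<in> V" and "\<epsilon> > 0"
  shows "\<exists>\<delta>>0. \<forall>x\<in>V. dist x X < \<delta> \<longrightarrow> (\<exists>Y\<in>V. br (\<theta> X) Y = 0 \<and> ip Y Y < \<epsilon> \<and> levi_conj x (X + Y))"
proof -
  obtain C where C: "C > 0" "\<And>x. ip x x \<le> C * (norm x)\<^sup>2" using ip_norm_bounds by blast
  \<comment> \<open>Chosen such that \<open>C * \<eta>\<^sup>2 = \<epsilon>\<close>.\<close>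
  define \<eta> where "\<eta> = sqrt (\<epsilon> / C)"
  have \<eta>: "\<eta> > 0" using assms C by (simp add: \<eta>_def)
  have small: "ip Y Y < \<epsilon>" if "norm Y < \<eta>" for Y
  proof -
    have "(norm Y)\<^sup>2 < \<eta>\<^sup>2" using that by (intro power_strict_mono) auto
    also have "\<eta>\<^sup>2 = \<epsilon> / C" using assms C by (simp add: \<eta>_def)
    finally show ?thesis using C(2)[of Y] C(1) by (simp add: field_simps)
  qed
  have "\<exists>\<delta>>0. \<forall>x\<in>V. dist x X < \<delta> \<longrightarrow>
      (\<exists>Z\<in>L. \<exists>Y\<in>{Y \<in> V. br (\<theta> X) Y = 0}. norm Y < \<eta> \<and> x = lin_exp (br Z) (X + Y))"
    by (rule exp_ad_slice[OF lie_algebra_bilinear[OF lie] L_subspace V_subspace slice_subspace _ X L_V])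
      (use tangent_decomposition[OF L_subspace V_subspace L_V[OF _ X] thetaV_V[OF X]] \<eta> in auto)
  then show ?thesis
    using small levi_conj_sym[OF levi_conj_exp] by (smt (verit, best) mem_Collect_eq)
qed

end

section \<open>Minimal vectors and the finiteness of the set of orbits\<close>

context cartan_grading
begin

abbreviation mnorm :: "'g \<Rightarrow> real" where "mnorm X \<equiv> ip (moment X) (moment X)"

text \<open>The inequality expresses minimality of the scale-invariant quotient
  \<open>mnorm y / (ip y y)\<^sup>2\<close> along the orbit, cleared of its denominator; at the unit
  vector \<open>X\<close> the quotient is \<open>mnorm X\<close>.\<close>

definition minimal_vectors :: "'g set" where
  "minimal_vectors = {X \<in> V. ip X X = 1 \<and> (\<forall>y. levi_conj X y \<longrightarrow> mnorm X * (ip y y)\<^sup>2 \<le> mnorm y)}"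

lemma mnorm_scale: "mnorm (c *\<^sub>R x) = c ^ 4 * mnorm x"
  by (simp add: theta_simps br_simps ip_simps power4_eq_xxxx)

lemma normalize:
  assumes "y \<in> V" "y \<noteq> 0"
  obtains y' where "levi_conj y y'" "y' \<in> V" "ip y' y' = 1" "mnorm y = mnorm y' * (ip y y)\<^sup>2"
proof -
  define c where "c = 1 / sqrt (ip y y)"
  have p: "ip y y > 0" using assms ip_pos by blast
  have c: "c > 0" "c\<^sup>2 = 1 / ip y y" using p by (auto simp: c_def power_divide)
  have "c ^ 4 = (c\<^sup>2)\<^sup>2" by simp
  then have c4: "c ^ 4 = 1 / (ip y y)\<^sup>2" by (simp only: c(2) power_divide power_one)
  have "ip (c *\<^sub>R y) (c *\<^sub>R y) = c\<^sup>2 * ip y y" by (simp add: ip_simps power2_eq_square)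
  then have "ip (c *\<^sub>R y) (c *\<^sub>R y) = 1" using p c by simp
  moreover have "mnorm y = mnorm (c *\<^sub>R y) * (ip y y)\<^sup>2"
    unfolding mnorm_scale c4 using p by simp
  ultimately show ?thesis
    using that[of "c *\<^sub>R y"] levi_conj_scale[OF c(1) assms(1)] V_subspace assms(1) by (simp add: subspace_scale)
qed

lemma continuous_on_mnorm: "continuous_on S mnorm"
  by (intro continuous_intros)

lemma mnorm_pos: "X \<in> V \<Longrightarrow> X \<noteq> 0 \<Longrightarrow> mnorm X > 0"
  by (intro ip_pos moment_nonzero)

text \<open>Let \<open>X0\<close> minimize \<open>mnorm\<close> on the compact set of unit vectors
  in the closure of the orbit. Some point of the orbit is conjugate to a slice point
  \<open>X0 + Y\<close>, and \<open>Y \<noteq> 0\<close> would make the quotient at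
  \<open>X0 + Y\<close> smaller than at \<open>X0\<close>.\<close>

lemma minimal_vector_exists:
  assumes X: "X \<in> V" "X \<noteq> 0"
  obtains X0 where "X0 \<in> minimal_vectors" "levi_conj X X0"
proof -
  define A where "A = closure {y. levi_conj X y} \<inter> {x \<in> V. ip x x = 1}"
  have "compact A"
    unfolding A_def by (intro closed_Int_compact closed_closure compact_ip_sphere V_subspace)
  moreover obtain X' where "levi_conj X X'" "X' \<in> V" "ip X' X' = 1"
    using normalize[OF X] by blast
  then have "A \<noteq> {}" using closure_subset[of "{y. levi_conj X y}"] by (auto simp: A_def)
  ultimately obtain X0 where X0: "X0 \<in> A" "\<And>y. y \<in> A \<Longrightarrow> mnorm X0 \<le> mnorm y"
    using continuous_attains_inf[OF _ _ continuous_on_mnorm] by metis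
  then have X0V: "X0 \<in> V" "ip X0 X0 = 1" by (auto simp: A_def)
  then have "X0 \<noteq> 0" by (auto simp: ip_simps)
  then have a: "mnorm X0 > 0" using X0V mnorm_pos by blast
  \<comment> \<open>Homogeneity extends the bound from unit vectors to the whole orbit.\<close>
  have unit: "mnorm X0 * (ip y y)\<^sup>2 \<le> mnorm y" if y: "levi_conj X y" for y
  proof (cases "y = 0")
    case False
    have "y \<in> V" using y X levi_conj_V by blast
    then obtain y' where y': "levi_conj y y'" "y' \<in> V" "ip y' y' = 1" "mnorm y = mnorm y' * (ip y y)\<^sup>2"
      using normalize False by blast
    then have "y' \<in> A"
      using levi_conj_trans[OF y y'(1)] closure_subset[of "{y. levi_conj X y}"] by (auto simp: A_def)
    then show ?thesis using X0(2) y'(4) by (simp add: mult_right_mono)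
  qed (simp add: ip_simps br_simps theta_simps)
  obtain C where C: "C > 0" "\<And>Y. mnorm Y \<le> C * (ip Y Y)\<^sup>2" using bounded_quartic by blast
  \<comment> \<open>Below this size of \<open>ip Y Y\<close> the descent inequality applies.\<close>
  have "2 * mnorm X0 / C > 0" using a C by simp
  from moment_slice_nearby[OF X0V(1) this] obtain \<delta> where \<delta>: "\<delta> > 0"
    "\<And>x. x \<in> V \<Longrightarrow> dist x X0 < \<delta> \<Longrightarrow>
      \<exists>Y\<in>V. br (\<theta> X0) Y = 0 \<and> ip Y Y < 2 * mnorm X0 / C \<and> levi_conj x (X0 + Y)"
    by blast
  have "X0 \<in> closure {y. levi_conj X y}" using X0 by (simp add: A_def)
  then obtain x where x: "levi_conj X x" "dist x X0 < \<delta>"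
    using \<delta>(1) by (auto simp: closure_approachable)
  obtain Y where Y: "Y \<in> V" "br (\<theta> X0) Y = 0" "ip Y Y < 2 * mnorm X0 / C" "levi_conj x (X0 + Y)"
    using \<delta>(2)[OF levi_conj_V[OF x(1) X(1)] x(2)] by blast
  have c: "levi_conj X (X0 + Y)" using levi_conj_trans[OF x(1) Y(4)] .
  have "Y = 0"
  proof (rule ccontr)
    assume "Y \<noteq> 0"
    moreover have "C * ip Y Y < 2 * mnorm X0" using Y(3) C(1) by (simp add: field_simps)
    ultimately have "mnorm (X0 + Y) < mnorm X0 * (ip (X0 + Y) (X0 + Y))\<^sup>2"
      using moment_slice_descent(1,2)[OF X0V Y(1,2) _ C(2)] by (meson le_less_trans)
    then show False using unit[OF c] by simp
  qed
  then have "levi_conj X X0" using c by simp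
  moreover have "X0 \<in> minimal_vectors"
    using X0V unit levi_conj_trans[OF \<open>levi_conj X X0\<close>] by (auto simp: minimal_vectors_def)
  ultimately show ?thesis using that by blast
qed

text \<open>Minimality is one closed condition for each group element, imposed on a compact
  sphere.\<close>

lemma compact_minimal_vectors: "compact minimal_vectors"
proof -
  have "minimal_vectors = {x \<in> V. ip x x = 1} \<inter>
      (\<Inter>g\<in>carrier GL. {X. mnorm X * (ip (g X) (g X))\<^sup>2 \<le> mnorm (g X)})"
    by (auto simp: minimal_vectors_def levi_conj_def)
  moreover have "closed {X. mnorm X * (ip (g X) (g X))\<^sup>2 \<le> mnorm (g X)}" if "g \<in> carrier GL" for g
  proof -
    have g: "continuous_on UNIV g"
      using GL_linear[OF that] by (simp add: linear_continuous_on linear_conv_bounded_linear)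
    show ?thesis by (intro closed_Collect_le continuous_intros g)
  qed
  ultimately show ?thesis
    by (simp add: compact_Int_closed compact_ip_sphere V_subspace closed_INT)
qed

text \<open>A minimal vector is a critical point, hence an eigenvector of its own moment.\<close>

lemma minimal_vector_eigen:
  assumes "X \<in> minimal_vectors"
  shows "br (moment X) X = mnorm X *\<^sub>R X"
proof -
  define H a W where "H = moment X" and "a = mnorm X" and "W = br H X"
  have X: "X \<in> V" "ip X X = 1" and min: "\<And>y. levi_conj X y \<Longrightarrow> a * (ip y y)\<^sup>2 \<le> mnorm y"
    using assms by (auto simp: minimal_vectors_def a_def)
  have HL: "H \<in> L" unfolding H_def by (rule thetaV_V[OF X(1) X(1)])
  \<comment> \<open>A curve in the orbit whose direction is the moment itself.\<close>
  define x where "x t = lin_exp (\<lambda>z. t *\<^sub>R br H z) X" for t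
  have x0: "x 0 = X" by (simp add: x_def lin_exp_zero)
  have x_exp: "x t = lin_exp (br (t *\<^sub>R H)) X" for t
    by (simp add: x_def br_simps[abs_def] fun_eq_iff)
  have dx: "(x has_vector_derivative W) (at 0)"
    using lin_exp_has_vector_derivative[OF br_linear(1), of H X 0] x0
    by (simp add: x_def[abs_def] W_def lin_exp_zero)
  have dth: "((\<lambda>t. \<theta> (x t)) has_vector_derivative \<theta> W) (at 0)"
    using theta(1) by (intro bounded_linear.has_vector_derivative[OF _ dx]) (simp add: linear_conv_bounded_linear)
  have dm: "((\<lambda>t. moment (x t)) has_vector_derivative br (\<theta> X) W + br (\<theta> W) X) (at 0)"
    using bounded_bilinear.has_vector_derivative[OF bounded_bilinear_br dth dx] by (simp add: x0)
  have dn: "((\<lambda>t. mnorm (x t)) has_real_derivative 4 * ip W W) (at 0)"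
  proof -
    have "ip H (br (\<theta> X) W) = ip W W" unfolding H_def ip_moment by (simp add: W_def H_def)
    moreover have "ip H (br (\<theta> W) X) = ip W W"
      unfolding H_def ip_moment moment_symmetric by (simp add: W_def H_def)
    ultimately have "ip H (br (\<theta> X) W + br (\<theta> W) X) = 2 * ip W W" by (simp add: ip_simps)
    then show ?thesis
      using bounded_bilinear.has_vector_derivative[OF bounded_bilinear_ip dm dm]
      by (simp add: x0 H_def[symmetric] ip_commute[of _ H] has_real_derivative_iff_has_vector_derivative)
  qed
  have WX: "ip W X = a" by (simp add: W_def a_def H_def ip_moment_self)
  have "((\<lambda>t. ip (x t) (x t)) has_real_derivative 2 * a) (at 0)"
    using bounded_bilinear.has_vector_derivative[OF bounded_bilinear_ip dx dx]
    by (simp add: x0 WX ip_commute[of X W] has_real_derivative_iff_has_vector_derivative)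
  from DERIV_power[OF this, of 2]
  have dq: "((\<lambda>t. (ip (x t) (x t))\<^sup>2) has_real_derivative 4 * a) (at 0)" by (simp add: x0 X)
  have "((\<lambda>t. mnorm (x t) - a * (ip (x t) (x t))\<^sup>2) has_real_derivative 4 * ip W W - a * (4 * a)) (at 0)"
    by (intro DERIV_diff dn DERIV_cmult dq)
  note dG = this
  have minG: "mnorm (x 0) - a * (ip (x 0) (x 0))\<^sup>2 \<le> mnorm (x t) - a * (ip (x t) (x t))\<^sup>2" for t
  proof -
    have "levi_conj X (x t)" unfolding x_exp using HL L_subspace by (intro levi_conj_exp subspace_scale)
    then show ?thesis using min[of "x t"] by (simp add: x0 X a_def)
  qed
  have "4 * ip W W - a * (4 * a) = 0"
    by (rule DERIV_local_min[OF dG, of 1]) (use minG in simp_all)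
  \<comment> \<open>Now \<open>ip W W = a\<^sup>2\<close>, \<open>ip W X = a\<close> and
    \<open>ip X X = 1\<close>, the equality case of Cauchy-Schwarz.\<close>
  then have "ip (W - a *\<^sub>R X) (W - a *\<^sub>R X) = 0"
    using WX X by (simp add: ip_simps ip_commute[of X W])
  then show ?thesis by (simp add: ip_eq_0_iff W_def H_def a_def)
qed

text \<open>The flow of \<open>- ad (moment X)\<close>, rescaled to fix \<open>X\<close>, expands the slice through \<open>X\<close>.\<close>

lemma slice_expansion:
  assumes X: "X \<in> V" and eig: "br (moment X) X = a *\<^sub>R X" and a: "a > 0"
    and Y: "Y \<in> V" "br (\<theta> X) Y = 0" "Y \<noteq> 0" and \<rho>: "ip Y Y \<le> \<rho>"
  obtains Y' where "Y' \<in> V" "br (\<theta> X) Y' = 0" "ip Y' Y' = \<rho>" "levi_conj (X + Y) (X + Y')"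
proof -
  define H where "H = moment X"
  have HL: "H \<in> L" unfolding H_def by (rule thetaV_V[OF X X])
  define E where "E s = lin_exp (br ((- s) *\<^sub>R H))" for s :: real
  have E_eq: "E s = lin_exp (\<lambda>z. s *\<^sub>R (- br H z))" for s
    by (auto simp: E_def br_simps[abs_def] fun_eq_iff intro!: arg_cong[of _ _ "\<lambda>T. lin_exp T _"])
  define y where "y s = E s Y" for s
  have lin: "linear (\<lambda>z. - br H z)" by (intro linear_compose_neg br_linear)
  \<comment> \<open>The flow preserves the slice, because \<open>br (\<theta> X) H\<close> is a
    multiple of \<open>\<theta> X\<close> and so kills \<open>z\<close>.\<close>
  have S: "br (- s *\<^sub>R H) z \<in> {z \<in> V. br (\<theta> X) z = 0}" if "z \<in> {z \<in> V. br (\<theta> X) z = 0}" for z s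
  proof -
    have "br (\<theta> X) H = \<theta> (br X (\<theta> H))" by (simp add: theta)
    also have "\<dots> = a *\<^sub>R \<theta> X"
      using eig by (simp add: H_def theta_moment br_simps br_anticommute[of X] theta_simps)
    finally have "br (\<theta> X) (br H z) = 0"
      using that by (simp add: jacobi[of "\<theta> X" H z] br_simps)
    then show ?thesis
      using that L_V[OF HL] V_subspace by (auto simp: br_simps subspace_scale subspace_neg)
  qed
  have yS: "y s \<in> V" "br (\<theta> X) (y s) = 0" for s
    using lin_exp_in_subspace[OF br_linear(1) slice_subspace S, of Y s] Y
    by (auto simp: y_def E_def)
  have y0: "y 0 = Y" by (simp add: y_def E_eq lin_exp_zero)
  have dy: "(y has_vector_derivative - br H (y s)) (at s)" for s
    using lin_exp_has_vector_derivative[OF lin, of Y s] by (simp add: y_def[abs_def] E_eq)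
  have dn: "((\<lambda>s. ip (y s) (y s)) has_real_derivative 2 * ip (br X (y s)) (br X (y s))) (at s)" for s
  proof -
    have "ip (br H (y s)) (y s) = - ip (br X (y s)) (br X (y s))"
      unfolding H_def by (rule moment_slice(2)[OF yS(2)])
    then show ?thesis
      using bounded_bilinear.has_vector_derivative[OF bounded_bilinear_ip dy[of s] dy[of s]]
      by (simp add: ip_simps ip_commute[of "y s" "br H (y s)"] has_real_derivative_iff_has_vector_derivative)
  qed
  have grow: "ip Y Y \<le> ip (y s) (y s)" if "s \<ge> 0" for s
    using DERIV_nonneg_imp_nondecreasing[OF that, of "\<lambda>s. ip (y s) (y s)"] dn ip_nonneg
    by (metis y0 mult_nonneg_nonneg zero_le_numeral)
  \<comment> \<open>Squared length of the slice component after rescaling by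
    \<open>exp (s * a)\<close>, the factor that returns the first component to
    \<open>X\<close>.\<close>
  define f where "f s = (exp (s * a))\<^sup>2 * ip (y s) (y s)" for s
  have cont: "isCont f s" for s
    unfolding f_def by (intro continuous_intros DERIV_isCont[OF dn])
  have p: "ip Y Y > 0" using Y ip_pos by blast
  have "\<exists>s\<ge>0. \<rho> \<le> f s"
  proof -
    \<comment> \<open>For this \<open>s\<close> one has
      \<open>(1 + s * a) * ip Y Y = ip Y Y + \<rho>\<close>.\<close>
    define s where "s = \<rho> / (ip Y Y * a)"
    have s: "s \<ge> 0" using p a \<rho> by (simp add: s_def)
    have "\<rho> \<le> (1 + s * a) * ip Y Y" using p a by (simp add: s_def field_simps)
    also have "\<dots> \<le> (exp (s * a))\<^sup>2 * ip (y s) (y s)"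
    proof (intro mult_mono grow s)
      have "1 + s * a \<le> exp (s * a)" by (rule exp_ge_add_one_self)
      also have "\<dots> \<le> (exp (s * a))\<^sup>2" using s a by (simp add: power2_eq_square)
      finally show "1 + s * a \<le> (exp (s * a))\<^sup>2" .
    qed (use p in auto)
    finally show ?thesis using s by (auto simp: f_def)
  qed
  then obtain s1 where s1: "s1 \<ge> 0" "\<rho> \<le> f s1" by blast
  moreover have "f 0 \<le> \<rho>" using \<rho> by (simp add: f_def y0)
  ultimately obtain s where s: "f s = \<rho>" using IVT[of f 0 \<rho> s1] cont by auto
  define Y' where "Y' = exp (s * a) *\<^sub>R y s"
  have "levi_conj (X + Y) (E s (X + Y))"
    unfolding E_def using HL L_subspace by (intro levi_conj_exp subspace_scale)
  moreover have "E s (X + Y) = exp (- (s * a)) *\<^sub>R X + y s"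
  proof -
    have "br (- s *\<^sub>R H) X = (- (s * a)) *\<^sub>R X"
      using eig by (simp add: br_simps H_def)
    then have "E s X = exp (- (s * a)) *\<^sub>R X"
      unfolding E_def by (rule lin_exp_eigenvector[OF br_linear(1)])
    then show ?thesis
      using linear_add[OF linear_lin_exp[OF br_linear(1)]] by (simp add: E_def y_def)
  qed
  moreover have "exp (s * a) *\<^sub>R (exp (- (s * a)) *\<^sub>R X + y s) = X + Y'"
    by (simp add: Y'_def scaleR_add_right exp_minus)
  moreover have "exp (- (s * a)) *\<^sub>R X + y s \<in> V"
    using X yS V_subspace by (intro subspace_add subspace_scale)
  ultimately have "levi_conj (X + Y) (X + Y')"
    by (metis levi_conj_scale levi_conj_trans exp_gt_zero)
  moreover have "Y' \<in> V" "br (\<theta> X) Y' = 0"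
    using yS V_subspace by (auto simp: Y'_def br_simps subspace_scale)
  moreover have "ip Y' Y' = \<rho>" using s by (simp add: Y'_def f_def ip_simps power2_eq_square)
  ultimately show ?thesis using that by blast
qed

text \<open>Suppose a minimal vector \<open>x\<close> near \<open>X\<close> is conjugate to
  \<open>X + Y\<close> with \<open>Y \<noteq> 0\<close>. Expansion moves it to \<open>X + Y'\<close>
  with \<open>ip Y' Y' = \<rho>\<close>, where the quotient is at most
  \<open>\<kappa> < mnorm X\<close>. Minimality gives \<open>mnorm x \<le> \<kappa>\<close>, which
  continuity excludes near \<open>X\<close>.\<close>

lemma minimal_vectors_isolated:
  assumes X: "X \<in> minimal_vectors"
  shows "\<exists>\<delta>>0. \<forall>x\<in>minimal_vectors. dist x X < \<delta> \<longrightarrow> levi_conj x X"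
proof -
  define a where "a = mnorm X"
  have XV: "X \<in> V" "ip X X = 1" using X by (auto simp: minimal_vectors_def)
  then have "X \<noteq> 0" by (auto simp: ip_simps)
  then have a: "a > 0" using mnorm_pos XV(1) by (simp add: a_def)
  have eig: "br (moment X) X = a *\<^sub>R X" unfolding a_def by (rule minimal_vector_eigen[OF X])
  obtain C where C: "C > 0" "\<And>Y. mnorm Y \<le> C * (ip Y Y)\<^sup>2" using bounded_quartic by blast
  \<comment> \<open>Then \<open>C * \<rho> = a < 2 * a\<close>, as the descent inequality
    requires.\<close>
  define \<rho> where "\<rho> = a / C"
  have \<rho>: "\<rho> > 0" "C * \<rho> < 2 * a" using a C by (auto simp: \<rho>_def)
  \<comment> \<open>Upper bound for the quotient at all slice points \<open>X + Y'\<close> with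
    \<open>ip Y' Y' = \<rho>\<close>.\<close>
  define \<kappa> where "\<kappa> = (a + C * \<rho>\<^sup>2) / (1 + \<rho>)\<^sup>2"
  have "C * \<rho> * \<rho> < 2 * a * \<rho>" using \<rho> by (intro mult_strict_right_mono)
  moreover have "0 \<le> a * \<rho>\<^sup>2" using a by simp
  ultimately have "a + C * \<rho>\<^sup>2 < a * (1 + \<rho>)\<^sup>2" by (simp add: power2_eq_square algebra_simps)
  then have "\<kappa> < mnorm X" using \<rho> by (simp add: \<kappa>_def a_def[symmetric] divide_simps)
  moreover have "isCont mnorm X"
    using continuous_on_mnorm[of UNIV] by (simp add: continuous_on_eq_continuous_at)
  ultimately have "eventually (\<lambda>x. \<kappa> < mnorm x) (at X)"
    unfolding isCont_def by (rule order_tendstoD(1)[rotated])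
  then obtain \<delta>1 where \<delta>1: "\<delta>1 > 0" "\<And>x. dist x X < \<delta>1 \<Longrightarrow> \<kappa> < mnorm x"
    unfolding eventually_at using \<open>\<kappa> < mnorm X\<close> by (metis UNIV_I)
  obtain \<delta>2 where \<delta>2: "\<delta>2 > 0"
    "\<And>x. x \<in> V \<Longrightarrow> dist x X < \<delta>2 \<Longrightarrow> \<exists>Y\<in>V. br (\<theta> X) Y = 0 \<and> ip Y Y < \<rho> \<and> levi_conj x (X + Y)"
    using moment_slice_nearby[OF XV(1) \<rho>(1)] by blast
  have "levi_conj x X" if x: "x \<in> minimal_vectors" "dist x X < min \<delta>1 \<delta>2" for x
  proof -
    have xV: "x \<in> V" and xmin: "\<And>y. levi_conj x y \<Longrightarrow> mnorm x * (ip y y)\<^sup>2 \<le> mnorm y"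
      using x by (auto simp: minimal_vectors_def)
    obtain Y where Y: "Y \<in> V" "br (\<theta> X) Y = 0" "ip Y Y < \<rho>" "levi_conj x (X + Y)"
      using \<delta>2(2)[OF xV] x(2) by auto
    have "Y = 0"
    proof (rule ccontr)
      assume "Y \<noteq> 0"
      from slice_expansion[OF XV(1) eig a Y(1,2) this less_imp_le[OF Y(3)]]
      obtain Y' where Y': "Y' \<in> V" "br (\<theta> X) Y' = 0" "ip Y' Y' = \<rho>" "levi_conj (X + Y) (X + Y')" by blast
      then have "Y' \<noteq> 0" using \<rho> by (auto simp: ip_simps)
      note d = moment_slice_descent[OF XV Y'(1,2) this C(2), unfolded Y'(3) a_def[symmetric], OF \<rho>(2)]
      have "mnorm x * (1 + \<rho>)\<^sup>2 \<le> a + C * \<rho>\<^sup>2"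
        using xmin[OF levi_conj_trans[OF Y(4) Y'(4)]] d(1) d(3) by simp
      then have "mnorm x \<le> \<kappa>" using \<rho> by (simp add: \<kappa>_def pos_le_divide_eq)
      then show False using \<delta>1(2)[of x] x(2) by simp
    qed
    then show ?thesis using Y by simp
  qed
  then show ?thesis using \<delta>1(1) \<delta>2(1) by (intro exI[of _ "min \<delta>1 \<delta>2"]) auto
qed

text \<open>Finitely many isolating neighbourhoods cover the compact set of minimal vectors; 0 is
  added as the orbit without a minimal vector.\<close>

lemma finite_representatives:
  obtains D where "finite D" "\<And>x. x \<in> V \<Longrightarrow> \<exists>d\<in>D. levi_conj x d"
proof -
  obtain \<delta> where \<delta>: "\<And>X. X \<in> minimal_vectors \<Longrightarrow> \<delta> X > 0"
    "\<And>X x. X \<in> minimal_vectors \<Longrightarrow> x \<in> minimal_vectors \<Longrightarrow> dist x X < \<delta> X \<Longrightarrow> levi_conj x X"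
    using minimal_vectors_isolated by metis
  obtain D where D: "D \<subseteq> minimal_vectors" "finite D" "minimal_vectors \<subseteq> (\<Union>X\<in>D. ball X (\<delta> X))"
    using compactE_image[OF compact_minimal_vectors, of minimal_vectors "\<lambda>X. ball X (\<delta> X)"] \<delta>(1)
    by (metis (no_types, lifting) UN_iff centre_in_ball open_ball subsetI)
  have "\<exists>d\<in>insert 0 D. levi_conj x d" if x: "x \<in> V" for x
  proof (cases "x = 0")
    case False
    obtain X where X: "X \<in> minimal_vectors" "levi_conj x X" using minimal_vector_exists[OF x False] by blast
    then obtain d where "d \<in> D" "dist X d < \<delta> d" using D(3) by (auto simp: dist_commute)
    then have "levi_conj X d" using \<delta>(2) X D(1) by blast
    then show ?thesis using levi_conj_trans X \<open>d \<in> D\<close> by blast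
  qed (use levi_conj_refl in auto)
  then show ?thesis using that[of "insert 0 D"] D(2) by blast
qed

lemma GL_action: "group_action GL V (natural_action V)"
  unfolding levi_group_def
  by (rule connected_subgroup_action[OF L_ad_system])
    (auto intro!: lin_exp_in_subspace br_linear V_subspace L_V)

lemma orbit_eq: "x \<in> V \<Longrightarrow> orbit GL (natural_action V) x = {y. levi_conj x y}"
  using orbit_natural_action[OF L_ad_system] by (auto simp: levi_group_def levi_conj_def)

lemma finite_orbits: "finite (orbits GL V (natural_action V))"
proof -
  obtain D where D: "finite D" "\<And>x. x \<in> V \<Longrightarrow> \<exists>d\<in>D. levi_conj x d" using finite_representatives by blast
  have "orbits GL V (natural_action V) \<subseteq> (\<lambda>d. {y. levi_conj d y}) ` D"
  proof
    fix O' assume "O' \<in> orbits GL V (natural_action V)"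
    then obtain x where x: "x \<in> V" "O' = {y. levi_conj x y}" by (auto simp: orbits_def orbit_eq)
    then obtain d where d: "d \<in> D" "levi_conj x d" using D by blast
    then have "{y. levi_conj x y} = {y. levi_conj d y}" using levi_conj_trans levi_conj_sym by blast
    then show "O' \<in> (\<lambda>d. {y. levi_conj d y}) ` D" using d x by blast
  qed
  then show ?thesis using D(1) finite_surj by blast
qed

end

section \<open>Eigenvectors of \<open>\<tau>\<close>\<close>

text \<open>\<open>a0_maximal\<close> is maximality of \<open>\<aa>0\<close> in terms of single
  elements: a vector centralizing \<open>\<aa>0\<close> and negated by both involutions could be
  adjoined to \<open>\<aa>0\<close>.\<close>

locale cartan_symmetric = cartan_grading br \<theta> \<aa>0 \<alpha>
  for br :: "'g::euclidean_space \<Rightarrow> 'g \<Rightarrow> 'g" and \<theta> and \<aa>0 and \<alpha> +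
  fixes \<sigma> \<tau> :: "'g \<Rightarrow> 'g"
  assumes sigma_involution: "lie_involution br \<sigma>"
    and sigma_theta: "\<sigma> (\<theta> x) = \<theta> (\<sigma> x)"
    and tau_def: "\<tau> = \<sigma> \<circ> \<theta>"
    and sigma_a0: "A \<in> \<aa>0 \<Longrightarrow> \<sigma> A = - A"
    and a0_maximal: "x \<in> L \<Longrightarrow> \<sigma> x = - x \<Longrightarrow> \<theta> x = - x \<Longrightarrow> x \<in> \<aa>0"
    and V_nontrivial: "V \<noteq> {0}"
begin

abbreviation Veps :: "real \<Rightarrow> 'g set" where "Veps \<epsilon> \<equiv> eigenpart \<tau> V \<epsilon>"
abbreviation mplus :: "'g set" where
  "mplus \<equiv> lie_centralizer br ({x. \<theta> x = x} \<inter> {x. \<sigma> x = x}) \<aa>0"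
abbreviation GM :: "('g \<Rightarrow> 'g) monoid" where
  "GM \<equiv> m_plus_group br {x. \<theta> x = x} {x. \<sigma> x = x} \<aa>0"

lemma sigma: "linear \<sigma>" "\<sigma> (\<sigma> z) = z" "\<sigma> (br u v) = br (\<sigma> u) (\<sigma> v)"
  using sigma_involution by (auto simp: lie_involution_def)

lemma tau: "linear \<tau>" "\<tau> (\<tau> z) = z" "\<tau> (br u v) = br (\<tau> u) (\<tau> v)" "\<tau> (\<theta> z) = \<theta> (\<tau> z)"
  using linear_compose[OF theta(1) sigma(1)] by (auto simp: tau_def sigma theta sigma_theta)

lemmas tau_simps = tau(2) linear_add[OF tau(1)] linear_diff[OF tau(1)]
  linear_neg[OF tau(1)] linear_scale[OF tau(1)] linear_0[OF tau(1)]

lemma tau_a0: "A \<in> \<aa>0 \<Longrightarrow> \<tau> A = A"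
  by (simp add: tau_def theta_a0 sigma_a0 linear_neg[OF sigma(1)])

lemma tau_V: "x \<in> V \<Longrightarrow> \<tau> x \<in> V"
proof -
  assume x: "x \<in> V"
  have "br A (\<tau> x) = \<alpha> A *\<^sub>R \<tau> x" if A: "A \<in> \<aa>0" for A
  proof -
    have "br A (\<tau> x) = \<tau> (br (\<tau> A) x)" by (simp add: tau)
    then show ?thesis by (simp add: tau_a0[OF A] V_D[OF x A] tau_simps)
  qed
  then show ?thesis by (simp add: root_space_def)
qed

lemma tau_L: "Z \<in> L \<Longrightarrow> \<tau> Z \<in> L"
proof -
  assume Z: "Z \<in> L"
  have "br A (\<tau> Z) = 0" if A: "A \<in> \<aa>0" for A
  proof -
    have "br A (\<tau> Z) = \<tau> (br (\<tau> A) Z)" by (simp add: tau)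
    then show ?thesis by (simp add: tau_a0[OF A] L_D[OF Z A] tau_simps)
  qed
  then show ?thesis by (simp add: lie_centralizer_def)
qed

lemma Veps_subspace: "subspace (Veps \<epsilon>)"
  using V_subspace by (auto simp: eigenpart_def subspace_def tau_simps algebra_simps)

lemma Veps_V: "x \<in> Veps \<epsilon> \<Longrightarrow> x \<in> V"
  by (simp add: eigenpart_def)

lemma mplus_subspace: "subspace mplus"
  by (auto simp: subspace_def lie_centralizer_def br_simps theta_simps linear_add[OF sigma(1)]
      linear_scale[OF sigma(1)] linear_0[OF sigma(1)])

lemma tau_fixed_subspace: "subspace {Z \<in> L. \<tau> Z = Z}"
  using L_subspace by (auto simp: subspace_def tau_simps)

text \<open>\<open>\<sigma>\<close> and \<open>\<theta>\<close> agree on vectors fixed by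
  \<open>\<tau>\<close>, so the splitting under \<open>\<theta>\<close> is one under
  \<open>\<sigma>\<close> as well. The part negated by both lies in \<open>\<aa>0\<close> by
  maximality.\<close>

lemma tau_fixed_decomposition:
  assumes "Z \<in> L" "\<tau> Z = Z"
  obtains M A where "M \<in> mplus" "A \<in> \<aa>0" "Z = M + A"
proof -
  have st: "\<sigma> Z = \<theta> Z" "\<sigma> (\<theta> Z) = Z"
  proof -
    show "\<sigma> (\<theta> Z) = Z" using assms(2) by (simp add: tau_def)
    then show "\<sigma> Z = \<theta> Z" by (metis sigma(2))
  qed
  have thZ: "\<theta> Z \<in> L"
  proof -
    have "br A (\<theta> Z) = 0" if A: "A \<in> \<aa>0" for A
    proof -
      have "br A (\<theta> Z) = \<theta> (br (\<theta> A) Z)" by (simp add: theta)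
      then show ?thesis by (simp add: theta_a0[OF A] br_simps L_D[OF assms(1) A] theta_simps)
    qed
    then show ?thesis by (simp add: lie_centralizer_def)
  qed
  define M A where "M = (1/2) *\<^sub>R (Z + \<theta> Z)" and "A = (1/2) *\<^sub>R (Z - \<theta> Z)"
  have "M \<in> L" "A \<in> L"
    using L_subspace assms(1) thZ by (auto simp: M_def A_def intro!: subspace_scale subspace_add subspace_diff)
  moreover have "\<theta> M = M" "\<sigma> M = M"
    by (simp_all add: M_def theta_simps linear_add[OF sigma(1)] linear_scale[OF sigma(1)] st add.commute)
  ultimately have "M \<in> mplus" by (simp add: lie_centralizer_def)
  moreover have "\<theta> A = - A" "\<sigma> A = - A"
    by (simp_all add: A_def theta_simps linear_diff[OF sigma(1)] linear_scale[OF sigma(1)] st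
        scaleR_diff_right)
  then have "A \<in> \<aa>0" using a0_maximal \<open>A \<in> L\<close> by blast
  moreover have "Z = M + A"
    by (simp add: M_def A_def algebra_simps flip: scaleR_add_left)
  ultimately show ?thesis using that by blast
qed

lemma Veps_br:
  assumes "\<epsilon> \<in> {1, -1}" "X \<in> Veps \<epsilon>" "s \<in> Veps \<epsilon>"
  shows "br (\<theta> X) s \<in> {Z \<in> L. \<tau> Z = Z}"
  using assms thetaV_V[of X s] by (auto simp: eigenpart_def tau br_simps theta_simps)

text \<open>The moment of an eigenvector of \<open>\<tau>\<close> lies in \<open>\<aa>0\<close> by maximality, so the slice through such a
  vector is trivial.\<close>

lemma moment_Veps:
  assumes "\<epsilon> \<in> {1, -1}" "X \<in> Veps \<epsilon>"
  shows "moment X \<in> \<aa>0"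
proof -
  have *: "moment X \<in> L" "\<tau> (moment X) = moment X" using Veps_br[OF assms assms(2)] by auto
  have "\<sigma> (moment X) = \<tau> (\<theta> (moment X))" by (simp only: tau_def comp_apply theta(2))
  also have "\<dots> = - moment X" using * by (simp only: theta_moment tau_simps)
  finally show ?thesis using a0_maximal * theta_moment by blast
qed

lemma trivial_slice:
  assumes \<epsilon>: "\<epsilon> \<in> {1, -1}" and X: "X \<in> Veps \<epsilon>" "X \<noteq> 0"
    and s: "s \<in> V" "br (\<theta> X) s = 0"
  shows "s = 0"
proof -
  have A: "moment X \<in> \<aa>0" by (rule moment_Veps[OF \<epsilon> X(1)])
  have "\<alpha> (moment X) * ip X X = mnorm X"
    by (simp add: ip_moment_self V_D[OF Veps_V[OF X(1)] A] ip_simps)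
  then have "\<alpha> (moment X) * ip X X > 0" using mnorm_pos[OF Veps_V[OF X(1)] X(2)] by simp
  then have "\<alpha> (moment X) > 0" using ip_nonneg[of X] by (simp add: zero_less_mult_iff)
  \<comment> \<open>\<open>moment X\<close> acts on \<open>V\<close> by a positive scalar, whereas
    its quadratic form is nonpositive on the slice.\<close>
  moreover have "\<alpha> (moment X) * ip s s = - ip (br X s) (br X s)"
    using moment_slice(2)[OF s(2)] by (simp add: V_D[OF s(1) A] ip_simps)
  ultimately have "ip s s \<le> 0"
    using ip_nonneg[of "br X s"] by (metis mult_le_0_iff neg_le_0_iff_le not_le)
  then show ?thesis using ip_nonneg[of s] ip_eq_0_iff by (metis order_antisym)
qed

lemma orbit_neighbourhood:
  assumes "\<epsilon> \<in> {1, -1}" "X \<in> Veps \<epsilon>" "X \<noteq> 0"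
  shows "\<exists>\<delta>>0. \<forall>x\<in>V. dist x X < \<delta> \<longrightarrow> levi_conj x X"
proof -
  obtain \<delta> where \<delta>: "\<delta> > 0"
    "\<And>x. x \<in> V \<Longrightarrow> dist x X < \<delta> \<Longrightarrow> \<exists>Y\<in>V. br (\<theta> X) Y = 0 \<and> ip Y Y < 1 \<and> levi_conj x (X + Y)"
    using moment_slice_nearby[OF Veps_V[OF assms(2)], of 1] by auto
  have "levi_conj x X" if x: "x \<in> V" "dist x X < \<delta>" for x
  proof -
    obtain Y where "Y \<in> V" "br (\<theta> X) Y = 0" "levi_conj x (X + Y)" using \<delta>(2)[OF x] by blast
    then show ?thesis using trivial_slice[OF assms, of Y] by simp
  qed
  then show ?thesis using \<delta>(1) by blast
qed

text \<open>\<open>x + \<tau> x\<close> and \<open>x - \<tau> x\<close> add up to twice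
  \<open>x\<close>, so one of them is nonzero. The explicit form keeps the eigenvector in every
  \<open>\<tau>\<close>-invariant subspace containing \<open>x\<close>.\<close>

lemma Veps_nontrivial:
  assumes "x \<in> V" "x \<noteq> 0"
  obtains \<epsilon> where "\<epsilon> \<in> {1, -1}" "x + \<epsilon> *\<^sub>R \<tau> x \<in> Veps \<epsilon>" "x + \<epsilon> *\<^sub>R \<tau> x \<noteq> 0"
proof -
  have e: "x + \<epsilon> *\<^sub>R \<tau> x \<in> Veps \<epsilon>" if "\<epsilon> \<in> {1, -1}" for \<epsilon>
    using that assms(1) tau_V[OF assms(1)] V_subspace
    by (auto simp: eigenpart_def tau_simps subspace_add subspace_diff)
  have "x + \<tau> x \<noteq> 0 \<or> x - \<tau> x \<noteq> 0"
  proof (rule ccontr)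
    assume "\<not> ?thesis"
    then have "x + \<tau> x = 0" "x - \<tau> x = 0" by blast+
    then have "(x + \<tau> x) + (x - \<tau> x) = 0" by (simp only: add_0)
    then have "2 *\<^sub>R x = 0" by (simp add: scaleR_2)
    then show False using assms(2) by simp
  qed
  then show ?thesis using that[of 1] that[of "-1"] e[of 1] e[of "-1"] by auto
qed

text \<open>Group elements are continuous and transport the neighbourhood of \<open>X\<close> to
  every point of its orbit.\<close>

lemma open_class:
  assumes "\<epsilon> \<in> {1, -1}" "X \<in> Veps \<epsilon>" "X \<noteq> 0"
  shows "openin (top_of_set V) {y. levi_conj X y}"
  unfolding openin_euclidean_subtopology_iff
proof (intro conjI ballI)
  show "{y. levi_conj X y} \<subseteq> V" using levi_conj_V Veps_V[OF assms(2)] by blast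
  fix y assume "y \<in> {y. levi_conj X y}"
  then obtain g where g: "g \<in> carrier GL" "g X = y" by (auto simp: levi_conj_def)
  obtain h where h: "h \<in> carrier GL" "\<And>x. h (g x) = x" "\<And>x. g (h x) = x"
    using GL_inverse[OF g(1)] by blast
  obtain \<delta> where \<delta>: "\<delta> > 0" "\<And>x. x \<in> V \<Longrightarrow> dist x X < \<delta> \<Longrightarrow> levi_conj x X"
    using orbit_neighbourhood[OF assms] by blast
  have "isCont h y"
    using GL_linear[OF h(1)] by (simp add: linear_continuous_at linear_conv_bounded_linear)
  then obtain e where e: "e > 0" "\<And>y'. dist y' y < e \<Longrightarrow> dist (h y') (h y) < \<delta>"
    using \<delta>(1) unfolding continuous_at_eps_delta by blast
  have "levi_conj X y'" if y': "y' \<in> V" "dist y' y < e" for y'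
  proof -
    have "levi_conj (h y') X" using \<delta>(2)[of "h y'"] GL_V[OF h(1)] e(2) y' h(2)[of X] g by auto
    moreover have "levi_conj y' (h y')" using h(1) by (auto simp: levi_conj_def)
    ultimately show ?thesis by (meson levi_conj_trans levi_conj_sym)
  qed
  then show "\<exists>e>0. \<forall>x'\<in>V. dist x' y < e \<longrightarrow> x' \<in> {y. levi_conj X y}" using e(1) by blast
qed

lemma Veps_vector_exists:
  obtains \<epsilon> X where "\<epsilon> \<in> {1, -1}" "X \<in> Veps \<epsilon>" "X \<noteq> 0"
proof -
  obtain x where "x \<in> V" "x \<noteq> 0" using V_nontrivial subspace_0[OF V_subspace] by blast
  then show ?thesis using Veps_nontrivial that by metis
qed

lemma open_orbit: "\<exists>U \<in> orbits GL V (natural_action V). openin (top_of_set V) U"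
proof -
  obtain \<epsilon> X where X: "\<epsilon> \<in> {1, -1}" "X \<in> Veps \<epsilon>" "X \<noteq> 0" by (rule Veps_vector_exists)
  then have "{y. levi_conj X y} \<in> orbits GL V (natural_action V)"
    using orbit_eq[OF Veps_V[OF X(2)]] Veps_V[OF X(2)] by (auto simp: orbits_def)
  then show ?thesis using open_class[OF X] by blast
qed

subsection \<open>Transitivity on spheres\<close>

lemma mplus_ad_system: "ad_system br mplus"
  by (rule ad_systemI[OF lie_algebra_bilinear[OF lie] mplus_subspace])

lemma mplus_L: "M \<in> mplus \<Longrightarrow> M \<in> L"
  by (simp add: lie_centralizer_def)

lemma mplus_tau: "M \<in> mplus \<Longrightarrow> \<tau> M = M"
  by (simp add: lie_centralizer_def tau_def)

lemma tau_fixed_Veps: "Z \<in> L \<Longrightarrow> \<tau> Z = Z \<Longrightarrow> x \<in> Veps \<epsilon> \<Longrightarrow> br Z x \<in> Veps \<epsilon>"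
  using L_V[of Z x] by (auto simp: eigenpart_def tau br_simps)

text \<open>As \<open>\<theta> M = M\<close>, the operator \<open>ad M\<close> is skew for
  \<open>ip\<close>, and lengths are constant along its flow.\<close>

lemma mplus_isometry:
  assumes "M \<in> mplus"
  shows "ip (lin_exp (br M) x) (lin_exp (br M) x) = ip x x"
proof -
  define y where "y t = lin_exp (\<lambda>z. t *\<^sub>R br M z) x" for t
  have dy: "(y has_vector_derivative br M (y t)) (at t)" for t
    using lin_exp_has_vector_derivative[OF br_linear(1)] by (simp add: y_def[abs_def])
  have skew: "ip (br M z) z = 0" for z
    using ip_br[of M z z] assms by (simp add: lie_centralizer_def ip_commute[of z])
  have "((\<lambda>t. ip (y t) (y t)) has_real_derivative 0) (at t)" for t
    using bounded_bilinear.has_vector_derivative[OF bounded_bilinear_ip dy[of t] dy[of t]]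
    by (simp add: skew ip_commute[of "y t" "br M (y t)"] has_real_derivative_iff_has_vector_derivative)
  then have "ip (y 1) (y 1) = ip (y 0) (y 0)" by (intro DERIV_isconst_all) blast
  then show ?thesis by (simp add: y_def lin_exp_zero)
qed

lemma mplus_exp_sphere:
  "M \<in> mplus \<Longrightarrow> x \<in> unit_sphere br \<theta> (Veps \<epsilon>) \<Longrightarrow> lin_exp (br M) x \<in> unit_sphere br \<theta> (Veps \<epsilon>)"
  by (auto simp: unit_sphere_def mplus_isometry intro!: lin_exp_in_subspace[OF br_linear(1) Veps_subspace]
      tau_fixed_Veps mplus_L mplus_tau)

lemma GM_exp: "M \<in> mplus \<Longrightarrow> lin_exp (br M) \<in> carrier GM"
  unfolding m_plus_group_def by (rule connected_subgroup_exp[OF mplus_ad_system])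

lemma GM_comp: "g \<in> carrier GM \<Longrightarrow> h \<in> carrier GM \<Longrightarrow> g \<circ> h \<in> carrier GM"
  unfolding m_plus_group_def by (rule connected_subgroup_comp[OF mplus_ad_system])

lemma GM_linear: "g \<in> carrier GM \<Longrightarrow> linear g"
  unfolding m_plus_group_def by (rule connected_subgroup_linear[OF mplus_ad_system])

lemma GM_inverse:
  assumes "g \<in> carrier GM"
  shows "\<exists>h\<in>carrier GM. (\<forall>x. h (g x) = x) \<and> (\<forall>x. g (h x) = x)"
  using connected_subgroup_inverse[OF mplus_ad_system] assms unfolding m_plus_group_def by blast

lemma GM_action:
  "group_action GM (unit_sphere br \<theta> (Veps \<epsilon>)) (natural_action (unit_sphere br \<theta> (Veps \<epsilon>)))"
  unfolding m_plus_group_def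
  by (rule connected_subgroup_action[OF mplus_ad_system mplus_exp_sphere])

lemma GM_sphere:
  "g \<in> carrier GM \<Longrightarrow> x \<in> unit_sphere br \<theta> (Veps \<epsilon>) \<Longrightarrow> g x \<in> unit_sphere br \<theta> (Veps \<epsilon>)"
  unfolding m_plus_group_def
  by (rule connected_subgroup_preserves[OF mplus_ad_system _ mplus_exp_sphere])

text \<open>On an eigenspace of \<open>\<tau>\<close> these classes are the orbits of the group
  generated by the \<open>\<tau>\<close>-fixed part of \<open>L\<close>, because
  \<open>\<aa>0\<close> contributes exactly the positive scalars.\<close>

definition homothetic :: "'g \<Rightarrow> 'g \<Rightarrow> bool" where
  "homothetic x y \<longleftrightarrow> (\<exists>g\<in>carrier GM. \<exists>c>0. y = c *\<^sub>R g x)"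

lemma homothetic_sym: "homothetic x y \<Longrightarrow> homothetic y x"
proof -
  assume "homothetic x y"
  then obtain g c where g: "g \<in> carrier GM" "c > 0" "y = c *\<^sub>R g x" by (auto simp: homothetic_def)
  obtain h where h: "h \<in> carrier GM" "\<And>x. h (g x) = x" "\<And>x. g (h x) = x"
    using GM_inverse[OF g(1)] by blast
  have "x = (1 / c) *\<^sub>R h y" using g h by (simp add: linear_scale[OF GM_linear[OF h(1)]])
  then show ?thesis using h(1) g(2) unfolding homothetic_def by (metis zero_less_divide_1_iff)
qed

lemma homothetic_trans: "homothetic x y \<Longrightarrow> homothetic y z \<Longrightarrow> homothetic x z"
proof -
  assume "homothetic x y" "homothetic y z"
  then obtain g c h d where "g \<in> carrier GM" "c > 0" "y = c *\<^sub>R g x"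
    "h \<in> carrier GM" "d > 0" "z = d *\<^sub>R h y" by (auto simp: homothetic_def)
  then have "h \<circ> g \<in> carrier GM" "d * c > 0" "z = (d * c) *\<^sub>R (h \<circ> g) x"
    using GM_comp by (auto simp: linear_scale[OF GM_linear])
  then show ?thesis unfolding homothetic_def by blast
qed

text \<open>The slice is trivial, so nearby points are \<open>lin_exp (br Z) X\<close> with
  \<open>\<tau> Z = Z\<close>. In \<open>Z = M + A\<close> the two parts commute, and
  \<open>exp (ad A)\<close> only rescales \<open>X\<close>.\<close>

lemma homothetic_neighbourhood:
  assumes \<epsilon>: "\<epsilon> \<in> {1, -1}" and X: "X \<in> Veps \<epsilon>" "X \<noteq> 0"
  shows "\<exists>\<delta>>0. \<forall>x\<in>Veps \<epsilon>. dist x X < \<delta> \<longrightarrow> homothetic X x"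
proof -
  let ?L = "{Z \<in> L. \<tau> Z = Z}"
  have "\<exists>Z\<in>?L. \<exists>Y\<in>{0}. v = br Z X + Y" if v: "v \<in> Veps \<epsilon>" for v
  proof -
    have "\<exists>Z\<in>?L. \<exists>Y\<in>{Y \<in> Veps \<epsilon>. br (\<theta> X) Y = 0}. v = br Z X + Y"
      by (rule tangent_decomposition[OF tau_fixed_subspace Veps_subspace _ Veps_br[OF \<epsilon> X(1)] v])
        (use tau_fixed_Veps X in auto)
    then show ?thesis using trivial_slice[OF \<epsilon> X] Veps_V by blast
  qed
  then have "\<exists>\<delta>>0. \<forall>x\<in>Veps \<epsilon>. dist x X < \<delta> \<longrightarrow>
      (\<exists>Z\<in>?L. \<exists>Y\<in>{0}. norm Y < 1 \<and> x = lin_exp (br Z) (X + Y))"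
    using tau_fixed_Veps X subspace_0[OF Veps_subspace]
    by (intro exp_ad_slice lie_algebra_bilinear[OF lie] tau_fixed_subspace Veps_subspace subspace_single_0) auto
  moreover have "homothetic X (lin_exp (br Z) X)" if Z: "Z \<in> L" "\<tau> Z = Z" for Z
  proof -
    obtain M A where MA: "M \<in> mplus" "A \<in> \<aa>0" "Z = M + A" using tau_fixed_decomposition[OF Z] by blast
    have "br M (br A x) = br A (br M x)" for x
      using jacobi[of A M x] L_D[OF mplus_L[OF MA(1)] MA(2)] by (simp add: br_simps)
    then have "lin_exp (\<lambda>x. br M x + br A x) X = lin_exp (br M) (lin_exp (br A) X)"
      by (rule lin_exp_add[OF br_linear(1) br_linear(1)])
    also have "(\<lambda>x. br M x + br A x) = br Z" by (simp add: MA(3) br_simps fun_eq_iff)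
    also have "lin_exp (br A) X = exp (\<alpha> A) *\<^sub>R X"
      by (rule lin_exp_eigenvector[OF br_linear(1) V_D[OF Veps_V[OF X(1)] MA(2)]])
    also have "lin_exp (br M) \<dots> = exp (\<alpha> A) *\<^sub>R lin_exp (br M) X"
      by (rule linear_scale[OF linear_lin_exp[OF br_linear(1)]])
    finally show ?thesis using GM_exp[OF MA(1)] unfolding homothetic_def by (metis exp_gt_zero)
  qed
  ultimately show ?thesis by (smt (verit) add_0_right mem_Collect_eq singletonD)
qed

text \<open>The classes are open, and a punctured space of dimension greater than one is
  connected.\<close>

lemma homothetic_Veps:
  assumes \<epsilon>: "\<epsilon> \<in> {1, -1}" and dim: "dim (Veps \<epsilon>) > 1"
    and xy: "x \<in> Veps \<epsilon>" "x \<noteq> 0" "y \<in> Veps \<epsilon>" "y \<noteq> 0"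
  shows "homothetic x y"
proof (rule connected_equivalence_relation[of "Veps \<epsilon> - {0}" x y homothetic])
  show "connected (Veps \<epsilon> - {0})"
    using dim aff_dim_subspace[OF Veps_subspace] subspace_imp_convex[OF Veps_subspace]
    by (intro connected_punctured_convex) auto
  fix X assume X: "X \<in> Veps \<epsilon> - {0}"
  then obtain \<delta> where \<delta>: "\<delta> > 0" "\<And>x. x \<in> Veps \<epsilon> \<Longrightarrow> dist x X < \<delta> \<Longrightarrow> homothetic X x"
    using homothetic_neighbourhood[OF \<epsilon>] by blast
  show "\<exists>T. openin (top_of_set (Veps \<epsilon> - {0})) T \<and> X \<in> T \<and> (\<forall>x\<in>T. homothetic X x)"
    using X \<delta> openin_open_Int[OF open_ball, of "Veps \<epsilon> - {0}" X \<delta>]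
    by (intro exI[of _ "(Veps \<epsilon> - {0}) \<inter> ball X \<delta>"]) (auto simp: dist_commute)
qed (use xy homothetic_sym homothetic_trans in blast)+

lemma GM_transitive:
  assumes \<epsilon>: "\<epsilon> \<in> {1, -1}" and dim: "dim (Veps \<epsilon>) > 1"
  shows "transitive_action GM (unit_sphere br \<theta> (Veps \<epsilon>)) (natural_action (unit_sphere br \<theta> (Veps \<epsilon>)))"
proof -
  let ?S = "unit_sphere br \<theta> (Veps \<epsilon>)"
  have "\<exists>g\<in>carrier GM. natural_action ?S g x = y" if xy: "x \<in> ?S" "y \<in> ?S" for x y
  proof -
    have "x \<noteq> 0" "y \<noteq> 0" using xy by (auto simp: unit_sphere_def ip_simps)
    then have "homothetic x y" using homothetic_Veps[OF assms] xy by (auto simp: unit_sphere_def)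
    then obtain g c where g: "g \<in> carrier GM" "c > 0" "y = c *\<^sub>R g x" by (auto simp: homothetic_def)
    \<comment> \<open>\<open>M\<^sup>+\<close> preserves lengths, so the positive factor between
      unit vectors is 1.\<close>
    have "ip (g x) (g x) = 1" "ip y y = 1"
      using GM_sphere[OF g(1) xy(1)] xy(2) by (auto simp: unit_sphere_def)
    then have "c * c = 1" by (simp add: g(3) ip_simps)
    then have "c = 1" using g(2) by (auto simp: square_eq_1_iff)
    then show ?thesis using g xy(1) by (auto simp: natural_action_def)
  qed
  then show ?thesis using GM_action
    by (simp add: transitive_action_def transitive_action_axioms_def)
qed

subsection \<open>The extension by \<open>\<tau>\<close>\<close>

abbreviation Gext where "Gext \<equiv> extended_by GL \<tau>"

text \<open>Conjugation by the automorphism \<open>\<tau>\<close> turns \<open>exp (ad X)\<close>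
  into \<open>exp (ad (\<tau> X))\<close>, and \<open>\<tau>\<close> preserves
  \<open>L\<close>.\<close>

lemma GL_tau:
  assumes "g \<in> carrier GL"
  shows "\<tau> \<circ> g \<circ> \<tau> \<in> carrier GL"
  using assms L_ad_system unfolding levi_group_def
proof (induction rule: connected_subgroup_induct)
  case one
  have "\<tau> \<circ> id \<circ> \<tau> = id" by (auto simp: tau)
  then show ?case using connected_subgroup_id[OF L_ad_system] by (simp only:)
next
  case (exp X)
  have "\<tau> \<circ> lin_exp (br X) \<circ> \<tau> = lin_exp (br (\<tau> X))"
  proof
    fix x
    have "\<tau> (lin_exp (br X) (\<tau> x)) = lin_exp (br (\<tau> X)) (\<tau> (\<tau> x))"
      by (rule lin_exp_intertwine[OF br_linear(1) br_linear(1) tau(1)]) (simp add: tau)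
    then show "(\<tau> \<circ> lin_exp (br X) \<circ> \<tau>) x = lin_exp (br (\<tau> X)) x" by (simp add: tau)
  qed
  then show ?case using connected_subgroup_exp[OF L_ad_system tau_L[OF exp]] by (simp only:)
next
  case (comp g h)
  have "\<tau> \<circ> (g \<circ> h) \<circ> \<tau> = (\<tau> \<circ> g \<circ> \<tau>) \<circ> (\<tau> \<circ> h \<circ> \<tau>)" by (auto simp: tau)
  then show ?case using connected_subgroup_comp[OF L_ad_system comp(3,4)] by (simp only:)
qed

lemma tau_bij: "bij \<tau>" "inv_into UNIV \<tau> = \<tau>"
proof -
  show "bij \<tau>" by (rule o_bij[of \<tau>]) (auto simp: tau)
  show "inv_into UNIV \<tau> = \<tau>" by (rule inv_equality) (auto simp: tau)
qed

lemma Gext_carrier: "carrier Gext = carrier GL \<times> {id, \<tau>}"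
  by (simp add: extended_by_def semidirect_def)

lemma conjugate_in_GL: "h \<in> {id, \<tau>} \<Longrightarrow> g \<in> carrier GL \<Longrightarrow> h \<circ> g \<circ> h \<in> carrier GL"
  using GL_tau by auto

lemma Gext_mult:
  assumes "(n, h) \<in> carrier Gext" "(n', h') \<in> carrier Gext"
  shows "(n, h) \<otimes>\<^bsub>Gext\<^esub> (n', h') = (n \<circ> (h \<circ> n' \<circ> h), h \<circ> h')"
proof -
  have h: "h \<in> {id, \<tau>}" "h' \<in> {id, \<tau>}" "n \<in> carrier GL" "n' \<in> carrier GL"
    using assms by (auto simp: Gext_carrier)
  then have "inv_into UNIV h = h" by (auto simp: tau_bij)
  moreover have "n \<otimes>\<^bsub>GL\<^esub> (h \<circ> n' \<circ> h) = n \<circ> (h \<circ> n' \<circ> h)"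
    using connected_subgroup_mult[OF L_ad_system, folded levi_group_def] h conjugate_in_GL by blast
  moreover have "h \<otimes>\<^bsub>BijGroup UNIV\<^esub> h' = h \<circ> h'"
    using h tau_bij by (intro mult_BijGroup_UNIV) (auto simp: Bij_def)
  ultimately show ?thesis by (simp add: extended_by_def semidirect_def)
qed

lemma Gext_group: "group Gext"
proof (rule groupI)
  have one: "\<one>\<^bsub>Gext\<^esub> = (id, id)"
    by (simp add: extended_by_def semidirect_def levi_group_def connected_subgroup_def one_BijGroup_UNIV)
  have id: "id \<in> carrier GL" using connected_subgroup_id[OF L_ad_system] by (simp add: levi_group_def)
  show oneC: "\<one>\<^bsub>Gext\<^esub> \<in> carrier Gext" using id by (simp add: one Gext_carrier)
  show closed: "x \<otimes>\<^bsub>Gext\<^esub> y \<in> carrier Gext" if "x \<in> carrier Gext" "y \<in> carrier Gext" for x y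
  proof -
    obtain n h n' h' where xy: "x = (n, h)" "y = (n', h')" by (metis surj_pair)
    then have "h \<circ> h' \<in> {id, \<tau>}" "n \<circ> (h \<circ> n' \<circ> h) \<in> carrier GL"
      using that conjugate_in_GL GL_comp by (auto simp: Gext_carrier tau)
    then show ?thesis using that by (simp only: xy Gext_mult) (simp add: Gext_carrier)
  qed
  show "x \<otimes>\<^bsub>Gext\<^esub> y \<otimes>\<^bsub>Gext\<^esub> z = x \<otimes>\<^bsub>Gext\<^esub> (y \<otimes>\<^bsub>Gext\<^esub> z)"
    if "x \<in> carrier Gext" "y \<in> carrier Gext" "z \<in> carrier Gext" for x y z
  proof -
    obtain n h n' h' n'' h'' where xyz: "x = (n, h)" "y = (n', h')" "z = (n'', h'')"
      by (metis surj_pair)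
    have h: "h \<in> {id, \<tau>}" "h' \<in> {id, \<tau>}" using that by (auto simp: xyz Gext_carrier)
    have "(n, h) \<otimes>\<^bsub>Gext\<^esub> (n', h') \<otimes>\<^bsub>Gext\<^esub> (n'', h'') =
        (n \<circ> (h \<circ> n' \<circ> h) \<circ> ((h \<circ> h') \<circ> n'' \<circ> (h \<circ> h')), h \<circ> h' \<circ> h'')"
      using that closed[OF that(1,2)] by (simp only: xyz Gext_mult)
    moreover have "(n, h) \<otimes>\<^bsub>Gext\<^esub> ((n', h') \<otimes>\<^bsub>Gext\<^esub> (n'', h'')) =
        (n \<circ> (h \<circ> (n' \<circ> (h' \<circ> n'' \<circ> h')) \<circ> h), h \<circ> (h' \<circ> h''))"
      using that closed[OF that(2,3)] by (simp only: xyz Gext_mult)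
    moreover have "n \<circ> (h \<circ> n' \<circ> h) \<circ> ((h \<circ> h') \<circ> n'' \<circ> (h \<circ> h')) =
        n \<circ> (h \<circ> (n' \<circ> (h' \<circ> n'' \<circ> h')) \<circ> h)"
      using h by (auto simp: fun_eq_iff tau)
    ultimately show ?thesis by (simp only: xyz comp_assoc)
  qed
  show "\<one>\<^bsub>Gext\<^esub> \<otimes>\<^bsub>Gext\<^esub> x = x" if "x \<in> carrier Gext" for x
  proof -
    obtain n h where "x = (n, h)" by (metis surj_pair)
    then show ?thesis using that oneC Gext_mult[of id id n h] by (simp add: one)
  qed
  show "\<exists>y\<in>carrier Gext. y \<otimes>\<^bsub>Gext\<^esub> x = \<one>\<^bsub>Gext\<^esub>" if "x \<in> carrier Gext" for x
  proof -
    obtain n h where x: "x = (n, h)" by (metis surj_pair)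
    then have nh: "n \<in> carrier GL" "h \<in> {id, \<tau>}" using that by (auto simp: Gext_carrier)
    obtain n' where n': "n' \<in> carrier GL" "\<And>x. n' (n x) = x" "\<And>x. n (n' x) = x"
      using GL_inverse[OF nh(1)] by blast
    have y: "(h \<circ> n' \<circ> h, h) \<in> carrier Gext"
      using nh n' conjugate_in_GL by (simp add: Gext_carrier)
    have "(h \<circ> n' \<circ> h) \<circ> (h \<circ> n \<circ> h) = id" "h \<circ> h = id"
      using nh n' by (auto simp: fun_eq_iff tau)
    then show ?thesis
      using y that Gext_mult[OF y, of n h] by (metis x one)
  qed
qed

lemma Gext_V: "(n, h) \<in> carrier Gext \<Longrightarrow> x \<in> V \<Longrightarrow> (n \<circ> h) x \<in> V"
  using GL_V tau_V by (auto simp: Gext_carrier)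

lemma Gext_action: "group_action Gext V (extended_action V)"
proof -
  interpret B: group "BijGroup V" by (rule group_BijGroup)
  have bij: "restrict (n \<circ> h) V \<in> Bij V" if nh: "(n, h) \<in> carrier Gext" for n h
  proof -
    have n: "n \<in> carrier GL" and h: "h \<in> {id, \<tau>}" using nh by (auto simp: Gext_carrier)
    obtain n' where n': "n' \<in> carrier GL" "\<And>x. n' (n x) = x" "\<And>x. n (n' x) = x"
      using GL_inverse[OF n] by blast
    have "bij_betw (n \<circ> h) V V"
      by (rule bij_betw_byWitness[of V "h \<circ> n'" "n \<circ> h" V])
        (use n n' h tau_V GL_V[OF n] GL_V[OF n'(1)] in \<open>auto simp: tau\<close>)
    then have "bij_betw (restrict (n \<circ> h) V) V V" by (simp cong: bij_betw_cong)
    then show ?thesis by (simp add: Bij_def)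
  qed
  have "extended_action V \<in> hom Gext (BijGroup V)"
  proof (rule homI)
    fix x assume "x \<in> carrier Gext"
    then show "extended_action V x \<in> carrier (BijGroup V)"
      using bij by (cases x) (auto simp: BijGroup_def extended_action_def)
  next
    fix x y assume xy: "x \<in> carrier Gext" "y \<in> carrier Gext"
    obtain n h n' h' where e: "x = (n, h)" "y = (n', h')" by (metis surj_pair)
    have h: "h \<in> {id, \<tau>}" using xy by (auto simp: e Gext_carrier)
    have "extended_action V (x \<otimes>\<^bsub>Gext\<^esub> y) = restrict ((n \<circ> (h \<circ> n' \<circ> h)) \<circ> (h \<circ> h')) V"
      using xy by (simp only: e Gext_mult extended_action_def prod.case)
    \<comment> \<open>\<open>h\<close> is an involution, so the twist in the semidirect product
      cancels.\<close>
    also have "(n \<circ> (h \<circ> n' \<circ> h)) \<circ> (h \<circ> h') = (n \<circ> h) \<circ> (n' \<circ> h')"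
      using h by (auto simp: fun_eq_iff tau)
    also have "restrict \<dots> V = compose V (restrict (n \<circ> h) V) (restrict (n' \<circ> h') V)"
      using Gext_V[OF xy(2)[unfolded e]] by (auto simp: compose_def restrict_def)
    also have "\<dots> = extended_action V x \<otimes>\<^bsub>BijGroup V\<^esub> extended_action V y"
      using bij xy by (simp add: e BijGroup_def extended_action_def)
    finally show "extended_action V (x \<otimes>\<^bsub>Gext\<^esub> y) =
        extended_action V x \<otimes>\<^bsub>BijGroup V\<^esub> extended_action V y" .
  qed
  then show ?thesis
    by (auto simp: group_action_def group_hom_def group_hom_axioms_def Gext_group B.is_group)
qed

text \<open>\<open>W\<close> contains a nonzero eigenvector \<open>e\<close> of
  \<open>\<tau>\<close>, whose orbit contains all points of \<open>V\<close> near \<open>e\<close>.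
  Hence \<open>e + t v\<close> lies in \<open>W\<close> for each \<open>v \<in> V\<close> and small
  \<open>t > 0\<close>, and so does \<open>v\<close>.\<close>

lemma invariant_subspace_trivial:
  assumes W: "subspace W" "W \<subseteq> V" and inv: "\<And>g. g \<in> carrier Gext \<Longrightarrow> extended_action V g ` W \<subseteq> W"
  shows "W = {0} \<or> W = V"
proof (rule disjCI)
  assume "W \<noteq> V"
  show "W = {0}"
  proof (rule ccontr)
    assume "W \<noteq> {0}"
    then obtain w where w: "w \<in> W" "w \<noteq> 0" using subspace_0[OF W(1)] by blast
    have act: "n (h x) \<in> W" if "n \<in> carrier GL" "h \<in> {id, \<tau>}" "x \<in> W" for n h x
      using inv[of "(n, h)"] that W(2) by (force simp: Gext_carrier extended_action_def)
    have id: "id \<in> carrier GL" using connected_subgroup_id[OF L_ad_system] by (simp add: levi_group_def)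
    have tW: "\<tau> w \<in> W" using act[OF id, of \<tau> w] w by simp
    obtain \<epsilon> where \<epsilon>: "\<epsilon> \<in> {1, -1}" "w + \<epsilon> *\<^sub>R \<tau> w \<in> Veps \<epsilon>" "w + \<epsilon> *\<^sub>R \<tau> w \<noteq> 0"
      using Veps_nontrivial w W(2) by blast
    define e where "e = w + \<epsilon> *\<^sub>R \<tau> w"
    have eW: "e \<in> W" using w tW W(1) by (auto simp: e_def intro!: subspace_add subspace_scale)
    obtain \<delta> where \<delta>: "\<delta> > 0" "\<And>x. x \<in> V \<Longrightarrow> dist x e < \<delta> \<Longrightarrow> levi_conj x e"
      using orbit_neighbourhood[OF \<epsilon>] unfolding e_def by blast
    have "v \<in> W" if v: "v \<in> V" for v
    proof -
      \<comment> \<open>The summand 1 keeps the denominator positive when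
        \<open>v = 0\<close>.\<close>
      define t where "t = \<delta> / (2 * (1 + norm v))"
      have t: "t > 0" using \<delta>(1) by (simp add: t_def add_pos_nonneg)
      have "t * norm v < \<delta>"
      proof -
        have "t * norm v \<le> t * (1 + norm v)" using t by simp
        also have "\<dots> = \<delta> / 2"
          using add_pos_nonneg[of 1 "norm v"] by (simp add: t_def divide_simps)
        finally show ?thesis using \<delta>(1) by simp
      qed
      moreover have "e + t *\<^sub>R v \<in> V"
        using eW W(2) v V_subspace by (auto intro!: subspace_add subspace_scale)
      moreover have "dist (e + t *\<^sub>R v) e = t * norm v" using t by (simp add: dist_norm)
      ultimately have "levi_conj (e + t *\<^sub>R v) e" by (intro \<delta>(2)) simp_all
      from levi_conj_sym[OF this] obtain g where "g \<in> carrier GL" "g e = e + t *\<^sub>R v"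
        unfolding levi_conj_def by blast
      then have "e + t *\<^sub>R v \<in> W" using act[of g id e] eW by simp
      then have "(1 / t) *\<^sub>R ((e + t *\<^sub>R v) - e) \<in> W"
        using eW W(1) by (intro subspace_scale subspace_diff)
      then show ?thesis using t by simp
    qed
    then have "V \<subseteq> W" by (rule subsetI)
    then show False using W(2) \<open>W \<noteq> V\<close> by (simp add: subset_antisym)
  qed
qed

lemma Gext_irreducible: "irreducible_real_representation Gext V (extended_action V)"
  unfolding irreducible_real_representation_def real_representation_def
proof (intro conjI ballI allI impI)
  fix g assume "g \<in> carrier Gext"
  then obtain n h where g: "g = (n, h)" "n \<in> carrier GL" "h \<in> {id, \<tau>}" by (auto simp: Gext_carrier)
  have lin: "linear (n \<circ> h)"
    using g linear_compose[OF _ GL_linear[OF g(2)]] GL_linear[OF g(2)] tau(1) by auto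
  show "extended_action V g (x + y) = extended_action V g x + extended_action V g y"
    if "x \<in> V" "y \<in> V" for x y
    using that linear_add[OF lin] by (simp add: g(1) extended_action_def subspace_add[OF V_subspace])
  show "extended_action V g (c *\<^sub>R x) = c *\<^sub>R extended_action V g x" if "x \<in> V" for c x
    using that linear_scale[OF lin] by (simp add: g(1) extended_action_def subspace_scale[OF V_subspace])
qed (use V_subspace Gext_action V_nontrivial invariant_subspace_trivial in auto)

end

section \<open>Complexification\<close>

declare split_paired_All [simp del]

lemma cscale_add: "cscale c (z + w) = cscale c z + cscale c w"
  by (simp add: cscale_def algebra_simps)

lemma cscale_diff: "cscale c (z - w) = cscale c z - cscale c w"
  by (simp add: cscale_def algebra_simps)

lemma linear_cscale: "linear (cscale c)"
  by (rule linearI) (simp_all add: cscale_def algebra_simps)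

lemma cscale_0 [simp]: "cscale c 0 = 0" "cscale 0 z = 0"
  by (simp_all add: cscale_def zero_prod_def)

lemma cscale_1 [simp]: "cscale 1 z = z"
  by (simp add: cscale_def)

definition complex_linear :: "('v::real_vector \<times> 'v \<Rightarrow> 'v \<times> 'v) \<Rightarrow> bool" where
  "complex_linear f \<longleftrightarrow> (\<forall>z w. f (z + w) = f z + f w) \<and> (\<forall>c z. f (cscale c z) = cscale c (f z))"

lemma complex_linear_sum:
  assumes "complex_linear f"
  shows "f (\<Sum>i\<in>I. cscale (c i) (z i)) = (\<Sum>i\<in>I. cscale (c i) (f (z i)))"
proof -
  have "f 0 = 0" using assms by (metis complex_linear_def cscale_0(2))
  then show ?thesis
    using assms by (induction I rule: infinite_finite_induct) (auto simp: complex_linear_def)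
qed

lemma complex_linear_linear: "complex_linear f \<Longrightarrow> linear f"
proof (rule linearI)
  fix r z assume f: "complex_linear f"
  have "cscale (complex_of_real r) w = r *\<^sub>R w" for w :: "'a \<times> 'a"
    by (simp add: cscale_def scaleR_prod_def)
  then show "f (r *\<^sub>R z) = r *\<^sub>R f z" using f by (metis complex_linear_def)
qed (auto simp: complex_linear_def)

lemma complex_linear_complexify:
  "linear f \<Longrightarrow> complex_linear (\<lambda>z. (f (fst z), f (snd z)))"
  by (simp add: complex_linear_def cscale_def linear_add linear_diff linear_scale)

lemma complex_linear_comp: "complex_linear f \<Longrightarrow> complex_linear g \<Longrightarrow> complex_linear (\<lambda>z. f (g z))"
  by (simp add: complex_linear_def)

section \<open>Polynomial functions on the complexified space\<close>

lemma complex_polynomial_comp: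
  assumes "complex_polynomial p" "complex_linear g"
  shows "complex_polynomial (\<lambda>z. p (g z))"
  using assms(1)
proof induction
  case (linear f)
  then show ?case using assms(2) by (intro complex_polynomial.linear) (auto simp: complex_linear_def)
qed (auto intro: complex_polynomial.intros)

lemma complex_polynomial_sum:
  "(\<And>i. i \<in> I \<Longrightarrow> complex_polynomial (f i)) \<Longrightarrow> complex_polynomial (\<lambda>z. \<Sum>i\<in>I. f i z)"
  by (induction I rule: infinite_finite_induct) (auto intro: complex_polynomial.intros)

lemma complex_polynomial_prod:
  "(\<And>i. i \<in> I \<Longrightarrow> complex_polynomial (f i)) \<Longrightarrow> complex_polynomial (\<lambda>z. \<Prod>i\<in>I. f i z)"
  by (induction I rule: infinite_finite_induct) (auto intro: complex_polynomial.intros)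

text \<open>On a complex line one is left with polynomials in one variable, which have finitely many
  zeros unless they vanish identically.\<close>

lemma complex_polynomial_on_line:
  assumes "complex_polynomial p"
  shows "\<exists>q. \<forall>t. p (z + cscale t d) = poly q t"
  using assms
proof induction
  case (linear f)
  then show ?case by (intro exI[of _ "[:f z, f d:]"]) simp
next
  case (const c)
  then show ?case by (intro exI[of _ "[:c:]"]) simp
next
  case (add f g)
  then obtain q r where "\<forall>t. f (z + cscale t d) = poly q t" "\<forall>t. g (z + cscale t d) = poly r t" by blast
  then show ?case by (intro exI[of _ "q + r"]) simp
next
  case (mult f g)
  then obtain q r where "\<forall>t. f (z + cscale t d) = poly q t" "\<forall>t. g (z + cscale t d) = poly r t" by blast
  then show ?case by (intro exI[of _ "q * r"]) simp
qed

text \<open>The polynomial is the determinant of \<open>A w\<close>.\<close>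

lemma complex_polynomial_detecting_injectivity:
  fixes A :: "'v::euclidean_space \<times> 'v \<Rightarrow> 'v \<times> 'v \<Rightarrow> 'v \<times> 'v"
  assumes lin: "\<And>w. complex_linear (A w)"
    and aff: "\<And>w v. A w v = B w v + K v" "\<And>v. complex_linear (\<lambda>w. B w v)"
    and z: "\<And>v. A z v = v"
  obtains p where "complex_polynomial p" "p z \<noteq> 0" "\<And>w v. p w \<noteq> 0 \<Longrightarrow> A w v = 0 \<Longrightarrow> v = 0"
proof -
  define n where "n = card (Basis :: 'v set)"
  obtain e where e: "bij_betw e {0..<n} (Basis :: 'v set)"
    unfolding n_def using ex_bij_betw_nat_finite[OF finite_Basis] by blast
  have eB: "e i \<in> Basis" if "i < n" for i using e that by (auto simp: bij_betw_def)
  \<comment> \<open>\<open>cc i\<close> are complex coordinates; the real basis, embedded as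
    \<open>E j\<close>, is the corresponding complex basis.\<close>
  define cc where "cc i x = Complex (inner (fst x) (e i)) (inner (snd x) (e i))" for i and x :: "'v \<times> 'v"
  define E where "E j = (e j, 0::'v)" for j
  have cc_lin: "cc i (x + y) = cc i x + cc i y" "cc i (cscale c x) = c * cc i x" for i x y c
    by (simp_all add: cc_def cscale_def complex_eq_iff inner_add_left inner_diff_left algebra_simps)
  have cc_0: "cc i 0 = 0" for i by (simp add: cc_def complex_eq_iff)
  have cc_sum: "cc i (\<Sum>j\<in>J. cscale (c j) (x j)) = (\<Sum>j\<in>J. c j * cc i (x j))" for i J c x
    by (induction J rule: infinite_finite_induct) (auto simp: cc_lin cc_0)
  have cc_E: "cc i (E j) = (if i = j then 1 else 0)" if "i < n" "j < n" for i j
  proof -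
    have "inner (e j) (e i) = (if i = j then 1 else 0)"
      using that e eB by (auto simp: inner_Basis bij_betw_def inj_on_def)
    then show ?thesis by (simp add: cc_def E_def complex_eq_iff)
  qed
  have expand: "x = (\<Sum>j = 0..<n. cscale (cc j x) (E j))" for x
  proof -
    have s: "(\<Sum>j = 0..<n. inner y (e j) *\<^sub>R e j) = y" for y
      using sum.reindex_bij_betw[OF e, of "\<lambda>b. inner y b *\<^sub>R b"] by (simp add: euclidean_representation)
    have "(\<Sum>j = 0..<n. cscale (cc j x) (E j)) =
        (\<Sum>j = 0..<n. (inner (fst x) (e j) *\<^sub>R e j, inner (snd x) (e j) *\<^sub>R e j))"
      by (simp add: cscale_def cc_def E_def)
    also have "\<dots> = x" by (rule prod_eqI) (simp_all add: fst_sum snd_sum s)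
    finally show ?thesis by simp
  qed
  define M where "M w = mat n n (\<lambda>(i, j). cc i (A w (E j)))" for w
  define p where "p w = Determinant.det (M w)" for w
  have M: "M w \<in> carrier_mat n n" for w by (simp add: M_def)
  show ?thesis
  proof
    have entry: "complex_polynomial (\<lambda>w. cc i (A w (E j)))" for i j
      unfolding aff(1) cc_lin
      by (intro complex_polynomial.add complex_polynomial.const complex_polynomial.linear)
        (use aff(2) in \<open>auto simp: complex_linear_def cc_lin\<close>)
    \<comment> \<open>The Leibniz formula exhibits \<open>p\<close> as a polynomial, since each
      matrix entry is affine in \<open>w\<close>.\<close>
    have "p = (\<lambda>w. \<Sum>\<pi> | \<pi> permutes {0..<n}. signof \<pi> * (\<Prod>i = 0..<n. cc i (A w (E (\<pi> i)))))"
      unfolding p_def det_def'[OF M]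
      by (intro ext sum.cong refl arg_cong2[of _ _ _ _ "(*)"] prod.cong)
        (use permutes_in_image in \<open>fastforce simp: M_def\<close>)
    then show "complex_polynomial p"
      by (auto intro!: complex_polynomial_sum complex_polynomial_prod complex_polynomial.mult
          complex_polynomial.const entry)
    have "M z = 1\<^sub>m n" by (rule eq_matI) (auto simp: M_def z cc_E)
    then show "p z \<noteq> 0" by (simp add: p_def)
    fix w v assume pw: "p w \<noteq> 0" and v: "A w v = 0"
    define x where "x = vec n (\<lambda>j. cc j v)"
    have "M w *\<^sub>v x = 0\<^sub>v n"
    proof (rule eq_vecI)
      fix i assume "i < dim_vec (0\<^sub>v n :: complex vec)"
      then have i: "i < n" by simp
      have "(M w *\<^sub>v x) $ i = (\<Sum>j = 0..<n. cc j v * cc i (A w (E j)))"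
        using i by (simp add: M_def x_def scalar_prod_def mult.commute)
      also have "\<dots> = cc i (\<Sum>j = 0..<n. cscale (cc j v) (A w (E j)))" by (simp add: cc_sum)
      also have "\<dots> = cc i (A w v)"
        by (subst (2) expand[of v]) (simp add: complex_linear_sum[OF lin])
      finally show "(M w *\<^sub>v x) $ i = 0\<^sub>v n $ i" using i v by (simp add: cc_0)
    qed (simp add: M_def)
    moreover have "x \<in> carrier_vec n" by (simp add: x_def)
    ultimately have "x = 0\<^sub>v n" using det_0_iff_vec_prod_zero_field[OF M] pw by (auto simp: p_def)
    then have "cc j v = 0" if "j < n" for j using that by (metis index_vec index_zero_vec(1) x_def)
    then show "v = 0" by (subst expand) simp
  qed
qed

section \<open>The complexified Levi group and prehomogeneity\<close>

context cartan_symmetric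
begin

abbreviation brC where "brC \<equiv> complexify_bracket br"
abbreviation LC where "LC \<equiv> complexify_space L"
abbreviation VC where "VC \<equiv> complexify_space V"
abbreviation GC where "GC \<equiv> complex_levi_group br \<aa>0"

lemma brC_complex_linear: "complex_linear (brC z)" "complex_linear (\<lambda>z. brC z w)"
  by (auto simp: complex_linear_def complexify_bracket_def cscale_def br_simps algebra_simps)

lemma brC_bilinear: "bilinear brC"
  using brC_complex_linear by (auto simp: bilinear_def intro: complex_linear_linear)

lemma LC_subspace: "subspace LC" and VC_subspace: "subspace VC"
  using L_subspace V_subspace by (auto simp: complexify_space_def intro: subspace_Times)

lemma VC_cscale: "z \<in> VC \<Longrightarrow> cscale c z \<in> VC"
  using V_subspace
  by (auto simp: complexify_space_def cscale_def intro!: subspace_add subspace_diff subspace_scale)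

lemma LC_VC: "Z \<in> LC \<Longrightarrow> x \<in> VC \<Longrightarrow> brC Z x \<in> VC"
  using V_subspace L_V
  by (auto simp: complexify_space_def complexify_bracket_def intro!: subspace_add subspace_diff)

lemma LC_ad_system: "ad_system brC LC"
  by (rule ad_systemI[OF brC_bilinear LC_subspace])

lemma brC_linear: "linear (brC z)"
  by (rule complex_linear_linear[OF brC_complex_linear(1)])

lemma LC_exp_VC: "Z \<in> LC \<Longrightarrow> x \<in> VC \<Longrightarrow> lin_exp (brC Z) x \<in> VC"
  by (auto intro!: lin_exp_in_subspace brC_linear VC_subspace LC_VC)

text \<open>Complex scalars commute with \<open>brC Z\<close>, hence with its exponential.\<close>

lemma GC_complex_linear:
  assumes "g \<in> carrier GC"
  shows "complex_linear g"
  using assms LC_ad_system unfolding complex_levi_group_def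
proof (induction rule: connected_subgroup_induct)
  case one
  show ?case by (simp add: complex_linear_def)
next
  case (exp Z)
  have "cscale c (lin_exp (brC Z) x) = lin_exp (brC Z) (cscale c x)" for c x
    by (rule lin_exp_intertwine[OF brC_linear brC_linear linear_cscale])
      (use brC_complex_linear(1) in \<open>simp add: complex_linear_def\<close>)
  then show ?case
    using linear_add[OF linear_lin_exp[OF brC_linear]] by (simp add: complex_linear_def)
next
  case (comp g h)
  then show ?case by (simp add: complex_linear_def)
qed

lemma GC_representation: "complex_representation GC VC (natural_action VC)"
  unfolding complex_representation_def
proof (intro conjI ballI allI)
  show "group_action GC VC (natural_action VC)"
    unfolding complex_levi_group_def by (rule connected_subgroup_action[OF LC_ad_system LC_exp_VC])
  fix g assume g: "g \<in> carrier GC"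
  show "natural_action VC g (z + w) = natural_action VC g z + natural_action VC g w"
    if "z \<in> VC" "w \<in> VC" for z w
    using that GC_complex_linear[OF g] subspace_add[OF VC_subspace]
    by (simp add: natural_action_def complex_linear_def)
  show "natural_action VC g (cscale c z) = cscale c (natural_action VC g z)" if "z \<in> VC" for c z
    using that GC_complex_linear[OF g] VC_cscale by (simp add: natural_action_def complex_linear_def)
qed (use VC_subspace VC_cscale in auto)

definition levi_conjC :: "'g \<times> 'g \<Rightarrow> 'g \<times> 'g \<Rightarrow> bool" where
  "levi_conjC x y \<longleftrightarrow> (\<exists>g\<in>carrier GC. g x = y)"

lemma levi_conjC_trans: "levi_conjC x y \<Longrightarrow> levi_conjC y z \<Longrightarrow> levi_conjC x z"
  unfolding levi_conjC_def complex_levi_group_def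
  by (metis connected_subgroup_comp[OF LC_ad_system] comp_apply)

lemma GC_inverse:
  "g \<in> carrier GC \<Longrightarrow> \<exists>h\<in>carrier GC. (\<forall>x. h (g x) = x) \<and> (\<forall>x. g (h x) = x)"
  unfolding complex_levi_group_def by (rule connected_subgroup_inverse[OF LC_ad_system])

lemma levi_conjC_sym: "levi_conjC x y \<Longrightarrow> levi_conjC y x"
  unfolding levi_conjC_def using GC_inverse by metis

lemma GC_VC: "g \<in> carrier GC \<Longrightarrow> x \<in> VC \<Longrightarrow> g x \<in> VC"
  unfolding complex_levi_group_def
  by (rule connected_subgroup_preserves[OF LC_ad_system _ LC_exp_VC])

text \<open>The tangent space of the orbit is all of \<open>VC\<close>, so
  \<open>exp_ad_slice\<close> applies with the slice \<open>{0}\<close>.\<close>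

lemma GC_neighbourhood:
  assumes z: "z \<in> VC" and reg: "\<And>v. v \<in> VC \<Longrightarrow> \<exists>Z\<in>LC. v = brC Z z"
  shows "\<exists>\<delta>>0. \<forall>x\<in>VC. dist x z < \<delta> \<longrightarrow> levi_conjC z x"
proof -
  have "\<exists>\<delta>>0. \<forall>x\<in>VC. dist x z < \<delta> \<longrightarrow>
      (\<exists>Z\<in>LC. \<exists>Y\<in>{0}. norm Y < 1 \<and> x = lin_exp (brC Z) (z + Y))"
    using LC_VC z reg subspace_0[OF VC_subspace]
    by (intro exp_ad_slice brC_bilinear LC_subspace VC_subspace subspace_single_0) auto
  moreover have "levi_conjC z (lin_exp (brC Z) (z + 0))" if "Z \<in> LC" for Z
    using connected_subgroup_exp[OF LC_ad_system that]
    by (auto simp: levi_conjC_def complex_levi_group_def)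
  ultimately show ?thesis by (metis singletonD)
qed

text \<open>A linear right inverse \<open>R\<close> of \<open>Z \<mapsto> br Z e\<close> on
  \<open>V\<close> is complexified. \<open>A w\<close> is \<open>v \<mapsto> brC (RC v) w\<close> on
  \<open>VC\<close> and the identity on the kernel of \<open>\<pi>C\<close>; at
  \<open>w = (e, 0)\<close> it is the identity throughout. Where its determinant does not vanish,
  \<open>A w\<close> is bijective and the brackets \<open>brC Z w\<close> fill
  \<open>VC\<close>.\<close>

lemma regular_polynomial:
  assumes e: "e \<in> V" and reg: "\<And>v. v \<in> V \<Longrightarrow> \<exists>Z\<in>L. v = br Z e"
  obtains p where "complex_polynomial p" "p (e, 0) \<noteq> 0"
    "\<And>w v. w \<in> VC \<Longrightarrow> p w \<noteq> 0 \<Longrightarrow> v \<in> VC \<Longrightarrow> \<exists>Z\<in>LC. v = brC Z w"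
proof -
  obtain R where R: "range R \<subseteq> L" "linear R" "\<And>v. v \<in> V \<Longrightarrow> br (R v) e = v"
  proof -
    obtain R where "range R \<subseteq> L" "linear R" "\<forall>v\<in>(\<lambda>Z. br Z e) ` L. br (R v) e = v"
      using real_vector.linear_exists_right_inverse_on[OF br_linear(2) L_subspace] by blast
    then show ?thesis using reg that[of R] by blast
  qed
  obtain \<pi> where \<pi>: "linear \<pi>" "range \<pi> \<subseteq> V" "\<And>x. x \<in> V \<Longrightarrow> \<pi> x = x"
    using linear_projection_exists[OF V_subspace] by blast
  define \<pi>C where "\<pi>C z = (\<pi> (fst z), \<pi> (snd z))" for z
  define RC where "RC z = (R (fst z), R (snd z))" for z
  have lin: "complex_linear \<pi>C" "complex_linear RC"
    unfolding \<pi>C_def[abs_def] RC_def[abs_def] using \<pi>(1) R(2) by (auto intro: complex_linear_complexify)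
  have \<pi>C: "\<pi>C z \<in> VC" "z \<in> VC \<Longrightarrow> \<pi>C z = z" for z
    using \<pi> by (auto simp: \<pi>C_def complexify_space_def)
  have RC: "RC z \<in> LC" for z using R(1) by (auto simp: RC_def complexify_space_def)
  define A where "A w v = brC (RC (\<pi>C v)) w + (v - \<pi>C v)" for w v
  have linA: "complex_linear (A w)" for w
    using complex_linear_comp[OF brC_complex_linear(2) complex_linear_comp[OF lin(2,1)], of w] lin(1)
    by (simp add: A_def complex_linear_def cscale_add cscale_diff)
  have "br (R (\<pi> x)) e = \<pi> x" for x using R(3) \<pi>(2) by blast
  then have "A (e, 0) v = v" for v
    by (simp add: A_def complexify_bracket_def RC_def \<pi>C_def br_simps)
  from complex_polynomial_detecting_injectivity[where A = A and z = "(e, 0)", OF linA A_def brC_complex_linear(1) this]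
  obtain p where p: "complex_polynomial p" "p (e, 0) \<noteq> 0" "\<And>w v. p w \<noteq> 0 \<Longrightarrow> A w v = 0 \<Longrightarrow> v = 0"
    by metis
  have "\<exists>Z\<in>LC. y = brC Z w" if w: "w \<in> VC" "p w \<noteq> 0" and y: "y \<in> VC" for w y
  proof -
    have lA: "linear (A w)" by (rule complex_linear_linear[OF linA])
    have "inj (A w)" using p(3)[OF w(2)] linear_injective_0[OF lA] by blast
    then obtain v where v: "A w v = y" using linear_injective_imp_surjective[OF lA] by (metis surjD)
    have br: "brC (RC (\<pi>C v)) w \<in> VC" by (rule LC_VC[OF RC w(1)])
    \<comment> \<open>The component of \<open>v\<close> in the kernel of \<open>\<pi>C\<close> turns
      out to lie in \<open>VC\<close>, where \<open>\<pi>C\<close> is the identity, so it is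
      0.\<close>
    have "v - \<pi>C v = y - brC (RC (\<pi>C v)) w" using v unfolding A_def by (metis add_diff_cancel_left')
    then have "v - \<pi>C v \<in> VC" using br y VC_subspace by (simp add: subspace_diff)
    then have "v - \<pi>C v = \<pi>C (v - \<pi>C v)" by (simp add: \<pi>C)
    also have "\<dots> = \<pi>C v - \<pi>C (\<pi>C v)" by (rule linear_diff[OF complex_linear_linear[OF lin(1)]])
    also have "\<dots> = 0" by (simp add: \<pi>C)
    finally have "v - \<pi>C v = 0" .
    then have "y = brC (RC (\<pi>C v)) w" using v unfolding A_def by (metis add_0_right)
    then show ?thesis using RC by blast
  qed
  then show ?thesis using that p(1,2) by blast
qed

text \<open>The line through two points of the nonvanishing locus of a polynomial meets that locus in
  a cofinite, hence connected, subset of the complex plane.\<close>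

lemma regular_locus_orbit:
  assumes p: "complex_polynomial p"
    and reg: "\<And>w v. w \<in> VC \<Longrightarrow> p w \<noteq> 0 \<Longrightarrow> v \<in> VC \<Longrightarrow> \<exists>Z\<in>LC. v = brC Z w"
    and z: "z \<in> VC" "p z \<noteq> 0" and w: "w \<in> VC" "p w \<noteq> 0"
  shows "levi_conjC z w"
proof -
  define \<gamma> where "\<gamma> t = z + cscale t (w - z)" for t
  obtain q where q: "\<And>t. p (\<gamma> t) = poly q t"
    using complex_polynomial_on_line[OF p, of z "w - z"] by (auto simp: \<gamma>_def)
  define S where "S = - {t. poly q t = 0}"
  have \<gamma>01: "\<gamma> 0 = z" "\<gamma> 1 = w" by (simp_all add: \<gamma>_def)
  have \<gamma>V: "\<gamma> t \<in> VC" for t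
    unfolding \<gamma>_def using z(1) w(1)
    by (intro subspace_add[OF VC_subspace] VC_cscale subspace_diff[OF VC_subspace])
  have "q \<noteq> 0" using q[of 0] z(2) \<gamma>01 by auto
  then have "connected S"
    unfolding S_def
    by (intro path_connected_imp_connected path_connected_complement_countable countable_finite poly_roots_finite)
      auto
  have "continuous_on UNIV (\<lambda>t. (Re t *\<^sub>R fst d - Im t *\<^sub>R snd d, Re t *\<^sub>R snd d + Im t *\<^sub>R fst d))"
    for d :: "'g \<times> 'g"
    by (intro continuous_intros)
  then have cont: "continuous_on UNIV \<gamma>"
    unfolding \<gamma>_def cscale_def by (intro continuous_intros)
  have "levi_conjC (\<gamma> 0) (\<gamma> 1)"
  proof (rule connected_equivalence_relation[OF \<open>connected S\<close>, of 0 1 "\<lambda>s t. levi_conjC (\<gamma> s) (\<gamma> t)"])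
    show "0 \<in> S" "1 \<in> S" using q[of 0] q[of 1] \<gamma>01 z(2) w(2) by (auto simp: S_def)
    fix t assume t: "t \<in> S"
    then have "p (\<gamma> t) \<noteq> 0" by (simp add: S_def q)
    then obtain \<delta> where \<delta>: "\<delta> > 0" "\<And>x. x \<in> VC \<Longrightarrow> dist x (\<gamma> t) < \<delta> \<Longrightarrow> levi_conjC (\<gamma> t) x"
      using GC_neighbourhood[OF \<gamma>V reg[OF \<gamma>V]] by blast
    have "open (\<gamma> -` ball (\<gamma> t) \<delta>)" using cont by (simp add: continuous_on_open_vimage)
    then show "\<exists>T. openin (top_of_set S) T \<and> t \<in> T \<and> (\<forall>x\<in>T. levi_conjC (\<gamma> t) (\<gamma> x))"
      using t \<delta> \<gamma>V
      by (intro exI[of _ "S \<inter> \<gamma> -` ball (\<gamma> t) \<delta>"]) (auto simp: openin_open_Int dist_commute)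
  qed (use levi_conjC_sym levi_conjC_trans in blast)+
  then show ?thesis by (simp add: \<gamma>01)
qed

text \<open>The nonvanishing locus of \<open>p\<close> lies in the orbit of \<open>(e, 0)\<close>,
  so the orbit is the union of the translates of that locus. It is therefore the nonvanishing locus
  of the family of all \<open>p \<circ> h\<close> with \<open>h\<close> in the group.\<close>

lemma GC_prehomogeneous: "prehomogeneous GC VC (natural_action VC)"
proof -
  obtain \<epsilon> e where e: "\<epsilon> \<in> {1, -1}" "e \<in> Veps \<epsilon>" "e \<noteq> 0" by (rule Veps_vector_exists)
  have eV: "e \<in> V" by (rule Veps_V[OF e(2)])
  have "\<exists>Z\<in>L. v = br Z e" if v: "v \<in> V" for v
  proof -
    obtain Z Y where Z: "Z \<in> L" "Y \<in> V" "br (\<theta> e) Y = 0" "v = br Z e + Y"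
      using tangent_decomposition[OF L_subspace V_subspace L_V[OF _ eV] thetaV_V[OF eV] v] by blast
    then have "Y = 0" using trivial_slice[OF e] by blast
    then show ?thesis using Z by auto
  qed
  from regular_polynomial[OF eV this]
  obtain p where p: "complex_polynomial p" "p (e, 0) \<noteq> 0"
    "\<And>w v. w \<in> VC \<Longrightarrow> p w \<noteq> 0 \<Longrightarrow> v \<in> VC \<Longrightarrow> \<exists>Z\<in>LC. v = brC Z w"
    by metis
  have z: "(e, 0) \<in> VC" using eV subspace_0[OF V_subspace] by (simp add: complexify_space_def)
  define U where "U = {w. levi_conjC (e, 0) w}"
  have "U = {w \<in> VC. \<exists>h\<in>carrier GC. p (h w) \<noteq> 0}"
  proof (rule equalityI; rule subsetI)
    fix w assume "w \<in> U"
    then obtain g where g: "g \<in> carrier GC" "g (e, 0) = w" by (auto simp: U_def levi_conjC_def)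
    then obtain h where h: "h \<in> carrier GC" "\<forall>x. h (g x) = x" using GC_inverse by blast
    then have "p (h w) \<noteq> 0" using g(2) p(2) by metis
    moreover have "w \<in> VC" using GC_VC[OF g(1) z] g(2) by simp
    ultimately show "w \<in> {w \<in> VC. \<exists>h\<in>carrier GC. p (h w) \<noteq> 0}" using h(1) by blast
  next
    fix w assume "w \<in> {w \<in> VC. \<exists>h\<in>carrier GC. p (h w) \<noteq> 0}"
    then obtain h where h: "w \<in> VC" "h \<in> carrier GC" "p (h w) \<noteq> 0" by blast
    have "levi_conjC (e, 0) (h w)"
      by (rule regular_locus_orbit[OF p(1,3) z p(2) GC_VC[OF h(2,1)] h(3)])
    moreover have "levi_conjC w (h w)" using h(2) by (auto simp: levi_conjC_def)
    ultimately show "w \<in> U" unfolding U_def by (blast intro: levi_conjC_trans levi_conjC_sym)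
  qed
  then have "zariski_open_in VC U"
    unfolding zariski_open_in_def
    by (intro exI[of _ "(\<lambda>h w. p (h w)) ` carrier GC"])
      (auto intro: complex_polynomial_comp p(1) GC_complex_linear)
  moreover have "U = orbit GC (natural_action VC) (e, 0)"
    unfolding complex_levi_group_def orbit_natural_action[OF LC_ad_system z]
    unfolding U_def levi_conjC_def complex_levi_group_def by blast
  then have "U \<in> orbits GC VC (natural_action VC)" using z by (auto simp: orbits_def)
  ultimately show ?thesis using GC_representation by (auto simp: prehomogeneous_def)
qed

end

section \<open>From the given data to the assumptions of the locales\<close>

theorem propositionB1:
  fixes br :: "'g::euclidean_space \<Rightarrow> 'g \<Rightarrow> 'g"
    and \<sigma> \<theta> \<tau> :: "'g \<Rightarrow> 'g"
    and \<hh> \<kk> \<aa>0 \<aa> :: "'g set"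
    and \<alpha> :: "'g \<Rightarrow> real"
  assumes "semisimple_lie_algebra br"
    and "symmetric_pair br \<sigma> \<hh>"
    and "cartan_involution br \<theta>"
    and "\<sigma> \<circ> \<theta> = \<theta> \<circ> \<sigma>"
    and "\<kk> = {x. \<theta> x = x}"
    and "\<tau> = \<sigma> \<circ> \<theta>"
    and "maximal_abelian_in br (killing_perp br \<hh> \<inter> killing_perp br \<kk>) \<aa>0"
    and "maximal_abelian_in br (killing_perp br \<kk>) \<aa>"
    and "\<aa>0 \<subseteq> \<aa>"
    and "\<alpha> \<in> restricted_roots_to br \<aa> \<aa>0"
  shows "(group_action (levi_group br \<aa>0) (root_space br \<aa>0 \<alpha>)
              (natural_action (root_space br \<aa>0 \<alpha>)) \<and>
          finite (orbits (levi_group br \<aa>0) (root_space br \<aa>0 \<alpha>)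
              (natural_action (root_space br \<aa>0 \<alpha>))) \<and>
          (\<exists>U \<in> orbits (levi_group br \<aa>0) (root_space br \<aa>0 \<alpha>)
              (natural_action (root_space br \<aa>0 \<alpha>)).
             openin (top_of_set (root_space br \<aa>0 \<alpha>)) U) \<and>
          prehomogeneous (complex_levi_group br \<aa>0) (complexify_space (root_space br \<aa>0 \<alpha>))
              (natural_action (complexify_space (root_space br \<aa>0 \<alpha>)))) \<and>
         (\<forall>\<epsilon> \<in> {1, -1}.
            dim (eigenpart \<tau> (root_space br \<aa>0 \<alpha>) \<epsilon>) > 1 \<longrightarrow>
            transitive_action (m_plus_group br \<kk> \<hh> \<aa>0)
              (unit_sphere br \<theta> (eigenpart \<tau> (root_space br \<aa>0 \<alpha>) \<epsilon>))
              (natural_action (unit_sphere br \<theta> (eigenpart \<tau> (root_space br \<aa>0 \<alpha>) \<epsilon>)))) \<and>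
         irreducible_real_representation (extended_by (levi_group br \<aa>0) \<tau>)
           (root_space br \<aa>0 \<alpha>) (extended_action (root_space br \<aa>0 \<alpha>))"
proof -
  interpret cartan_pair br \<theta>
    by unfold_locales (use assms(1,3) in \<open>auto simp: semisimple_lie_algebra_def\<close>)
  have \<sigma>: "lie_involution br \<sigma>" and \<hh>: "\<hh> = {x. \<sigma> x = x}"
    using assms(2) by (auto simp: symmetric_pair_def)
  have \<theta>: "lie_involution br \<theta>" using assms(3) by (simp add: cartan_involution_def)
  \<comment> \<open>Invariance makes the two eigenspaces of \<open>\<phi>\<close> orthogonal.
    Conversely, if \<open>x\<close> is orthogonal to the fixed vectors, \<open>x + \<phi> x\<close>
    is orthogonal to everything and so vanishes.\<close>
  have perp: "killing_perp br {x. \<phi> x = x} = {x. \<phi> x = - x}" if \<phi>: "lie_involution br \<phi>" for \<phi>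
  proof -
    have lin: "linear \<phi>" and inv: "\<phi> (\<phi> y) = y" for y using \<phi> by (auto simp: lie_involution_def)
    have perp: "killing br x y = 0" if x: "\<phi> x = - x" and y: "\<phi> y = y" for x y
    proof -
      have "killing br x y = killing br ((-1) *\<^sub>R x) y"
        using killing_involution[OF \<phi>, of x y] x y by simp
      then show ?thesis unfolding killing_linear_left by simp
    qed
    have anti: "\<phi> x = - x" if x: "x \<in> killing_perp br {x. \<phi> x = x}" for x
    proof -
      define u where "u = x + \<phi> x"
      have u: "\<phi> u = u" by (simp add: u_def linear_add[OF lin] inv add.commute)
      have "killing br u y = 0" for y
      proof -
        have y: "\<phi> (y + \<phi> y) = y + \<phi> y" by (simp add: linear_add[OF lin] inv add.commute)
        have "killing br u y = killing br u (\<phi> y)" using killing_involution[OF \<phi>, of u y] u by simp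
        moreover have "killing br (\<phi> x) (y + \<phi> y) = killing br x (y + \<phi> y)"
          using killing_involution[OF \<phi>, of x "y + \<phi> y"] y by simp
        moreover have "killing br x (y + \<phi> y) = 0" using x y by (simp add: killing_perp_def)
        ultimately have "killing br u y + killing br u y = 0"
          by (simp add: u_def killing_linear_left killing_linear_right)
        then show ?thesis by simp
      qed
      \<comment> \<open>Testing against \<open>\<theta> u\<close> and using positivity of
        \<open>ip\<close> gives the nondegeneracy needed here.\<close>
      then have "u = 0" using ip_eq_0_iff[of u] by (simp add: cartan_inner_def)
      then show ?thesis by (simp add: u_def add_eq_0_iff)
    qed
    show ?thesis
    proof (rule equalityI; rule subsetI)
      fix x assume "x \<in> {x. \<phi> x = - x}"
      then show "x \<in> killing_perp br {x. \<phi> x = x}" using perp by (simp add: killing_perp_def)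
    qed (simp add: anti)
  qed
  have ab: "abelian_subspace br \<aa>0" and sub: "\<aa>0 \<subseteq> {x. \<sigma> x = - x} \<inter> {x. \<theta> x = - x}"
    and max: "\<And>T. abelian_subspace br T \<Longrightarrow> T \<subseteq> {x. \<sigma> x = - x} \<inter> {x. \<theta> x = - x} \<Longrightarrow> \<aa>0 \<subseteq> T \<Longrightarrow> T = \<aa>0"
    using assms(7) unfolding maximal_abelian_in_def \<hh> assms(5) perp[OF \<sigma>] perp[OF \<theta>] by auto
  obtain \<beta> where \<beta>: "\<beta> \<in> restricted_roots br \<aa>" "\<alpha> = restrict \<beta> \<aa>0" and nz: "\<alpha> \<noteq> (\<lambda>A\<in>\<aa>0. 0)"
    using assms(10) by (auto simp: restricted_roots_to_def)
  have "\<exists>A\<in>\<aa>0. \<alpha> A \<noteq> 0" 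
  proof (rule ccontr)
    assume "\<not> ?thesis"
    then have "\<alpha> = (\<lambda>A\<in>\<aa>0. 0)" by (auto simp: \<beta>(2) restrict_def fun_eq_iff)
    then show False using nz by contradiction
  qed
  then interpret cartan_grading br \<theta> \<aa>0 \<alpha>
    using ab sub by unfold_locales (auto simp: abelian_subspace_def)
  \<comment> \<open>The root space of \<open>\<beta>\<close> for the larger \<open>\<aa>\<close>
    lies in the one of its restriction \<open>\<alpha>\<close>.\<close>
  have nontriv: "root_space br \<aa>0 \<alpha> \<noteq> {0}"
  proof -
    have "root_space br \<aa> \<beta> \<noteq> {0}" "0 \<in> root_space br \<aa> \<beta>"
      using \<beta>(1) by (auto simp: restricted_roots_def root_space_def br_simps)
    moreover have "root_space br \<aa> \<beta> \<subseteq> root_space br \<aa>0 \<alpha>"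
      using assms(9) by (auto simp: root_space_def \<beta>(2))
    ultimately show ?thesis by blast
  qed
  have maximal: "x \<in> \<aa>0"
    if x: "x \<in> lie_centralizer br UNIV \<aa>0" "\<sigma> x = - x" "\<theta> x = - x" for x
  proof -
    have lin: "linear \<sigma>" "linear \<theta>" using \<sigma> \<theta> by (auto simp: lie_involution_def)
    \<comment> \<open>Adjoining \<open>x\<close> to \<open>\<aa>0\<close> gives an abelian subspace
      of the common -1 eigenspace, so maximality forces \<open>T = \<aa>0\<close>.\<close>
    define T where "T = {A + c *\<^sub>R x | A c. A \<in> \<aa>0}"
    have T: "T = {u + v | u v. u \<in> \<aa>0 \<and> v \<in> span {x}}"
      by (auto simp: T_def span_singleton)
    have "subspace T" unfolding T by (intro subspace_sums a0_subspace subspace_span)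
    moreover have "br (A + c *\<^sub>R x) (A' + c' *\<^sub>R x) = 0" if "A \<in> \<aa>0" "A' \<in> \<aa>0" for A A' c c'
      using that a0_abelian L_D[OF x(1)] br_anticommute[of x A'] by (simp add: br_simps)
    ultimately have "abelian_subspace br T" by (auto simp: abelian_subspace_def T_def)
    moreover have "T \<subseteq> {x. \<sigma> x = - x} \<inter> {x. \<theta> x = - x}"
      using sub x lin by (auto simp: T_def linear_add linear_scale)
    moreover have "\<aa>0 \<subseteq> T" by (force simp: T_def intro: exI[of _ 0])
    ultimately have "T = \<aa>0" by (rule max)
    moreover have "x \<in> T" using subspace_0[OF a0_subspace] by (force simp: T_def intro: exI[of _ 1])
    ultimately show ?thesis by simp
  qed
  interpret cartan_symmetric br \<theta> \<aa>0 \<alpha> \<sigma> \<tau>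
    using \<sigma> assms(4,6) sub maximal nontriv
    by unfold_locales (auto simp: fun_eq_iff)
  show ?thesis
    unfolding \<hh> assms(5)
    using GL_action finite_orbits open_orbit GC_prehomogeneous GM_transitive Gext_irreducible
    by blast
qed


end
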